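(* Let $(\mathfrak g=\mathfrak h\oplus\mathfrak m,g)$ be an irreducible naturally reductive decomposition with $\mathfrak g$ its transvection algebra. Let $$\mathfrak g=\mathfrak h^+\oplus\mathfrak h^-\oplus\mathfrak m^+\oplus\mathfrak m^-$$ be the fiber decomposition with respect to the maximal abelian ideal $\mathfrak a$ of $\mathfrak g$ (so $\mathfrak a\cap\mathfrak m=\{0\}$). Then the base space associated to $\mathfrak a$ is isomorphic to a naturally reductive decomposition $$\bigl(\mathfrak g^-=(\mathfrak h_0\oplus\mathfrak m_0)\oplus_{L.a.}\mathbb R^n,\ g|_{\mathfrak m^-\times\mathfrak m^-}\bigr)$$ with isotropy algebra $\mathfrak h_0$ and $\mathfrak m^-=\mathfrak m_0\oplus\mathbb R^n$, where $\mathfrak h_0\oplus\mathfrak m_0$ is semisimple or $\{0\}$. Moreover, $(\mathfrak g=\mathfrak h\oplus\mathfrak m,g)$ is isomorphic to the $(\varphi(\mathfrak h^+),\rho^*g|_{\mathfrak m^+\times\mathfrak m^+})$-extension of $\mathfrak g^-=\mathfrak h_0\oplus\mathfrak m^-$.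
   Context: Lie algebras are real and finite-dimensional; $\oplus_{L.a.}$ denotes a direct sum of Lie algebras. Naturally reductive decompositions. A naturally reductive decomposition $(\mathfrak g=\mathfrak h\oplus\mathfrak m,g)$ is a Lie algebra $\mathfrak g$ with a subalgebra $\mathfrak h$ (the isotropy algebra), a complement $\mathfrak m$ and an inner product $g$ on $\mathfrak m$ such that $[\mathfrak h,\mathfrak m]\subset\mathfrak m$, $g$ is $\mathrm{ad}(\mathfrak h)$-invariant (so $\mathrm{ad}:\mathfrak h\to\mathfrak{so}(\mathfrak m)$), and $g([x,y]_{\mathfrak m},z)=-g(y,[x,z]_{\mathfrak m})$ for $x,y,z\in\mathfrak m$. Its infinitesimal model is $(T,R)$ with $T(x,y)=-[x,y]_{\mathfrak m}$, $R(x,y)=-\mathrm{ad}([x,y]_{\mathfrak h})\in\mathfrak{so}(\mathfrak m)$; $T$ is regarded as a 3-form via $g$. It is effective if $\mathrm{ad}:\mathfrak h\to\mathfrak{so}(\mathfrak m)$ is injective; $\mathfrak g$ is its transvection algebra if it is effective and $\mathrm{im}(R)=\mathrm{ad}(\mathfrak h)$. It is reducible if $T\in\Lambda^3\mathfrak m_1\oplus\Lambda^3\mathfrak m_2$ for some orthogonal decomposition $\mathfrak m=\mathfrak m_1\oplus\mathfrak m_2$ with both summands non-zero; otherwise irreducible. Two decompositions are isomorphic if there is a linear isometry $\mathfrak m\to\mathfrak m'$ carrying $(T,R)$ to $(T',R')$. Fiber decomposition. An effective naturally reductive decomposition has a maximal abelian ideal (the sum of all abelian ideals, which is again abelian). For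 an abelian ideal $\mathfrak a\subset\mathfrak g$ put $\mathfrak m_{\mathfrak a}=\mathfrak a\cap\mathfrak m$, let $\mathfrak m_{\mathfrak a}^{\perp}$ be its orthogonal complement in $\mathfrak m$, $\mathfrak a'=\{x\in\mathfrak a:\pi_{\mathfrak m}(x)\in\mathfrak m_{\mathfrak a}^\perp\}$, $\mathfrak m^+=\pi_{\mathfrak m}(\mathfrak a')$, $\mathfrak m^-$ the orthogonal complement of $\mathfrak m^+$ in $\mathfrak m_{\mathfrak a}^\perp$, $\mathfrak h^+=\pi_{\mathfrak h}(\mathfrak a')$ (an ideal of $\mathfrak h$) and $\mathfrak h^-$ any ideal of $\mathfrak h$ complementary to $\mathfrak h^+$, where $\pi_{\mathfrak h},\pi_{\mathfrak m}$ are the projections of $\mathfrak g=\mathfrak h\oplus\mathfrak m$. The fiber decomposition is $\mathfrak g=\mathfrak h^+\oplus\mathfrak h^-\oplus\mathfrak m^+\oplus\mathfrak m^-\oplus\mathfrak m_{\mathfrak a}$. When $\mathfrak m_{\mathfrak a}=\{0\}$, $\mathfrak a\subset\mathfrak h^+\oplus\mathfrak m^+$ is the graph of a linear isomorphism $\rho:\mathfrak h^+\to\mathfrak m^+$; $\varphi:\mathfrak h^+\to\mathfrak{so}(\mathfrak m^-)$ is the restricted adjoint representation. The base space associated to $\mathfrak a$ is then the naturally reductive decomposition $(\mathfrak g=\mathfrak e\oplus\mathfrak m^-,g|_{\mathfrak m^-\times\mathfrak m^-})$ with isotropy algebra $\mathfrak e=\mathfrak h\oplus\mathfrak m^+$.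 The algebra $\mathfrak g^-$. Let $\mathfrak h_0\subset\mathfrak h$ be the image of $[\mathfrak m^-,\mathfrak m^-]$ under the projection onto $\mathfrak h$ along $\mathfrak a\oplus\mathfrak m^-$ in $\mathfrak g=\mathfrak h\oplus\mathfrak a\oplus\mathfrak m^-$. Then $\mathfrak a\oplus\mathfrak h_0\oplus\mathfrak m^-$ is a subalgebra with $\mathfrak a$ in its center, and $\mathfrak g^-=\mathfrak h_0\oplus\mathfrak m^-$ carries the Lie algebra structure of the quotient $(\mathfrak a\oplus\mathfrak h_0\oplus\mathfrak m^-)/\mathfrak a$. $(\mathfrak k,B)$-extensions. Let $\mathfrak g=\mathfrak h\oplus\mathfrak m$ be a naturally reductive decomposition with $\mathfrak g$ its transvection algebra, metric $g_0$ and infinitesimal model $(T_0,R_0)$. If $\mathfrak g\ne\{0\}$ set $\mathfrak s(\mathfrak g)=\{f\in\mathrm{Der}(\mathfrak g): f(\mathfrak h)=\{0\},\ f(\mathfrak m)\subset\mathfrak m,\ f|_{\mathfrak m}\in\mathfrak{so}(\mathfrak m)\}$; set $\mathfrak s(\{0\})=\mathfrak{so}(\infty)$. Let $\mathfrak k\subset\mathfrak s(\mathfrak g)$ be a finite-dimensional subalgebra with an $\mathrm{ad}(\mathfrak k)$-invariant inner product $B$. Let $\mathfrak n$ be a copy of $\mathfrak k$ with inner product $B$, $\varphi:\mathfrak k\to\mathfrak{so}(\mathfrak m)$ the natural representation, $\psi=\mathrm{ad}\oplus\varphi:\mathfrak k\to\mathfrak{so}(\mathfrak n\oplus\mathfrak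 m)$, $k_1,\dots,k_l$ an orthonormal basis of $\mathfrak k$ and $n_1,\dots,n_l$ the corresponding basis of $\mathfrak n$. On $(\mathfrak n\oplus\mathfrak m,B\oplus g_0)$ the $(\mathfrak k,B)$-extension is the naturally reductive infinitesimal model $$T=T_0+\sum_i\varphi(k_i)\wedge n_i+2T_{\mathfrak n},\qquad R=R_0+\sum_i\psi(k_i)\odot\psi(k_i),$$ where $T_{\mathfrak n}(x,y,z)=B([x,y],z)$, $T_0,R_0$ are extended by zero, a skew endomorphism $\alpha$ is identified with the 2-form $\alpha(x,y)=\langle\alpha x,y\rangle$, and $(\alpha\odot\alpha)(x,y)=\langle\alpha x,y\rangle\alpha$. A naturally reductive decomposition with this infinitesimal model is also called the $(\mathfrak k,B)$-extension. Here $\varphi(\mathfrak h^+)$ is regarded as a subalgebra of $\mathfrak s(\mathfrak g^-)$ by extending by zero on $\mathfrak h_0$, and $\rho^*g$ is transported along $\varphi$ (which is injective when $\mathfrak m^-\neq\{0\}$). If $\mathfrak m^-=\{0\}$, then $\mathfrak g^-=\{0\}$ and the extension is understood as the extension of $\{0\}$ by $(\mathfrak h^+,\rho^*g)$, with $\mathfrak h^+$ embedded in $\mathfrak{so}(\infty)$.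
   Formalization: The case dim 𝔪 = 1 is excluded: it consists only of 𝔤 = 𝔪 = ℝ with 𝔥 = {0}, which is irreducible by the literal definition but has 𝔞 = 𝔪, so 𝔞 ∩ 𝔪 = {0} and the extension claim both fail there. *)

theory Defs
  imports
    "HOL-Analysis.Analysis"
    "HOL-Library.Function_Algebras"
    "HOL-Library.Set_Algebras"
begin

text \<open>
  Functions into a real vector space form a real vector space (pointwise operations). This makes
  spaces of endomorphisms and spaces of infinite matrices available as ambient vector spaces.
\<close>

instantiation "fun" :: (type, real_vector) real_vector
begin

definition scaleR_fun :: "real \<Rightarrow> ('a \<Rightarrow> 'b) \<Rightarrow> 'a \<Rightarrow> 'b"
  where "scaleR_fun c f = (\<lambda>x. c *\<^sub>R f x)"

instance
  by standard (simp_all add: scaleR_fun_def plus_fun_def scaleR_add_right scaleR_add_left)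

end


section \<open>Linear algebra on subspaces\<close>

definition direct_sum :: "'a::real_vector set \<Rightarrow> 'a set \<Rightarrow> 'a set \<Rightarrow> bool" where
  "direct_sum V U W \<longleftrightarrow> subspace U \<and> subspace W \<and> V = U + W \<and> U \<inter> W = {0}"

text \<open>The projection of \<open>V \<oplus> W\<close> onto \<open>V\<close> along \<open>W\<close>.\<close>

definition proj_along :: "'a::real_vector set \<Rightarrow> 'a set \<Rightarrow> 'a \<Rightarrow> 'a" where
  "proj_along V W x = (THE v. v \<in> V \<and> x - v \<in> W)"

definition inner_product_on :: "'a::real_vector set \<Rightarrow> ('a \<Rightarrow> 'a \<Rightarrow> real) \<Rightarrow> bool" where
  "inner_product_on V g \<longleftrightarrow>
     (\<forall>x\<in>V. \<forall>y\<in>V. g x y = g y x) \<and>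
     (\<forall>x\<in>V. \<forall>y\<in>V. \<forall>z\<in>V. g (x + y) z = g x z + g y z) \<and>
     (\<forall>c. \<forall>x\<in>V. \<forall>y\<in>V. g (c *\<^sub>R x) y = c * g x y) \<and>
     (\<forall>x\<in>V. x \<noteq> 0 \<longrightarrow> 0 < g x x)"

definition orth_compl :: "'a::real_vector set \<Rightarrow> ('a \<Rightarrow> 'a \<Rightarrow> real) \<Rightarrow> 'a set \<Rightarrow> 'a set" where
  "orth_compl V g U = {x \<in> V. \<forall>y\<in>U. g x y = 0}"

definition orthonormal_basis :: "'a::real_vector set \<Rightarrow> ('a \<Rightarrow> 'a \<Rightarrow> real) \<Rightarrow> 'a set \<Rightarrow> bool" where
  "orthonormal_basis V g E \<longleftrightarrow>
     finite E \<and> E \<subseteq> V \<and> span E = V \<and> (\<forall>x\<in>E. \<forall>y\<in>E. g x y = (if x = y then 1 else 0))"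

definition skew_on :: "'a set \<Rightarrow> ('a \<Rightarrow> 'a \<Rightarrow> real) \<Rightarrow> ('a \<Rightarrow> 'a) \<Rightarrow> bool" where
  "skew_on V g f \<longleftrightarrow> (\<forall>x\<in>V. \<forall>y\<in>V. g (f x) y = - g x (f y))"

text \<open>
  An endomorphism of a subspace \<open>V\<close> is represented by a function that vanishes outside \<open>V\<close>, so that
  equality of endomorphisms is equality of functions.
\<close>

definition zero_outside :: "'a set \<Rightarrow> ('a \<Rightarrow> 'b::zero) \<Rightarrow> 'a \<Rightarrow> 'b" where
  "zero_outside V f = (\<lambda>x. if x \<in> V then f x else 0)"


section \<open>Lie algebras\<close>

definition lie_algebra :: "'a::real_vector set \<Rightarrow> ('a \<Rightarrow> 'a \<Rightarrow> 'a) \<Rightarrow> bool" where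
  "lie_algebra G br \<longleftrightarrow>
     subspace G \<and> (\<exists>S. finite S \<and> G = span S) \<and>
     (\<forall>x\<in>G. \<forall>y\<in>G. br x y \<in> G) \<and>
     (\<forall>x\<in>G. \<forall>y\<in>G. \<forall>z\<in>G. br (x + y) z = br x z + br y z \<and> br z (x + y) = br z x + br z y) \<and>
     (\<forall>c. \<forall>x\<in>G. \<forall>y\<in>G. br (c *\<^sub>R x) y = c *\<^sub>R br x y \<and> br x (c *\<^sub>R y) = c *\<^sub>R br x y) \<and>
     (\<forall>x\<in>G. br x x = 0) \<and>
     (\<forall>x\<in>G. \<forall>y\<in>G. \<forall>z\<in>G. br x (br y z) + br y (br z x) + br z (br x y) = 0)"

definition subalgebra :: "'a::real_vector set \<Rightarrow> ('a \<Rightarrow> 'a \<Rightarrow> 'a) \<Rightarrow> 'a set \<Rightarrow> bool" where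
  "subalgebra G br H \<longleftrightarrow> subspace H \<and> H \<subseteq> G \<and> (\<forall>x\<in>H. \<forall>y\<in>H. br x y \<in> H)"

definition lie_ideal :: "'a::real_vector set \<Rightarrow> ('a \<Rightarrow> 'a \<Rightarrow> 'a) \<Rightarrow> 'a set \<Rightarrow> bool" where
  "lie_ideal G br I \<longleftrightarrow> subspace I \<and> I \<subseteq> G \<and> (\<forall>x\<in>G. \<forall>y\<in>I. br x y \<in> I)"

definition abelian :: "'a::real_vector set \<Rightarrow> ('a \<Rightarrow> 'a \<Rightarrow> 'a) \<Rightarrow> bool" where
  "abelian G br \<longleftrightarrow> (\<forall>x\<in>G. \<forall>y\<in>G. br x y = 0)"

definition lie_direct_sum ::
  "'a::real_vector set \<Rightarrow> ('a \<Rightarrow> 'a \<Rightarrow> 'a) \<Rightarrow> 'a set \<Rightarrow> 'a set \<Rightarrow> bool" where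
  "lie_direct_sum G br I J \<longleftrightarrow> direct_sum G I J \<and> lie_ideal G br I \<and> lie_ideal G br J"

text \<open>The subspace \<open>[U, W]\<close>.\<close>

definition bracket_span ::
  "('a::real_vector \<Rightarrow> 'a \<Rightarrow> 'a) \<Rightarrow> 'a set \<Rightarrow> 'a set \<Rightarrow> 'a set" where
  "bracket_span br U W = span {br x y |x y. x \<in> U \<and> y \<in> W}"

primrec derived_series ::
  "('a::real_vector \<Rightarrow> 'a \<Rightarrow> 'a) \<Rightarrow> 'a set \<Rightarrow> nat \<Rightarrow> 'a set" where
  "derived_series br G 0 = G"
| "derived_series br G (Suc n) = bracket_span br (derived_series br G n) (derived_series br G n)"

definition solvable :: "'a::real_vector set \<Rightarrow> ('a \<Rightarrow> 'a \<Rightarrow> 'a) \<Rightarrow> bool" where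
  "solvable G br \<longleftrightarrow> (\<exists>n. derived_series br G n = {0})"

definition semisimple :: "'a::real_vector set \<Rightarrow> ('a \<Rightarrow> 'a \<Rightarrow> 'a) \<Rightarrow> bool" where
  "semisimple G br \<longleftrightarrow>
     lie_algebra G br \<and> G \<noteq> {0} \<and> (\<forall>I. lie_ideal G br I \<and> solvable I br \<longrightarrow> I = {0})"

definition max_abelian_ideal :: "'a::real_vector set \<Rightarrow> ('a \<Rightarrow> 'a \<Rightarrow> 'a) \<Rightarrow> 'a set" where
  "max_abelian_ideal G br = span (\<Union>{I. lie_ideal G br I \<and> abelian I br})"

definition ad_invariant ::
  "'a set \<Rightarrow> ('a \<Rightarrow> 'a \<Rightarrow> 'a) \<Rightarrow> ('a \<Rightarrow> 'a \<Rightarrow> real) \<Rightarrow> bool" where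
  "ad_invariant K br B \<longleftrightarrow> (\<forall>k\<in>K. skew_on K B (br k))"

definition derivations ::
  "'a::real_vector set \<Rightarrow> ('a \<Rightarrow> 'a \<Rightarrow> 'a) \<Rightarrow> ('a \<Rightarrow> 'a) set" where
  "derivations G br = {f.
     (\<forall>x. x \<notin> G \<longrightarrow> f x = 0) \<and> (\<forall>x\<in>G. f x \<in> G) \<and>
     (\<forall>x\<in>G. \<forall>y\<in>G. f (x + y) = f x + f y) \<and> (\<forall>c. \<forall>x\<in>G. f (c *\<^sub>R x) = c *\<^sub>R f x) \<and>
     (\<forall>x\<in>G. \<forall>y\<in>G. f (br x y) = br (f x) y + br x (f y))}"

definition commutator :: "('a \<Rightarrow> 'a::ab_group_add) \<Rightarrow> ('a \<Rightarrow> 'a) \<Rightarrow> 'a \<Rightarrow> 'a" where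
  "commutator f f' = (\<lambda>x. f (f' x) - f' (f x))"

text \<open>
  \<open>so(\<infinity>)\<close> is the union of the \<open>so(n)\<close>: skew-symmetric infinite matrices with only finitely many
  non-zero entries. The sum in the matrix product is finite for such matrices.
\<close>

definition so_inf :: "(nat \<Rightarrow> nat \<Rightarrow> real) set" where
  "so_inf = {S. (\<forall>i j. S i j = - S j i) \<and> (\<exists>n. \<forall>i j. n \<le> i \<or> n \<le> j \<longrightarrow> S i j = 0)}"

definition mat_prod_inf ::
  "(nat \<Rightarrow> nat \<Rightarrow> real) \<Rightarrow> (nat \<Rightarrow> nat \<Rightarrow> real) \<Rightarrow> nat \<Rightarrow> nat \<Rightarrow> real" where
  "mat_prod_inf S S' = (\<lambda>i j. \<Sum>l | S i l \<noteq> 0. S i l * S' l j)"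

definition so_inf_bracket ::
  "(nat \<Rightarrow> nat \<Rightarrow> real) \<Rightarrow> (nat \<Rightarrow> nat \<Rightarrow> real) \<Rightarrow> nat \<Rightarrow> nat \<Rightarrow> real" where
  "so_inf_bracket S S' = mat_prod_inf S S' - mat_prod_inf S' S"


section \<open>Naturally reductive decompositions and their infinitesimal models\<close>

record 'a decomp =
  alg :: "'a set"
  lbr :: "'a \<Rightarrow> 'a \<Rightarrow> 'a"
  isot :: "'a set"
  compl :: "'a set"
  met :: "'a \<Rightarrow> 'a \<Rightarrow> real"

abbreviation proj_isot :: "'a::real_vector decomp \<Rightarrow> 'a \<Rightarrow> 'a" where
  "proj_isot D \<equiv> proj_along (isot D) (compl D)"

abbreviation proj_compl :: "'a::real_vector decomp \<Rightarrow> 'a \<Rightarrow> 'a" where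
  "proj_compl D \<equiv> proj_along (compl D) (isot D)"

definition naturally_reductive :: "'a::real_vector decomp \<Rightarrow> bool" where
  "naturally_reductive D \<longleftrightarrow>
     lie_algebra (alg D) (lbr D) \<and> subalgebra (alg D) (lbr D) (isot D) \<and>
     direct_sum (alg D) (isot D) (compl D) \<and>
     inner_product_on (compl D) (met D) \<and>
     (\<forall>h\<in>isot D. \<forall>x\<in>compl D. lbr D h x \<in> compl D) \<and>
     (\<forall>h\<in>isot D. skew_on (compl D) (met D) (lbr D h)) \<and>
     (\<forall>x\<in>compl D. \<forall>y\<in>compl D. \<forall>z\<in>compl D.
        met D (proj_compl D (lbr D x y)) z = - met D y (proj_compl D (lbr D x z)))"

text \<open>
  The torsion is recorded as a 3-form. The curvature is recorded as \<open>curv x y z = R(x, y) z\<close>. Only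
  arguments in the underlying space are meaningful.
\<close>

record 'a inf_model =
  mspace :: "'a set"
  mmet :: "'a \<Rightarrow> 'a \<Rightarrow> real"
  tors :: "'a \<Rightarrow> 'a \<Rightarrow> 'a \<Rightarrow> real"
  curv :: "'a \<Rightarrow> 'a \<Rightarrow> 'a \<Rightarrow> 'a"

definition model_of :: "'a::real_vector decomp \<Rightarrow> 'a inf_model" where
  "model_of D = \<lparr>
     mspace = compl D,
     mmet = met D,
     tors = (\<lambda>x y z. met D (- proj_compl D (lbr D x y)) z),
     curv = (\<lambda>x y z. - lbr D (proj_isot D (lbr D x y)) z)\<rparr>"

text \<open>A linear map defined on a subspace extends to the whole space, whence the total map here.\<close>

definition isomorphic_models ::
  "'a::real_vector inf_model \<Rightarrow> 'b::real_vector inf_model \<Rightarrow> bool" where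
  "isomorphic_models P Q \<longleftrightarrow> (\<exists>f. linear f \<and> bij_betw f (mspace P) (mspace Q) \<and>
     (\<forall>x\<in>mspace P. \<forall>y\<in>mspace P. mmet Q (f x) (f y) = mmet P x y) \<and>
     (\<forall>x\<in>mspace P. \<forall>y\<in>mspace P. \<forall>z\<in>mspace P. tors Q (f x) (f y) (f z) = tors P x y z) \<and>
     (\<forall>x\<in>mspace P. \<forall>y\<in>mspace P. \<forall>z\<in>mspace P. curv Q (f x) (f y) (f z) = f (curv P x y z)))"

definition isomorphic_decomps :: "'a::real_vector decomp \<Rightarrow> 'b::real_vector decomp \<Rightarrow> bool" where
  "isomorphic_decomps D D' \<longleftrightarrow> isomorphic_models (model_of D) (model_of D')"

definition effective :: "'a::real_vector decomp \<Rightarrow> bool" where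
  "effective D \<longleftrightarrow> inj_on (\<lambda>h. zero_outside (compl D) (lbr D h)) (isot D)"

text \<open>
  The image of \<open>R\<close>, as a linear map on \<open>\<Lambda>\<^sup>2\<mm>\<close>, is the span of all \<open>R(x, y)\<close>.
\<close>

definition transvection :: "'a::real_vector decomp \<Rightarrow> bool" where
  "transvection D \<longleftrightarrow> naturally_reductive D \<and> effective D \<and>
     span {zero_outside (compl D) (curv (model_of D) x y) |x y. x \<in> compl D \<and> y \<in> compl D}
       = (\<lambda>h. zero_outside (compl D) (lbr D h)) ` isot D"

text \<open>
  A 3-form lies in \<open>\<Lambda>\<^sup>3M\<^sub>1 \<oplus> \<Lambda>\<^sup>3M\<^sub>2\<close> iff it is the sum of the pullbacks of its restrictions to the
  two summands.
\<close>

definition reducible :: "'a::real_vector decomp \<Rightarrow> bool" where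
  "reducible D \<longleftrightarrow> (\<exists>M1 M2. direct_sum (compl D) M1 M2 \<and> M1 \<noteq> {0} \<and> M2 \<noteq> {0} \<and>
     (\<forall>x\<in>M1. \<forall>y\<in>M2. met D x y = 0) \<and>
     (\<forall>x1\<in>M1. \<forall>x2\<in>M2. \<forall>y1\<in>M1. \<forall>y2\<in>M2. \<forall>z1\<in>M1. \<forall>z2\<in>M2.
        tors (model_of D) (x1 + x2) (y1 + y2) (z1 + z2)
          = tors (model_of D) x1 y1 z1 + tors (model_of D) x2 y2 z2))"


section \<open>The fiber decomposition, the base space and the algebra \<open>\<gg>\<^sup>-\<close>\<close>

definition a_prime :: "'a::real_vector decomp \<Rightarrow> 'a set \<Rightarrow> 'a set" where
  "a_prime D A = {x \<in> A. proj_compl D x \<in> orth_compl (compl D) (met D) (A \<inter> compl D)}"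

definition fiber_decomposition ::
  "'a::real_vector decomp \<Rightarrow> 'a set \<Rightarrow> 'a set \<Rightarrow> 'a set \<Rightarrow> 'a set \<Rightarrow> 'a set \<Rightarrow> 'a set \<Rightarrow> bool" where
  "fiber_decomposition D A Hp Hm Mp Mm Ma \<longleftrightarrow>
     Ma = A \<inter> compl D \<and>
     Mp = proj_compl D ` a_prime D A \<and>
     Mm = orth_compl (orth_compl (compl D) (met D) Ma) (met D) Mp \<and>
     Hp = proj_isot D ` a_prime D A \<and>
     lie_ideal (isot D) (lbr D) Hm \<and> direct_sum (isot D) Hp Hm"

text \<open>The isomorphism \<open>\<rho>\<close> from \<open>H\<^sup>+\<close> to \<open>M\<^sup>+\<close> whose graph is \<open>A\<close>.\<close>

definition graph_iso :: "'a::real_vector set \<Rightarrow> 'a set \<Rightarrow> 'a \<Rightarrow> 'a" where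
  "graph_iso A Mp h = (THE y. y \<in> Mp \<and> h + y \<in> A)"

definition base_space :: "'a::real_vector decomp \<Rightarrow> 'a set \<Rightarrow> 'a set \<Rightarrow> 'a decomp" where
  "base_space D Mp Mm = D\<lparr>isot := isot D + Mp, compl := Mm\<rparr>"

definition h_zero :: "'a::real_vector decomp \<Rightarrow> 'a set \<Rightarrow> 'a set \<Rightarrow> 'a set" where
  "h_zero D A Mm = proj_along (isot D) (A + Mm) ` bracket_span (lbr D) Mm Mm"

text \<open>
  The quotient of \<open>A \<oplus> (H\<^sub>0 \<oplus> M\<^sup>-)\<close> by \<open>A\<close> is identified with \<open>H\<^sub>0 \<oplus> M\<^sup>-\<close>. The bracket of the quotient
  then becomes the bracket of \<open>\<gg>\<close> followed by the projection along \<open>A\<close>.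
\<close>

definition g_minus :: "'a::real_vector decomp \<Rightarrow> 'a set \<Rightarrow> 'a set \<Rightarrow> 'a decomp" where
  "g_minus D A Mm = \<lparr>
     alg = h_zero D A Mm + Mm,
     lbr = (\<lambda>x y. proj_along (h_zero D A Mm + Mm) A (lbr D x y)),
     isot = h_zero D A Mm,
     compl = Mm,
     met = met D\<rparr>"

text \<open>
  The restricted adjoint representation \<open>\<phi>\<close> of \<open>H\<^sup>+\<close> on \<open>M\<^sup>-\<close>, extended by zero on \<open>H\<^sub>0\<close>.
\<close>

definition phi_rep :: "'a::real_vector decomp \<Rightarrow> 'a set \<Rightarrow> 'a set \<Rightarrow> 'a \<Rightarrow> 'a \<Rightarrow> 'a" where
  "phi_rep D A Mm h =
     zero_outside (h_zero D A Mm + Mm) (\<lambda>x. lbr D h (proj_along Mm (h_zero D A Mm) x))"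


section \<open>\<open>(\<kk>, B)\<close>-extensions\<close>

definition s_alg :: "'a::real_vector decomp \<Rightarrow> ('a \<Rightarrow> 'a) set" where
  "s_alg D = {f \<in> derivations (alg D) (lbr D).
     (\<forall>h\<in>isot D. f h = 0) \<and> (\<forall>x\<in>compl D. f x \<in> compl D) \<and> skew_on (compl D) (met D) f}"

text \<open>
  Admissible pairs \<open>(K, B)\<close> in an ambient, possibly infinite-dimensional, Lie algebra \<open>(S, br)\<close>.
  The predicate \<open>lie_algebra\<close> includes finite-dimensionality.
\<close>

definition extension_pair ::
  "'k::real_vector set \<Rightarrow> ('k \<Rightarrow> 'k \<Rightarrow> 'k) \<Rightarrow> 'k set \<Rightarrow> ('k \<Rightarrow> 'k \<Rightarrow> real) \<Rightarrow> bool" where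
  "extension_pair S br K B \<longleftrightarrow>
     subalgebra S br K \<and> lie_algebra K br \<and> inner_product_on K B \<and> ad_invariant K br B"

text \<open>
  The model of the extension of \<open>D\<close> by \<open>(K, B)\<close>, where \<open>K\<close> has bracket \<open>br\<close> and acts on \<open>compl D\<close> by
  \<open>act\<close>. The space \<open>\<nn> \<oplus> \<mm>\<close> is realised as \<open>K \<times> compl D\<close>. The 1-form of \<open>n\<^sub>i\<close> is \<open>B(k\<^sub>i, \<cdot>)\<close>, and
  \<open>\<alpha> \<and> \<beta>\<close> for a 2-form \<open>\<alpha>\<close> and a 1-form \<open>\<beta>\<close> is the cyclic sum
  \<open>\<alpha>(x,y) \<beta>(z) + \<alpha>(y,z) \<beta>(x) + \<alpha>(z,x) \<beta>(y)\<close>. The model does not depend on the chosen orthonormal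
  basis.
\<close>

definition extension_model ::
  "'a::real_vector decomp \<Rightarrow> 'k::real_vector set \<Rightarrow> ('k \<Rightarrow> 'k \<Rightarrow> 'k) \<Rightarrow> ('k \<Rightarrow> 'a \<Rightarrow> 'a) \<Rightarrow>
     ('k \<Rightarrow> 'k \<Rightarrow> real) \<Rightarrow> ('k \<times> 'a) inf_model" where
  "extension_model D K br act B =
     (let E = (SOME E. orthonormal_basis K B E);
          ip = (\<lambda>x y. B (fst x) (fst y) + met D (snd x) (snd y));
          phi = (\<lambda>k x y. met D (act k (snd x)) (snd y));
          psi = (\<lambda>k x. (br k (fst x), act k (snd x)))
      in \<lparr>mspace = K \<times> compl D,
          mmet = ip,
          tors = (\<lambda>x y z. tors (model_of D) (snd x) (snd y) (snd z)
             + (\<Sum>k\<in>E. phi k x y * B k (fst z) + phi k y z * B k (fst x) + phi k z x * B k (fst y))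
             + 2 * B (br (fst x) (fst y)) (fst z)),
          curv = (\<lambda>x y z. (0, curv (model_of D) (snd x) (snd y) (snd z))
             + (\<Sum>k\<in>E. ip (psi k x) y *\<^sub>R psi k z))\<rparr>)"

definition extension ::
  "'a::real_vector decomp \<Rightarrow> ('a \<Rightarrow> 'a) set \<Rightarrow> (('a \<Rightarrow> 'a) \<Rightarrow> ('a \<Rightarrow> 'a) \<Rightarrow> real)
     \<Rightarrow> (('a \<Rightarrow> 'a) \<times> 'a) inf_model" where
  "extension D K B = extension_model D K commutator (\<lambda>f. f) B"

text \<open>The extension of \<open>D\<close> in the case \<open>alg D = {0}\<close>, where \<open>K\<close> is a subalgebra of \<open>so(\<infinity>)\<close>.\<close>

definition extension_of_zero ::
  "'a::real_vector decomp \<Rightarrow> (nat \<Rightarrow> nat \<Rightarrow> real) set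
     \<Rightarrow> ((nat \<Rightarrow> nat \<Rightarrow> real) \<Rightarrow> (nat \<Rightarrow> nat \<Rightarrow> real) \<Rightarrow> real)
     \<Rightarrow> ((nat \<Rightarrow> nat \<Rightarrow> real) \<times> 'a) inf_model" where
  "extension_of_zero D K B = extension_model D K so_inf_bracket (\<lambda>_ _. 0) B"

definition lie_embedding ::
  "'a::real_vector set \<Rightarrow> ('a \<Rightarrow> 'a \<Rightarrow> 'a) \<Rightarrow> 'b::real_vector set \<Rightarrow> ('b \<Rightarrow> 'b \<Rightarrow> 'b) \<Rightarrow> ('a \<Rightarrow> 'b) \<Rightarrow> bool" where
  "lie_embedding G br S br' f \<longleftrightarrow> linear f \<and> inj_on f G \<and> f ` G \<subseteq> S \<and>
     (\<forall>x\<in>G. \<forall>y\<in>G. f (br x y) = br' (f x) (f y))"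

text \<open>The inner product on \<open>f ` V\<close> obtained by transporting \<open>b\<close> along the injection \<open>f\<close> of \<open>V\<close>.\<close>

definition transport :: "('a \<Rightarrow> 'b) \<Rightarrow> 'a set \<Rightarrow> ('a \<Rightarrow> 'a \<Rightarrow> real) \<Rightarrow> 'b \<Rightarrow> 'b \<Rightarrow> real" where
  "transport f V b = (\<lambda>u v. b (inv_into V f u) (inv_into V f v))"

end

theory Submission
  imports Defs
begin

text \<open>
  Write \<open>G = H \<oplus> M\<close>. The engine of the proof is that the metric restricts ideals severely. If \<open>x\<close> lies
  in \<open>A \<inter> M\<close> for an abelian ideal \<open>A\<close>, then \<open>[x, [x, y]] = 0\<close> for all \<open>y\<close>, while \<open>[x, \<cdot>]\<close> followed by the
  projection to \<open>M\<close> is skew; so \<open>x\<close> annihilates the torsion (\<open>abelian_ideal_meets_complement\<close>), the line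
  through \<open>x\<close> splits off, and irreducibility gives \<open>A \<inter> M = {0}\<close>. If, on the other hand, an ideal \<open>N\<close>
  meets \<open>M\<close> trivially, then effectiveness makes the projection \<open>N \<rightarrow> M\<close> injective, and the metric of \<open>M\<close>
  pulls back to an inner product on \<open>N\<close> that is invariant under all of \<open>G\<close>. Hence no element of \<open>G\<close> acts on
  \<open>N\<close> by a non-zero operator of square zero (\<open>ideal_square_free\<close>). Elements of an abelian ideal
  have \<open>(ad c)\<^sup>2 = 0\<close>, so any two abelian ideals commute and their sum \<open>A\<close> is abelian.

  \<open>A\<close> is then the graph of a map \<open>rho\<close> from an ideal \<open>Hp\<close> of \<open>H\<close> onto \<open>Mp \<subseteq> M\<close>. With \<open>Mm\<close> the
  orthogonal complement of \<open>Mp\<close>, the relations \<open>[A, A] = 0\<close> and \<open>[A, Mm] = 0\<close> determine every bracket that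
  involves \<open>Mp\<close> in terms of the action of \<open>Hp\<close> (\<open>rho_rho\<close>, \<open>A_Mm\<close>, \<open>rho_Mm\<close>), and \<open>A\<close> commutes with
  \<open>H0 \<oplus> Mm\<close>, where \<open>H0\<close> is the part of \<open>H\<close> generated by \<open>[Mm, Mm]\<close>. All statements about the base space and
  about the quotient \<open>(A \<oplus> H0 \<oplus> Mm) / A\<close> are read off from these relations, and so is the model of \<open>D\<close>:
  its torsion and curvature are those of an extension, the component of \<open>[x, y]\<close> along \<open>A\<close> for
  \<open>x, y \<in> Mm\<close> being dual to the action of \<open>Hp\<close> (\<open>bracket_M\<close>, \<open>isomorphic_extension\<close>).

  For semisimplicity, split the center \<open>V\<close> of \<open>H0 \<oplus> Mm\<close> inside \<open>Mm\<close> off. The abelian ideals of what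
  remains meet \<open>Mm\<close> trivially, so they commute with each other; let \<open>J\<close> be their sum. A derivation \<open>d\<close>
  compatible with the metric preserves \<open>J\<close>, because \<open>B + d B\<close> is an abelian ideal whenever \<open>B\<close> is one
  (\<open>derivation_translate_abelian_ideal\<close>). Thus \<open>J\<close> is invariant under \<open>H\<close>, and \<open>A + J\<close> is an ideal of
  \<open>G\<close>. It is abelian, because the obstruction is the action of \<open>Hp\<close> on the \<open>Mm\<close>-components of \<open>J\<close>, which
  maps into \<open>J \<inter> Mm = {0}\<close>. Maximality of \<open>A\<close> forces \<open>J = {0}\<close> (\<open>no_abelian_radical\<close>).
\<close>


section \<open>Linear algebra on subspaces\<close>

lemma proj_along_eq:
  assumes "subspace U" "subspace W" "U \<inter> W = {0}" "v \<in> U" "x - v \<in> W"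
  shows "proj_along U W x = v"
  unfolding proj_along_def
proof (rule the_equality)
  show "v \<in> U \<and> x - v \<in> W" using assms by blast
next
  fix u assume u: "u \<in> U \<and> x - u \<in> W"
  have 1: "u - v \<in> U" using u assms subspace_diff by blast
  have "(x - v) - (x - u) \<in> W" using u assms(5) subspace_diff[OF assms(2)] by blast
  moreover have "(x - v) - (x - u) = u - v" by simp
  ultimately have "u - v \<in> W" by simp
  with 1 have "u - v \<in> U \<inter> W" by blast
  thus "u = v" unfolding assms(3) by simp
qed

lemma proj_along_add:
  assumes "subspace U" "subspace W" "U \<inter> W = {0}" "u \<in> U" "w \<in> W"
  shows "proj_along U W (u + w) = u" "proj_along W U (u + w) = w"
proof -
  show "proj_along U W (u + w) = u" by (rule proj_along_eq[OF assms(1-4)]) (simp add: assms)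
  have "W \<inter> U = {0}" using assms(3) by blast
  thus "proj_along W U (u + w) = w"
    by (rule proj_along_eq[OF assms(2,1) _ assms(5)]) (simp add: assms)
qed

lemma direct_sum_elim:
  assumes "direct_sum V U W" "x \<in> V"
  obtains u w where "u \<in> U" "w \<in> W" "x = u + w"
  using assms unfolding direct_sum_def by (auto elim: set_plus_elim)

lemma direct_sumI:
  assumes "subspace V" "subspace U" "subspace W" "U \<subseteq> V" "W \<subseteq> V" "U \<inter> W = {0}"
    and "\<And>x. x \<in> V \<Longrightarrow> \<exists>u\<in>U. \<exists>w\<in>W. x = u + w"
  shows "direct_sum V U W"
proof -
  have "V = U + W"
  proof
    show "V \<subseteq> U + W" using assms(7) by (auto simp: set_plus_def)
    show "U + W \<subseteq> V" using assms by (auto simp: set_plus_def subset_iff intro!: subspace_add)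
  qed
  thus ?thesis using assms by (simp add: direct_sum_def)
qed

lemma subspace_set_plus:
  assumes "subspace U" "subspace W"
  shows "subspace (U + W)"
proof -
  have "U + W = {x + y |x y. x \<in> U \<and> y \<in> W}" by (auto simp: set_plus_def)
  thus ?thesis using subspace_sums[OF assms] by simp
qed

lemma set_plus_left: "subspace (W::'a::real_vector set) \<Longrightarrow> U \<subseteq> U + W"
  using set_zero_plus2[of W U] subspace_0[of W] by (simp add: add.commute)

lemma set_plus_right: "subspace (U::'a::real_vector set) \<Longrightarrow> W \<subseteq> U + W"
  using set_zero_plus2[of U W] subspace_0[of U] by simp

abbreviation fin_spanned :: "'a::real_vector set \<Rightarrow> bool" where
  "fin_spanned V \<equiv> \<exists>S. finite S \<and> V = span S"

lemma fin_spanned_subspace: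
  assumes "fin_spanned V" "subspace U" "U \<subseteq> V"
  shows "fin_spanned U"
proof -
  obtain B where B: "B \<subseteq> U" "independent B" "U \<subseteq> span B" "card B = dim U"
    by (rule basis_exists)
  obtain S where "finite S" "V = span S" using assms by blast
  hence "finite B" using independent_span_bound[of S B] B assms by blast
  moreover have "U = span B" using B(3) span_minimal[OF B(1) assms(2)] by (rule subset_antisym)
  ultimately show ?thesis by blast
qed

text \<open>Brackets and projections along a subspace are linear on their carriers only, whence linearity
  relative to a subspace.\<close>

definition lin_on :: "'a::real_vector set \<Rightarrow> ('a \<Rightarrow> 'b::real_vector) \<Rightarrow> bool" where
  "lin_on V f \<longleftrightarrow> (\<forall>x\<in>V. \<forall>y\<in>V. f (x + y) = f x + f y) \<and> (\<forall>c. \<forall>x\<in>V. f (c *\<^sub>R x) = c *\<^sub>R f x)"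

lemma lin_onI:
  assumes "\<And>x y. x \<in> V \<Longrightarrow> y \<in> V \<Longrightarrow> f (x + y) = f x + f y"
    and "\<And>c x. x \<in> V \<Longrightarrow> f (c *\<^sub>R x) = c *\<^sub>R f x"
  shows "lin_on V f"
  using assms by (simp add: lin_on_def)

text \<open>The extension is \<open>f\<close> composed with a linear projection of the whole space onto \<open>V\<close>.\<close>

lemma lin_on_extend:
  assumes "subspace V" "lin_on V f"
  obtains F where "linear F" "\<And>x. x \<in> V \<Longrightarrow> F x = f x"
proof -
  obtain P where P: "P ` UNIV \<subseteq> V" "linear P" "\<forall>v\<in>V. P v = v"
    using real_vector.linear_exists_left_inverse_on[of "\<lambda>x. x" V] assms(1)
    by (auto simp: linear_iff[symmetric] module_hom_ident linear_def[symmetric]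
        real_vector.linear_ident inj_on_def)
  have PV: "P x \<in> V" for x using P(1) by blast
  have "linear (\<lambda>x. f (P x))"
    by (rule linearI)
      (use PV assms(2) in \<open>auto simp: linear_add[OF P(2)] linear_scale[OF P(2)] lin_on_def\<close>)
  thus thesis using that[of "\<lambda>x. f (P x)"] P by auto
qed

lemma lin_on_0: "subspace V \<Longrightarrow> lin_on V f \<Longrightarrow> f 0 = 0"
  unfolding lin_on_def by (metis scaleR_zero_left subspace_0)

lemma lin_on_diff:
  assumes "subspace V" "lin_on V f" "x \<in> V" "y \<in> V"
  shows "f (x - y) = f x - f y"
proof -
  have "f (x - y) + f y = f (x - y + y)"
    using assms subspace_diff unfolding lin_on_def by metis
  thus ?thesis by (simp add: eq_diff_eq)
qed

lemma lin_on_subspace_image: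
  assumes "subspace V" "lin_on V f"
  shows "subspace (f ` V)"
proof -
  obtain F where F: "linear F" "\<And>x. x \<in> V \<Longrightarrow> F x = f x" using lin_on_extend[OF assms] by blast
  have "f ` V = F ` V" using F(2) by auto
  thus ?thesis using linear_subspace_image[OF F(1) assms(1)] by simp
qed

lemma lin_on_fin_spanned_image:
  assumes "fin_spanned V" "lin_on V f"
  shows "fin_spanned (f ` V)"
proof -
  have "subspace V" using assms(1) by auto
  from lin_on_extend[OF this assms(2)]
  obtain F where F: "linear F" "\<And>x. x \<in> V \<Longrightarrow> F x = f x" by blast
  obtain S where S: "finite S" "V = span S" using assms(1) by blast
  have "f ` V = F ` V" using F(2) by auto
  also have "\<dots> = span (F ` S)" using S(2) linear_span_image[OF F(1)] by simp
  finally show ?thesis using S(1) by blast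
qed

lemma lin_on_sum_scaleR:
  assumes "subspace V" "lin_on V f" "finite E" "\<And>e. e \<in> E \<Longrightarrow> u e \<in> V"
  shows "f (\<Sum>e\<in>E. c e *\<^sub>R u e) = (\<Sum>e\<in>E. c e *\<^sub>R f (u e))"
proof -
  obtain F where F: "linear F" "\<And>x. x \<in> V \<Longrightarrow> F x = f x"
    using lin_on_extend[OF assms(1,2)] by blast
  have "(\<Sum>e\<in>E. c e *\<^sub>R u e) \<in> V"
    using assms by (auto intro!: subspace_sum subspace_scale)
  hence "f (\<Sum>e\<in>E. c e *\<^sub>R u e) = F (\<Sum>e\<in>E. c e *\<^sub>R u e)" using F by simp
  also have "\<dots> = (\<Sum>e\<in>E. c e *\<^sub>R F (u e))" by (simp add: linear_sum[OF F(1)] linear_scale[OF F(1)])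
  also have "\<dots> = (\<Sum>e\<in>E. c e *\<^sub>R f (u e))" using F(2) assms(4) by simp
  finally show ?thesis .
qed

lemma span_in_subspace_image:
  assumes "lin_on (span S) f" "subspace W" "\<And>s. s \<in> S \<Longrightarrow> f s \<in> W" "x \<in> span S"
  shows "f x \<in> W"
proof -
  obtain F where F: "linear F" "\<And>x. x \<in> span S \<Longrightarrow> F x = f x"
    using lin_on_extend[OF subspace_span assms(1)] by blast
  have "F x \<in> span (F ` S)" using assms(4) linear_span_image[OF F(1), of S] by blast
  moreover have "F ` S \<subseteq> W" using F(2) assms(3) by (auto simp: span_base)
  ultimately have "F x \<in> W" using span_minimal assms(2) by blast
  thus ?thesis using F(2) assms(4) by simp
qed


lemma proj_along_lin:
  assumes "subspace U" "subspace W" "U \<inter> W = {0}"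
  shows "lin_on (U + W) (proj_along U W)" "lin_on (U + W) (proj_along W U)"
proof -
  note p = proj_along_add[OF assms]
  have "proj_along U W (x + y) = proj_along U W x + proj_along U W y \<and>
      proj_along W U (x + y) = proj_along W U x + proj_along W U y"
    if xy: "x \<in> U + W" "y \<in> U + W" for x y
  proof -
    obtain u w where x: "u \<in> U" "w \<in> W" "x = u + w" using xy(1) by (rule set_plus_elim)
    obtain u' w' where y: "u' \<in> U" "w' \<in> W" "y = u' + w'" using xy(2) by (rule set_plus_elim)
    have e: "x + y = (u + u') + (w + w')" using x(3) y(3) by (simp add: add_ac)
    have "u + u' \<in> U" "w + w' \<in> W"
      using subspace_add[OF assms(1) x(1) y(1)] subspace_add[OF assms(2) x(2) y(2)] .
    hence "proj_along U W (x + y) = u + u'" "proj_along W U (x + y) = w + w'"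
      unfolding e by (rule p)+
    moreover have "proj_along U W x = u" "proj_along W U x = w" unfolding x(3) by (rule p[OF x(1,2)])+
    moreover have "proj_along U W y = u'" "proj_along W U y = w'" unfolding y(3) by (rule p[OF y(1,2)])+
    ultimately show ?thesis by (simp only:)
  qed
  moreover have "proj_along U W (c *\<^sub>R x) = c *\<^sub>R proj_along U W x \<and>
      proj_along W U (c *\<^sub>R x) = c *\<^sub>R proj_along W U x"
    if x: "x \<in> U + W" for c x
  proof -
    obtain u w where x: "u \<in> U" "w \<in> W" "x = u + w" using x by (rule set_plus_elim)
    have e: "c *\<^sub>R x = c *\<^sub>R u + c *\<^sub>R w" using x(3) by (simp add: scaleR_add_right)
    have "c *\<^sub>R u \<in> U" "c *\<^sub>R w \<in> W"
      using subspace_scale[OF assms(1) x(1)] subspace_scale[OF assms(2) x(2)] .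
    hence "proj_along U W (c *\<^sub>R x) = c *\<^sub>R u" "proj_along W U (c *\<^sub>R x) = c *\<^sub>R w"
      unfolding e by (rule p)+
    moreover have "proj_along U W x = u" "proj_along W U x = w" unfolding x(3) by (rule p[OF x(1,2)])+
    ultimately show ?thesis by (simp only:)
  qed
  ultimately show "lin_on (U + W) (proj_along U W)" "lin_on (U + W) (proj_along W U)"
    by (simp_all add: lin_on_def)
qed


section \<open>Inner products on subspaces\<close>

locale ip_space =
  fixes V :: "'a::real_vector set" and g :: "'a \<Rightarrow> 'a \<Rightarrow> real"
  assumes fin: "fin_spanned V" and ip: "inner_product_on V g"
begin

lemma V_sub: "subspace V"
  using fin by auto

lemma ip_sym: "x \<in> V \<Longrightarrow> y \<in> V \<Longrightarrow> g x y = g y x"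
  using ip by (simp add: inner_product_on_def)

lemma ip_add_left: "x \<in> V \<Longrightarrow> y \<in> V \<Longrightarrow> z \<in> V \<Longrightarrow> g (x + y) z = g x z + g y z"
  using ip by (simp add: inner_product_on_def)

lemma ip_add_right: "x \<in> V \<Longrightarrow> y \<in> V \<Longrightarrow> z \<in> V \<Longrightarrow> g z (x + y) = g z x + g z y"
  using ip_add_left ip_sym V_sub subspace_add by metis

lemma ip_scale_left: "x \<in> V \<Longrightarrow> y \<in> V \<Longrightarrow> g (c *\<^sub>R x) y = c * g x y"
  using ip by (simp add: inner_product_on_def)

lemma ip_scale_right: "x \<in> V \<Longrightarrow> y \<in> V \<Longrightarrow> g x (c *\<^sub>R y) = c * g x y"
  using ip_scale_left ip_sym V_sub subspace_scale by metis

lemma ip_zero_left: "x \<in> V \<Longrightarrow> g 0 x = 0"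
  using ip_scale_left[of 0 x 0] subspace_0[OF V_sub] by simp

lemma ip_zero_right: "x \<in> V \<Longrightarrow> g x 0 = 0"
  using ip_scale_right[of x 0 0] subspace_0[OF V_sub] by simp

lemma ip_neg_left: "x \<in> V \<Longrightarrow> y \<in> V \<Longrightarrow> g (- x) y = - g x y"
  using ip_scale_left[of x y "-1"] by simp

lemma ip_neg_right: "x \<in> V \<Longrightarrow> y \<in> V \<Longrightarrow> g x (- y) = - g x y"
  using ip_scale_right[of x y "-1"] by simp

lemma ip_diff_left: "x \<in> V \<Longrightarrow> y \<in> V \<Longrightarrow> z \<in> V \<Longrightarrow> g (x - y) z = g x z - g y z"
  using ip_add_left[of x "-y" z] ip_neg_left[of y z] subspace_neg[OF V_sub] by simp

lemma ip_diff_right: "x \<in> V \<Longrightarrow> y \<in> V \<Longrightarrow> z \<in> V \<Longrightarrow> g z (x - y) = g z x - g z y"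
  using ip_add_right[of x "-y" z] ip_neg_right[of z y] subspace_neg[OF V_sub] by simp

lemmas ip_simps = ip_add_left ip_add_right ip_scale_left ip_scale_right ip_zero_left ip_zero_right
  ip_neg_left ip_neg_right ip_diff_left ip_diff_right

lemma ip_pos: "x \<in> V \<Longrightarrow> x \<noteq> 0 \<Longrightarrow> 0 < g x x"
  using ip by (simp add: inner_product_on_def)

lemma ip_eq_0: "x \<in> V \<Longrightarrow> g x x = 0 \<Longrightarrow> x = 0"
  using ip_pos by force

lemma ip_sum_left:
  assumes "finite E" "\<And>e. e \<in> E \<Longrightarrow> u e \<in> V" "y \<in> V"
  shows "g (\<Sum>e\<in>E. u e) y = (\<Sum>e\<in>E. g (u e) y)"
  using assms(1,2)
proof (induction E)
  case empty
  thus ?case using assms(3) by (simp add: ip_zero_left)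
next
  case (insert a E)
  thus ?case using assms(3) by (simp add: ip_add_left subspace_sum[OF V_sub])
qed

lemma ip_span_zero:
  assumes "S \<subseteq> V" "y \<in> V" "\<And>s. s \<in> S \<Longrightarrow> g s y = 0" "x \<in> span S"
  shows "g x y = 0"
proof -
  have "span S \<subseteq> {v \<in> V. g v y = 0}"
  proof (rule span_minimal)
    show "subspace {v \<in> V. g v y = 0}"
      using V_sub assms(2) by (auto simp: subspace_def ip_simps)
    show "S \<subseteq> {v \<in> V. g v y = 0}" using assms by auto
  qed
  thus ?thesis using assms(4) by auto
qed

lemma orthonormal_coefficient:
  assumes "finite E" "E \<subseteq> V" "e \<in> E"
    and "\<And>x y. x \<in> E \<Longrightarrow> y \<in> E \<Longrightarrow> g x y = (if x = y then 1 else 0)"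
  shows "g (\<Sum>x\<in>E. c x *\<^sub>R x) e = c e"
proof -
  have "g (\<Sum>x\<in>E. c x *\<^sub>R x) e = (\<Sum>x\<in>E. g (c x *\<^sub>R x) e)"
    using assms(1-3) V_sub by (intro ip_sum_left) (auto intro: subspace_scale)
  also have "\<dots> = (\<Sum>x\<in>E. if x = e then c x else 0)"
    using assms(2-4) by (intro sum.cong) (auto simp: ip_scale_left subset_iff)
  also have "\<dots> = c e" using assms(1,3) by simp
  finally show ?thesis .
qed

lemma sum_scale_in_span: "(\<Sum>e\<in>E. c e *\<^sub>R e) \<in> span E"
  by (intro span_sum span_scale span_base)

text \<open>This is the Gram--Schmidt process: the new vector is the normalised residual of \<open>a\<close>, unless \<open>a\<close>
  lies in the span already.\<close>

lemma orthonormal_basis_span: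
  assumes "finite S" "S \<subseteq> V"
  shows "\<exists>E. orthonormal_basis (span S) g E"
  using assms
proof (induction S)
  case empty
  have "orthonormal_basis (span {}) g {}"
    unfolding orthonormal_basis_def by simp
  thus ?case by blast
next
  case (insert a S)
  then obtain E where E: "orthonormal_basis (span S) g E" by auto
  have E1: "finite E" "span E = span S" "\<And>x y. x \<in> E \<Longrightarrow> y \<in> E \<Longrightarrow> g x y = (if x = y then 1 else 0)"
    using E by (auto simp: orthonormal_basis_def)
  have EV: "E \<subseteq> V"
    using E insert.prems span_minimal[OF _ V_sub, of S] by (auto simp: orthonormal_basis_def)
  have aV: "a \<in> V" using insert by simp
  define p where "p = (\<Sum>e\<in>E. g a e *\<^sub>R e)"
  have pE: "p \<in> span E" unfolding p_def by (rule sum_scale_in_span)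
  have pV: "p \<in> V" using pE EV span_minimal[OF _ V_sub] by blast
  have gp: "g p e = g a e" if "e \<in> E" for e
    unfolding p_def using orthonormal_coefficient[OF E1(1) EV that E1(3)] by simp
  define r where "r = a - p"
  have rV: "r \<in> V" using aV pV V_sub subspace_diff unfolding r_def by blast
  show ?case
  proof (cases "r = 0")
    case True
    hence "a \<in> span S" using pE E1(2) by (simp add: r_def)
    hence "span (insert a S) = span S" by (rule span_redundant)
    thus ?thesis using E by auto
  next
    case False
    define n where "n = r /\<^sub>R sqrt (g r r)"
    have pos: "0 < g r r" using False rV ip_pos by blast
    have nV: "n \<in> V" unfolding n_def using rV V_sub subspace_scale by blast
    have nn: "g n n = 1" unfolding n_def using rV pos V_sub
      by (simp add: ip_simps subspace_scale field_simps flip: power2_eq_square)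
    have ne: "g n e = 0" "g e n = 0" if "e \<in> E" for e
    proof -
      have "e \<in> V" using that EV by blast
      thus "g n e = 0" using gp[OF that] rV aV pV unfolding n_def
        by (simp add: ip_simps r_def)
      thus "g e n = 0" using ip_sym[OF nV \<open>e \<in> V\<close>] by simp
    qed
    have "span (insert n E) = span (insert a S)"
    proof (rule span_eq[THEN iffD2], intro conjI subsetI)
      fix x assume x: "x \<in> insert n E"
      have ES: "span E \<subseteq> span (insert a S)" using E1(2) by (simp add: span_mono subset_insertI)
      have "n \<in> span (insert a S)" unfolding n_def r_def
        using pE ES by (auto intro!: span_scale span_diff simp: span_base)
      thus "x \<in> span (insert a S)" using x ES span_base by blast
    next
      fix x assume x: "x \<in> insert a S"
      have r_eq: "r = sqrt (g r r) *\<^sub>R n" using pos by (simp add: n_def)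
      have SE: "span S \<subseteq> span (insert n E)" using E1(2) by (metis span_mono subset_insertI)
      have "a = p + sqrt (g r r) *\<^sub>R n" using r_eq by (simp add: r_def)
      moreover have "p \<in> span (insert n E)" using pE span_mono subset_insertI by blast
      ultimately have "a \<in> span (insert n E)"
        by (metis insertI1 span_add span_base span_scale)
      thus "x \<in> span (insert n E)" using x SE span_base by blast
    qed
    moreover have "n \<notin> E" using nn ne(1)[of n] by auto
    ultimately have "orthonormal_basis (span (insert a S)) g (insert n E)"
      unfolding orthonormal_basis_def using E1 nn ne by (auto intro: span_base)
    thus ?thesis by blast
  qed
qed

lemma orthonormal_basis_exists: "\<exists>E. orthonormal_basis V g E"
  using fin orthonormal_basis_span span_superset by metis

lemma subspace_ip_space:
  assumes "subspace U" "U \<subseteq> V"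
  shows "ip_space U g"
  using assms ip fin_spanned_subspace[OF fin assms]
  by unfold_locales (auto simp: inner_product_on_def subset_iff)

text \<open>The partial Fourier sum is the orthogonal projection to the span of the orthonormal set.\<close>

lemma orthonormal_residual:
  assumes E: "orthonormal_basis U g E" and U: "U \<subseteq> V" and x: "x \<in> V"
  defines "p \<equiv> \<Sum>e\<in>E. g x e *\<^sub>R e"
  shows "p \<in> U" "x - p \<in> orth_compl V g U"
proof -
  have E1: "finite E" "span E = U" "E \<subseteq> V"
    "\<And>x y. x \<in> E \<Longrightarrow> y \<in> E \<Longrightarrow> g x y = (if x = y then 1 else 0)"
    using E U by (auto simp: orthonormal_basis_def)
  show pU: "p \<in> U" unfolding p_def using sum_scale_in_span[of "g x" E] E1(2) by simp
  hence pV: "p \<in> V" using U by blast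
  have rV: "x - p \<in> V" using x pV V_sub subspace_diff by blast
  have e: "g e (x - p) = 0" if "e \<in> E" for e
  proof -
    have eV: "e \<in> V" using that E1 by blast
    have "g p e = g x e" unfolding p_def using orthonormal_coefficient[OF E1(1,3) that E1(4)] by simp
    thus ?thesis using x pV eV ip_sym by (simp add: ip_diff_right)
  qed
  have "g (x - p) u = 0" if u: "u \<in> U" for u
  proof -
    have "g u (x - p) = 0" by (rule ip_span_zero[OF E1(3) rV e]) (use u E1(2) in auto)
    thus ?thesis using ip_sym[OF _ rV, of u] u U by auto
  qed
  thus "x - p \<in> orth_compl V g U" using rV by (simp add: orth_compl_def)
qed

lemma orthonormal_expansion:
  assumes E: "orthonormal_basis V g E" and x: "x \<in> V"
  shows "x = (\<Sum>e\<in>E. g x e *\<^sub>R e)"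
proof -
  let ?r = "x - (\<Sum>e\<in>E. g x e *\<^sub>R e)"
  have "?r \<in> V" "g ?r ?r = 0"
    using orthonormal_residual(2)[OF E subset_refl x] by (auto simp: orth_compl_def)
  hence "?r = 0" by (rule ip_eq_0)
  thus ?thesis by simp
qed

lemma orth_subspace: 
  assumes "U \<subseteq> V"
  shows "subspace (orth_compl V g U)"
  using V_sub assms by (auto simp: subspace_def orth_compl_def ip_simps subset_iff)

lemma orth_inter:
  assumes "subspace U" "U \<subseteq> V"
  shows "U \<inter> orth_compl V g U = {0}"
  using assms ip_eq_0 subspace_0[OF assms(1)] subspace_0[OF orth_subspace[OF assms(2)]]
  by (auto simp: orth_compl_def)

lemma orth_decomp:
  assumes "subspace U" "U \<subseteq> V" "x \<in> V"
  shows "\<exists>u\<in>U. \<exists>w\<in>orth_compl V g U. x = u + w"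
proof -
  interpret U: ip_space U g by (rule subspace_ip_space[OF assms(1,2)])
  obtain E where E: "orthonormal_basis U g E" using U.orthonormal_basis_exists by blast
  show ?thesis
    by (rule bexI[OF bexI[OF _ orthonormal_residual(2)[OF E assms(2,3)]]
          orthonormal_residual(1)[OF E assms(2,3)]]) simp
qed

lemma orth_direct_sum:
  assumes "subspace U" "U \<subseteq> V"
  shows "direct_sum V U (orth_compl V g U)"
  using assms V_sub orth_subspace[OF assms(2)] orth_inter[OF assms] orth_decomp[OF assms]
  by (intro direct_sumI) (auto simp: orth_compl_def)

end

section \<open>Lie algebras, abelian ideals and derivations\<close>

locale lie =
  fixes G :: "'a::real_vector set" and br :: "'a \<Rightarrow> 'a \<Rightarrow> 'a"
  assumes lie: "lie_algebra G br"
begin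

lemma G_sub: "subspace G" and G_fin: "fin_spanned G"
  using lie by (simp_all add: lie_algebra_def)

lemmas G_closed = subspace_0[OF G_sub] subspace_add[OF G_sub] subspace_scale[OF G_sub]
  subspace_diff[OF G_sub] subspace_neg[OF G_sub]

lemma br_in: "x \<in> G \<Longrightarrow> y \<in> G \<Longrightarrow> br x y \<in> G"
  using lie by (simp add: lie_algebra_def)

lemma br_add_left: "x \<in> G \<Longrightarrow> y \<in> G \<Longrightarrow> z \<in> G \<Longrightarrow> br (x + y) z = br x z + br y z"
  and br_add_right: "x \<in> G \<Longrightarrow> y \<in> G \<Longrightarrow> z \<in> G \<Longrightarrow> br z (x + y) = br z x + br z y"
  using lie by (simp_all add: lie_algebra_def)

lemma br_scale_left: "x \<in> G \<Longrightarrow> y \<in> G \<Longrightarrow> br (c *\<^sub>R x) y = c *\<^sub>R br x y"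
  and br_scale_right: "x \<in> G \<Longrightarrow> y \<in> G \<Longrightarrow> br x (c *\<^sub>R y) = c *\<^sub>R br x y"
  using lie by (simp_all add: lie_algebra_def)

lemma br_self: "x \<in> G \<Longrightarrow> br x x = 0"
  using lie by (simp add: lie_algebra_def)

lemma br_zero_left: "x \<in> G \<Longrightarrow> br 0 x = 0" and br_zero_right: "x \<in> G \<Longrightarrow> br x 0 = 0"
  using br_scale_left[of 0 x 0] br_scale_right[of x 0 0] G_closed(1) by simp_all

lemma br_neg_left: "x \<in> G \<Longrightarrow> y \<in> G \<Longrightarrow> br (- x) y = - br x y"
  and br_neg_right: "x \<in> G \<Longrightarrow> y \<in> G \<Longrightarrow> br x (- y) = - br x y"
  using br_scale_left[of x y "-1"] br_scale_right[of x y "-1"] by simp_all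

lemma br_diff_left: "x \<in> G \<Longrightarrow> y \<in> G \<Longrightarrow> z \<in> G \<Longrightarrow> br (x - y) z = br x z - br y z"
  and br_diff_right: "x \<in> G \<Longrightarrow> y \<in> G \<Longrightarrow> z \<in> G \<Longrightarrow> br z (x - y) = br z x - br z y"
  using br_add_left[of x "-y" z] br_add_right[of x "-y" z] br_neg_left[of y z] br_neg_right[of z y]
    G_closed(5) by simp_all

lemmas br_simps = br_add_left br_add_right br_scale_left br_scale_right br_zero_left br_zero_right
  br_neg_left br_neg_right br_diff_left br_diff_right

lemma br_anti:
  assumes "x \<in> G" "y \<in> G"
  shows "br x y = - br y x"
proof -
  have "br (x + y) (x + y) = br x x + br y x + (br x y + br y y)"
    using assms G_closed(2) by (simp add: br_add_left br_add_right)
  hence "br y x + br x y = 0" using assms br_self G_closed(2) by simp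
  thus ?thesis by (simp add: eq_neg_iff_add_eq_0 add.commute)
qed

lemma jacobi:
  assumes "x \<in> G" "y \<in> G" "z \<in> G"
  shows "br x (br y z) = br (br x y) z + br y (br x z)"
proof -
  have 1: "br x (br y z) + br y (br z x) + br z (br x y) = 0"
    using lie assms by (simp add: lie_algebra_def)
  have "br y (br z x) = br y (- br x z)"
    by (rule arg_cong[OF br_anti[OF assms(3,1)]])
  hence 2: "br y (br z x) = - br y (br x z)"
    using br_neg_right[OF assms(2) br_in[OF assms(1,3)]] by (rule trans)
  have 3: "br z (br x y) = - br (br x y) z"
    by (rule br_anti[OF assms(3) br_in[OF assms(1,2)]])
  have "br x (br y z) - br y (br x z) - br (br x y) z = 0" using 1 unfolding 2 3 by simp
  thus ?thesis by (simp add: diff_eq_eq)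
qed

lemma br_lin: "x \<in> G \<Longrightarrow> U \<subseteq> G \<Longrightarrow> lin_on U (br x)"
  by (auto intro!: lin_onI simp: br_simps subset_iff)

lemma br_span_in:
  assumes "S \<subseteq> G" "x \<in> G" "subspace W" "\<And>s. s \<in> S \<Longrightarrow> br x s \<in> W" "y \<in> span S"
  shows "br x y \<in> W"
  by (rule span_in_subspace_image[of S "br x", OF _ assms(3-5)])
    (use assms(1,2) span_minimal[OF _ G_sub] br_lin in auto)

lemma idealD:
  assumes "lie_ideal G br I"
  shows "subspace I" "I \<subseteq> G" "x \<in> G \<Longrightarrow> y \<in> I \<Longrightarrow> br x y \<in> I" "x \<in> G \<Longrightarrow> y \<in> I \<Longrightarrow> br y x \<in> I"
proof -
  show *: "subspace I" "I \<subseteq> G" "x \<in> G \<Longrightarrow> y \<in> I \<Longrightarrow> br x y \<in> I" for x y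
    using assms by (auto simp: lie_ideal_def)
  show "x \<in> G \<Longrightarrow> y \<in> I \<Longrightarrow> br y x \<in> I"
    using *(2) *(3)[of x y] subspace_neg[OF *(1)] br_anti[of y x] by auto
qed

lemma subalgebra_lie:
  assumes "subalgebra G br H"
  shows "lie_algebra H br"
proof -
  have "subspace H" "H \<subseteq> G" using assms by (auto simp: subalgebra_def)
  thus ?thesis using assms lie fin_spanned_subspace[OF G_fin]
    by (auto simp: lie_algebra_def subalgebra_def subset_iff)
qed

lemma bracket_span_ideal:
  assumes "lie_ideal G br I" "lie_ideal G br J"
  shows "lie_ideal G br (bracket_span br I J)"
proof -
  let ?S = "{br x y |x y. x \<in> I \<and> y \<in> J}"
  have S: "?S \<subseteq> G" using idealD[OF assms(1)] idealD[OF assms(2)] br_in by blast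
  have "br x s \<in> span ?S" if x: "x \<in> G" and s: "s \<in> span ?S" for x s
  proof (rule br_span_in[OF S x _ _ s])
    fix s assume "s \<in> ?S"
    then obtain y z where yz: "y \<in> I" "z \<in> J" "s = br y z" by blast
    have "br x s = br (br x y) z + br y (br x z)"
      using yz x idealD(2)[OF assms(1)] idealD(2)[OF assms(2)] jacobi by blast
    moreover have "br (br x y) z \<in> span ?S" "br y (br x z) \<in> span ?S"
      using yz(1,2) idealD(3)[OF assms(1) x yz(1)] idealD(3)[OF assms(2) x yz(2)]
      by (blast intro: span_base)+
    ultimately show "br x s \<in> span ?S" by (simp add: span_add)
  qed simp
  thus ?thesis using S span_minimal[OF S G_sub] by (auto simp: lie_ideal_def bracket_span_def)
qed

lemma derived_series_ideal:
  assumes "lie_ideal G br I"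
  shows "lie_ideal G br (derived_series br I n)"
  using assms by (induction n) (auto intro: bracket_span_ideal)

lemma derived_series_subset:
  assumes "lie_ideal G br I"
  shows "derived_series br I n \<subseteq> I"
proof (induction n)
  case (Suc n)
  have "{br x y |x y. x \<in> derived_series br I n \<and> y \<in> derived_series br I n} \<subseteq> I"
    using Suc idealD[OF assms] by blast
  thus ?case using span_minimal idealD(1)[OF assms] by (simp add: bracket_span_def)
qed simp

text \<open>The last non-zero term of the derived series is abelian.\<close>

lemma solvable_ideal_contains_abelian:
  assumes "lie_ideal G br I" "solvable I br" "I \<noteq> {0}"
  shows "\<exists>B. lie_ideal G br B \<and> abelian B br \<and> B \<noteq> {0} \<and> B \<subseteq> I"
proof -
  define n where "n = (LEAST n. derived_series br I n = {0})"
  have n: "derived_series br I n = {0}"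
    using assms(2) LeastI_ex unfolding solvable_def n_def by meson
  have "n \<noteq> 0" using n assms(3) by (cases n) auto
  then obtain m where m: "n = Suc m" by (cases n) auto
  define B where "B = derived_series br I m"
  have "B \<noteq> {0}" using not_less_Least[of m "\<lambda>n. derived_series br I n = {0}"] m
    unfolding B_def n_def by simp
  moreover have "abelian B br"
    unfolding abelian_def
  proof safe
    fix x y assume "x \<in> B" "y \<in> B"
    hence "br x y \<in> derived_series br I n"
      unfolding m by (auto simp: bracket_span_def B_def intro!: span_base)
    thus "br x y = 0" using n by simp
  qed
  ultimately show ?thesis
    using derived_series_ideal[OF assms(1)] derived_series_subset[OF assms(1)] B_def by blast
qed

lemma span_commuting_ideals:
  assumes "\<And>I. I \<in> S \<Longrightarrow> lie_ideal G br I"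
    and "\<And>I J x y. I \<in> S \<Longrightarrow> J \<in> S \<Longrightarrow> x \<in> I \<Longrightarrow> y \<in> J \<Longrightarrow> br x y = 0"
  shows "lie_ideal G br (span (\<Union>S))" "abelian (span (\<Union>S)) br"
proof -
  have S: "\<Union>S \<subseteq> G" using assms(1) idealD(2) by blast
  hence SG: "span (\<Union>S) \<subseteq> G" using span_minimal G_sub by blast
  show "lie_ideal G br (span (\<Union>S))"
    unfolding lie_ideal_def
  proof (intro conjI ballI)
    fix x y assume x: "x \<in> G" and y: "y \<in> span (\<Union>S)"
    show "br x y \<in> span (\<Union>S)"
      by (rule br_span_in[OF S x _ _ y]) (use x assms(1) idealD(3) in \<open>auto intro!: span_base\<close>)
  qed (use SG in auto)
  have 1: "br x y = 0" if x: "x \<in> \<Union>S" and y: "y \<in> span (\<Union>S)" for x y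
  proof -
    have "br x y \<in> {0}"
      by (rule br_span_in[OF S _ _ _ y]) (use x S assms(2) in \<open>auto intro: subspace_single_0\<close>)
    thus ?thesis by simp
  qed
  have "br x y = 0" if x: "x \<in> span (\<Union>S)" and y: "y \<in> span (\<Union>S)" for x y
  proof -
    have "br y s \<in> {0}" if "s \<in> \<Union>S" for s
      using 1[OF that y] br_anti[of s y] S SG that y by (auto simp: subset_iff)
    hence "br y x \<in> {0}"
      using br_span_in[OF S _ _ _ x, of y "{0}"] y SG by (auto intro: subspace_single_0)
    thus ?thesis using br_anti[of x y] x y SG by (auto simp: subset_iff)
  qed
  thus "abelian (span (\<Union>S)) br" by (simp add: abelian_def)
qed

text \<open>An inner product on \<open>B\<close> for which \<open>G\<close> acts by skew operators implies the following property. The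
  arguments about ideals need nothing else from the metric.\<close>

definition square_free_action :: "'a set \<Rightarrow> bool" where
  "square_free_action B \<longleftrightarrow> (\<forall>x\<in>G. \<forall>c\<in>B. br x (br x c) = 0 \<longrightarrow> br x c = 0)"

text \<open>For \<open>x\<close> in an abelian ideal, \<open>(ad x)\<^sup>2 = 0\<close> on all of \<open>G\<close>.\<close>

lemma abelian_ideals_commute:
  assumes "lie_ideal G br B" "square_free_action B" "lie_ideal G br C" "abelian C br"
    and "b \<in> B" "c \<in> C"
  shows "br c b = 0" "br b c = 0"
proof -
  have bc: "b \<in> G" "c \<in> G" using assms idealD(2) by blast+
  hence "br c (br c b) = 0"
    using idealD(4)[OF assms(3) bc(1) assms(6)] assms(4,6) by (simp add: abelian_def)
  thus "br c b = 0" using assms(2,5) bc by (simp add: square_free_action_def)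
  thus "br b c = 0" using br_anti[OF bc] by simp
qed

text \<open>
  If \<open>b\<close> lies in an abelian ideal, then \<open>exp (t d) b\<close> lies in the image of that ideal under the
  automorphism \<open>exp (t d)\<close>, whence \<open>[exp (t d) b, [exp (t d) b, c]] = 0\<close> for every \<open>t\<close> and \<open>c\<close>. Up to
  scalars, the coefficients of \<open>t\<^sup>2\<close> and \<open>t\<^sup>4\<close> are the identities below. The Leibniz rule gives each
  coefficient from the one before, so that no exponential is required.
\<close>

lemma derivation_square_zero_coefficients:
  assumes d_lin: "lin_on G d" and d_in: "\<And>x. x \<in> G \<Longrightarrow> d x \<in> G"
    and leibniz: "\<And>x y. x \<in> G \<Longrightarrow> y \<in> G \<Longrightarrow> d (br x y) = br (d x) y + br x (d y)"
    and b: "b \<in> G" and zero: "\<And>c. c \<in> G \<Longrightarrow> br b (br b c) = 0" and c: "c \<in> G"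
  shows "br (d (d b)) (br b c) + 2 *\<^sub>R br (d b) (br (d b) c) + br b (br (d (d b)) c) = 0" (is ?F2)
    and "br (d (d (d (d b)))) (br b c) + 4 *\<^sub>R br (d (d (d b))) (br (d b) c)
      + 6 *\<^sub>R br (d (d b)) (br (d (d b)) c)
      + 4 *\<^sub>R br (d b) (br (d (d (d b))) c) + br b (br (d (d (d (d b)))) c) = 0" (is ?F4)
proof -
  have d_add: "d (x + y) = d x + d y" if "x \<in> G" "y \<in> G" for x y
    using d_lin that by (simp add: lin_on_def)
  have d_scale: "d (r *\<^sub>R x) = r *\<^sub>R d x" if "x \<in> G" for x r
    using d_lin that by (simp add: lin_on_def)
  have d0: "d 0 = 0" using lin_on_0[OF G_sub d_lin] .
  note rules = d_add d_scale leibniz d_in br_in br_simps G_closed b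
  have F1: "br (d b) (br b c) + br b (br (d b) c) = 0" if "c \<in> G" for c
  proof -
    have "d (br b (br b c)) = br b (br b (d c)) + (br (d b) (br b c) + br b (br (d b) c))"
      using that by (simp add: rules add_ac)
    thus ?thesis using zero that d_in d0 by simp
  qed
  have F2: "br (d (d b)) (br b c) + 2 *\<^sub>R br (d b) (br (d b) c) + br b (br (d (d b)) c) = 0"
    if "c \<in> G" for c
  proof -
    have "d (br (d b) (br b c) + br b (br (d b) c))
      = (br (d b) (br b (d c)) + br b (br (d b) (d c)))
        + (br (d (d b)) (br b c) + 2 *\<^sub>R br (d b) (br (d b) c) + br b (br (d (d b)) c))"
      using that by (simp add: rules add_ac scaleR_2)
    thus ?thesis using F1 that d_in d0 by simp
  qed
  have F3: "br (d (d (d b))) (br b c) + 3 *\<^sub>R br (d (d b)) (br (d b) c)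
      + 3 *\<^sub>R br (d b) (br (d (d b)) c) + br b (br (d (d (d b))) c) = 0"
    if "c \<in> G" for c
  proof -
    \<comment> \<open>Multiples are expanded into repeated summands, so that sorting the sum decides the identity.\<close>
    have three: "3 *\<^sub>R x = x + x + x" for x :: 'a
      using scaleR_left_distrib[of 2 1 x] by (simp add: scaleR_2)
    have "d (br (d (d b)) (br b c) + 2 *\<^sub>R br (d b) (br (d b) c) + br b (br (d (d b)) c))
      = (br (d (d b)) (br b (d c)) + 2 *\<^sub>R br (d b) (br (d b) (d c)) + br b (br (d (d b)) (d c)))
        + (br (d (d (d b))) (br b c) + 3 *\<^sub>R br (d (d b)) (br (d b) c)
      + 3 *\<^sub>R br (d b) (br (d (d b)) c) + br b (br (d (d (d b))) c))"
      using that by (simp add: rules add_ac scaleR_2 three)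
    thus ?thesis using F2 that d_in d0 by simp
  qed
  have F4: "br (d (d (d (d b)))) (br b c) + 4 *\<^sub>R br (d (d (d b))) (br (d b) c)
      + 6 *\<^sub>R br (d (d b)) (br (d (d b)) c)
      + 4 *\<^sub>R br (d b) (br (d (d (d b))) c) + br b (br (d (d (d (d b)))) c) = 0"
    if "c \<in> G" for c
  proof -
    have three: "3 *\<^sub>R x = x + x + x" for x :: 'a
      using scaleR_left_distrib[of 2 1 x] by (simp add: scaleR_2)
    have four: "4 *\<^sub>R x = x + x + x + x" for x :: 'a
      using scaleR_left_distrib[of 3 1 x] by (simp add: three)
    have six: "6 *\<^sub>R x = x + x + x + x + x + x" for x :: 'a
      using scaleR_left_distrib[of 3 3 x] by (simp add: three add_ac)
    have "d (br (d (d (d b))) (br b c) + 3 *\<^sub>R br (d (d b)) (br (d b) c)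
      + 3 *\<^sub>R br (d b) (br (d (d b)) c) + br b (br (d (d (d b))) c))
      = (br (d (d (d b))) (br b (d c)) + 3 *\<^sub>R br (d (d b)) (br (d b) (d c))
      + 3 *\<^sub>R br (d b) (br (d (d b)) (d c)) + br b (br (d (d (d b))) (d c)))
        + (br (d (d (d (d b)))) (br b c) + 4 *\<^sub>R br (d (d (d b))) (br (d b) c)
      + 6 *\<^sub>R br (d (d b)) (br (d (d b)) c)
      + 4 *\<^sub>R br (d b) (br (d (d (d b))) c) + br b (br (d (d (d (d b)))) c))"
      using that by (simp add: rules add_ac three four six)
    thus ?thesis using F3 that d_in d0 by simp
  qed
  show ?F2 using F2 c by simp
  show ?F4 using F4 c by simp
qed

text \<open>
  For \<open>c \<in> B\<close> most terms of the two identities above vanish. The first one reduces to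
  \<open>[d b, [d b, c]] = 0\<close>, so \<open>[d b, c] = 0\<close>; with this the second one reduces to
  \<open>[d (d b), [d (d b), c]] = 0\<close>, so \<open>[d (d b), c] = 0\<close>. Differentiating \<open>[d b, c] = 0\<close> then gives
  \<open>[d b, d c] = 0\<close>.
\<close>

lemma derivation_translate_abelian_ideal:
  assumes d_lin: "lin_on G d" and d_in: "\<And>x. x \<in> G \<Longrightarrow> d x \<in> G"
    and leibniz: "\<And>x y. x \<in> G \<Longrightarrow> y \<in> G \<Longrightarrow> d (br x y) = br (d x) y + br x (d y)"
    and B: "lie_ideal G br B" "abelian B br" and sq: "square_free_action B"
  shows "lie_ideal G br (B + d ` B)" "abelian (B + d ` B) br"
proof -
  have BG: "x \<in> G" if "x \<in> B" for x using that idealD(2)[OF B(1)] by blast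
  have B0: "0 \<in> B" using idealD(1)[OF B(1)] subspace_0 by blast
  have ab: "br x y = 0" if "x \<in> B" "y \<in> B" for x y using B(2) that by (simp add: abelian_def)
  have zero: "br b (br b c) = 0" if "b \<in> B" "c \<in> G" for b c
    using ab idealD(4)[OF B(1)] that by simp
  have coeff: "br (d (d b)) (br b c) + 2 *\<^sub>R br (d b) (br (d b) c) + br b (br (d (d b)) c) = 0"
    "br (d (d (d (d b)))) (br b c) + 4 *\<^sub>R br (d (d (d b))) (br (d b) c)
      + 6 *\<^sub>R br (d (d b)) (br (d (d b)) c)
      + 4 *\<^sub>R br (d b) (br (d (d (d b))) c) + br b (br (d (d (d (d b)))) c) = 0"
    if "b \<in> B" "c \<in> B" for b c
    using derivation_square_zero_coefficients[of d b c] d_lin d_in leibniz BG zero that by blast+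
  have db: "br (d b) c = 0" if b: "b \<in> B" and c: "c \<in> B" for b c
  proof -
    have "2 *\<^sub>R br (d b) (br (d b) c) = 0"
      using coeff(1)[OF b c] b c BG d_in idealD(3)[OF B(1)] ab
      by (simp add: br_zero_right)
    thus ?thesis using sq BG[OF b] c d_in by (simp add: square_free_action_def)
  qed
  have ddb: "br (d (d b)) c = 0" if b: "b \<in> B" and c: "c \<in> B" for b c
  proof -
    have "6 *\<^sub>R br (d (d b)) (br (d (d b)) c) = 0"
      using coeff(2)[OF b c] b c BG d_in idealD(3)[OF B(1)] ab db
      by (simp add: br_zero_right)
    thus ?thesis using sq BG[OF b] c d_in by (simp add: square_free_action_def)
  qed
  have dbdc: "br (d b) (d c) = 0" if b: "b \<in> B" and c: "c \<in> B" for b c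
  proof -
    have "0 = d (br (d b) c)" using db[OF b c] lin_on_0[OF G_sub d_lin] by simp
    thus ?thesis using leibniz BG[OF b] BG[OF c] d_in ddb[OF b c] by simp
  qed
  have dB: "subspace (d ` B)"
    using lin_on_subspace_image[OF idealD(1)[OF B(1)], of d] d_lin BG by (simp add: lin_on_def)
  have V_sub: "subspace (B + d ` B)" using subspace_set_plus[OF idealD(1)[OF B(1)] dB] .
  have BC: "B \<subseteq> B + d ` B" "d ` B \<subseteq> B + d ` B"
    using set_plus_left[OF dB] set_plus_right[OF idealD(1)[OF B(1)]] by auto
  show "lie_ideal G br (B + d ` B)"
    unfolding lie_ideal_def
  proof (intro conjI ballI)
    show "B + d ` B \<subseteq> G" using BG d_in G_closed(2) by (auto elim!: set_plus_elim)
    fix x y assume x: "x \<in> G" and "y \<in> B + d ` B"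
    then obtain b c where bc: "b \<in> B" "c \<in> B" "y = b + d c" by (auto elim!: set_plus_elim)
    have "br x (d c) = d (br x c) - br (d x) c"
      using leibniz[OF x BG[OF bc(2)]] by simp
    hence "br x y = (br x b - br (d x) c) + d (br x c)"
      using bc BG d_in x by (simp add: br_simps)
    moreover have "br x b - br (d x) c \<in> B" "br x c \<in> B"
      using bc x d_in idealD(3)[OF B(1)] subspace_diff[OF idealD(1)[OF B(1)]] by auto
    ultimately show "br x y \<in> B + d ` B" by (auto intro: set_plus_intro)
  qed (rule V_sub)
  have bd: "br b (d c) = 0" if "b \<in> B" "c \<in> B" for b c
    using db[OF that(2,1)] br_anti[of b "d c"] BG that d_in by simp
  show "abelian (B + d ` B) br"
    unfolding abelian_def
    using BG d_in ab db bd dbdc by (auto elim!: set_plus_elim simp: br_simps G_closed)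
qed

end

section \<open>Ideals in naturally reductive decompositions\<close>

locale natred =
  fixes D :: "'a::real_vector decomp"
  assumes nr: "naturally_reductive D"
begin

abbreviation G where "G \<equiv> alg D"
abbreviation br where "br \<equiv> lbr D"
abbreviation H where "H \<equiv> isot D"
abbreviation M where "M \<equiv> compl D"
abbreviation g where "g \<equiv> met D"
abbreviation pH where "pH \<equiv> proj_along (isot D) (compl D)"
abbreviation pM where "pM \<equiv> proj_along (compl D) (isot D)"

sublocale lie "alg D" "lbr D"
  using nr by unfold_locales (simp add: naturally_reductive_def)

lemma G_direct_sum: "direct_sum G H M"
  using nr by (simp add: naturally_reductive_def)

lemma H_sub: "subspace H" and M_sub: "subspace M" and HM0: "H \<inter> M = {0}" and G_eq: "G = H + M"
  using G_direct_sum by (simp_all add: direct_sum_def)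

lemma HG: "x \<in> H \<Longrightarrow> x \<in> G" and MG: "x \<in> M \<Longrightarrow> x \<in> G"
  using set_plus_left[OF M_sub, of H] set_plus_right[OF H_sub, of M] G_eq by auto

lemma M_subset: "M \<subseteq> G"
  using MG by auto

sublocale ip_space "compl D" "met D"
  using nr fin_spanned_subspace[OF G_fin M_sub M_subset]
  by unfold_locales (simp_all add: naturally_reductive_def)

lemmas H_closed = subspace_0[OF H_sub] subspace_add[OF H_sub] subspace_scale[OF H_sub]
  subspace_diff[OF H_sub] subspace_neg[OF H_sub]
lemmas M_closed = subspace_0[OF M_sub] subspace_add[OF M_sub] subspace_scale[OF M_sub]
  subspace_diff[OF M_sub] subspace_neg[OF M_sub]

lemma pH_add: "h \<in> H \<Longrightarrow> m \<in> M \<Longrightarrow> pH (h + m) = h" and pM_add: "h \<in> H \<Longrightarrow> m \<in> M \<Longrightarrow> pM (h + m) = m"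
  using proj_along_add[OF H_sub M_sub HM0] by auto

lemma pM_M: "m \<in> M \<Longrightarrow> pM m = m"
  using pM_add[of 0 m] H_closed(1) by simp

lemma pH_H: "h \<in> H \<Longrightarrow> pH h = h" and pM_H: "h \<in> H \<Longrightarrow> pM h = 0"
  using pH_add[of h 0] pM_add[of h 0] M_closed(1) by simp_all

lemma G_split:
  assumes "x \<in> G"
  shows "pH x \<in> H" "pM x \<in> M" "x = pH x + pM x"
proof -
  obtain h m where "h \<in> H" "m \<in> M" "x = h + m" using assms G_direct_sum direct_sum_elim by blast
  thus "pH x \<in> H" "pM x \<in> M" "x = pH x + pM x" by (simp_all add: pH_add pM_add)
qed

lemma p_plus:
  "x \<in> G \<Longrightarrow> y \<in> G \<Longrightarrow> pH (x + y) = pH x + pH y"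
  "x \<in> G \<Longrightarrow> y \<in> G \<Longrightarrow> pM (x + y) = pM x + pM y"
  and p_scale: "x \<in> G \<Longrightarrow> pH (c *\<^sub>R x) = c *\<^sub>R pH x" "x \<in> G \<Longrightarrow> pM (c *\<^sub>R x) = c *\<^sub>R pM x"
  using proj_along_lin[OF H_sub M_sub HM0] unfolding G_eq lin_on_def by auto

lemma p_neg: "x \<in> G \<Longrightarrow> pH (- x) = - pH x" "x \<in> G \<Longrightarrow> pM (- x) = - pM x"
  using p_scale[of x "-1"] by simp_all

lemma p_diff:
  "x \<in> G \<Longrightarrow> y \<in> G \<Longrightarrow> pH (x - y) = pH x - pH y"
  "x \<in> G \<Longrightarrow> y \<in> G \<Longrightarrow> pM (x - y) = pM x - pM y"
  using p_plus[of x "-y"] p_neg[of y] G_closed(5)[of y] by simp_all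

lemmas p_simps = p_plus p_scale p_neg p_diff

lemma br_HH: "h \<in> H \<Longrightarrow> k \<in> H \<Longrightarrow> br h k \<in> H"
  using nr by (simp add: naturally_reductive_def subalgebra_def)

lemma br_HM: "h \<in> H \<Longrightarrow> x \<in> M \<Longrightarrow> br h x \<in> M"
  using nr by (simp add: naturally_reductive_def)

lemma br_MH: "h \<in> H \<Longrightarrow> x \<in> M \<Longrightarrow> br x h \<in> M"
  using br_HM br_anti[of x h] HG MG M_closed(5) by simp

lemma pM_MM: "x \<in> M \<Longrightarrow> y \<in> M \<Longrightarrow> pM (br x y) \<in> M"
  using G_split br_in MG by blast

lemma pH_MM: "x \<in> M \<Longrightarrow> y \<in> M \<Longrightarrow> pH (br x y) \<in> H"
  using G_split(1) br_in MG by blast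

lemma H_skew: "h \<in> H \<Longrightarrow> x \<in> M \<Longrightarrow> y \<in> M \<Longrightarrow> g (br h x) y = - g x (br h y)"
  using nr by (simp add: naturally_reductive_def skew_on_def)

lemma natural: "x \<in> M \<Longrightarrow> y \<in> M \<Longrightarrow> z \<in> M \<Longrightarrow> g (pM (br x y)) z = - g y (pM (br x z))"
  using nr by (simp add: naturally_reductive_def)

lemma pM_anti: "x \<in> G \<Longrightarrow> y \<in> G \<Longrightarrow> pM (br x y) = - pM (br y x)"
  using p_neg(2)[OF br_in, of y x] br_anti[of x y] by simp

lemma model_simps:
  "mspace (model_of D) = M" "mmet (model_of D) = g"
  "tors (model_of D) x y z = g (- pM (br x y)) z"
  "curv (model_of D) x y z = - br (pH (br x y)) z"
  by (simp_all add: model_of_def)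

text \<open>The torsion is totally skew, so a subspace \<open>P\<close> that absorbs \<open>T(P, M)\<close> makes \<open>T\<close> vanish on
  mixed arguments from \<open>P\<close> and its orthogonal complement.\<close>

lemma reducible_if_invariant:
  assumes P: "subspace P" "P \<subseteq> M" "P \<noteq> {0}" "P \<noteq> M"
    and inv: "\<And>p y. p \<in> P \<Longrightarrow> y \<in> M \<Longrightarrow> pM (br p y) \<in> P"
  shows "reducible D"
proof -
  define Q where "Q = orth_compl M g P"
  have Q: "direct_sum M P Q" unfolding Q_def by (rule orth_direct_sum[OF P(1,2)])
  have QM: "y \<in> M" if "y \<in> Q" for y using that by (simp add: Q_def orth_compl_def)
  have PM: "p \<in> M" if "p \<in> P" for p using that P(2) by blast
  have qp: "g q p = 0" if "q \<in> Q" "p \<in> P" for p q using that by (simp add: Q_def orth_compl_def)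
  hence pq: "g p q = 0" if "q \<in> Q" "p \<in> P" for p q using that ip_sym PM QM by metis
  have "Q \<noteq> {0}"
  proof
    assume "Q = {0}"
    hence "M = P" using Q by (simp add: direct_sum_def)
    thus False using P(4) by simp
  qed
  have PQ: "pM (br p q) = 0" if "p \<in> P" "q \<in> Q" for p q
  proof (rule ip_eq_0)
    show m: "pM (br p q) \<in> M" using pM_MM PM QM that by blast
    have "g (pM (br p q)) (pM (br p q)) = - g q (pM (br p (pM (br p q))))"
      using natural PM QM that m by blast
    also have "\<dots> = 0" using inv[OF that(1) m] qp that by simp
    finally show "g (pM (br p q)) (pM (br p q)) = 0" .
  qed
  have QP: "pM (br q p) = 0" if "p \<in> P" "q \<in> Q" for p q
    using pM_anti[of q p] PQ[OF that] that MG PM QM by simp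
  have QQP: "g (pM (br q q')) p = 0" if "p \<in> P" "q \<in> Q" "q' \<in> Q" for p q q'
    using natural[of q q' p] QP[OF that(1,2)] QM PM that by (simp add: ip_zero_right)
  have PPQ: "g (pM (br p p')) q = 0" if "p \<in> P" "q \<in> Q" "p' \<in> P" for p q p'
    using pq[OF that(2) inv[OF that(1) PM[OF that(3)]]] .
  have "tors (model_of D) (x1 + x2) (y1 + y2) (z1 + z2)
          = tors (model_of D) x1 y1 z1 + tors (model_of D) x2 y2 z2"
    if "x1 \<in> P" "x2 \<in> Q" "y1 \<in> P" "y2 \<in> Q" "z1 \<in> P" "z2 \<in> Q" for x1 x2 y1 y2 z1 z2
  proof -
    have m: "x1 \<in> M" "x2 \<in> M" "y1 \<in> M" "y2 \<in> M" "z1 \<in> M" "z2 \<in> M" using that PM QM by auto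
    have "pM (br (x1 + x2) (y1 + y2)) = pM (br x1 y1) + pM (br x2 y2)"
      using m MG that by (simp add: br_simps br_in p_simps G_closed PQ QP)
    thus ?thesis
      using m that pM_MM PPQ QQP by (simp add: model_simps ip_simps M_closed)
  qed
  moreover have "\<forall>x\<in>P. \<forall>y\<in>Q. g x y = 0" using pq by blast
  ultimately show ?thesis
    unfolding reducible_def using Q P(3) \<open>Q \<noteq> {0}\<close> by blast
qed

text \<open>One may take \<open>y\<close> orthogonal to \<open>A \<inter> M\<close>. Since \<open>[x, [x, y]] = 0\<close>, applying \<open>[x, \<cdot>]\<close> and projecting
  to \<open>M\<close> twice maps \<open>y\<close> to \<open>[[x, y]\<^sub>H, x]\<close>, which lies in \<open>A \<inter> M\<close>; so its inner product with \<open>y\<close>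
  vanishes. By skewness that inner product is minus the squared length of \<open>[x, y]\<^sub>M\<close>.\<close>

lemma abelian_ideal_meets_complement:
  assumes A: "lie_ideal G br A" "abelian A br" and x: "x \<in> A" "x \<in> M" and y: "y \<in> M"
  shows "pM (br x y) = 0"
proof -
  have xG: "x \<in> G" using x MG by blast
  have "subspace (A \<inter> M)" using idealD(1)[OF A(1)] M_sub subspace_inter by blast
  then obtain u w where uw: "u \<in> A \<inter> M" "w \<in> orth_compl M g (A \<inter> M)" "y = u + w"
    using orth_decomp[of "A \<inter> M" y] y by blast
  have wM: "w \<in> M" and w: "\<And>a. a \<in> A \<Longrightarrow> a \<in> M \<Longrightarrow> g w a = 0"
    using uw(2) by (auto simp: orth_compl_def)
  define z where "z = br x w"
  have zA: "z \<in> A" using idealD(4)[OF A(1)] MG[OF wM] x(1) z_def by blast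
  have zG: "z \<in> G" using zA idealD(2)[OF A(1)] by blast
  note z = G_split[OF zG]
  have "br x z = 0" using A(2) x zA by (simp add: abelian_def)
  hence "br x (pH z + pM z) = 0" using z(3) by simp
  hence "br x (pH z) + br x (pM z) = 0" using z(1,2) HG MG xG by (simp add: br_add_right)
  hence 1: "br x (pM z) = br (pH z) x"
    using br_anti[OF xG HG[OF z(1)]] by (simp add: add_eq_0_iff)
  have "br (pH z) x \<in> A" using idealD(3)[OF A(1)] z HG x by blast
  moreover have hxM: "br (pH z) x \<in> M" using br_HM z x by blast
  ultimately have "g w (br (pH z) x) = 0" using w by blast
  hence "g w (pM (br x (pM z))) = 0" using 1 pM_M[OF hxM] by simp
  hence "g (pM z) (pM z) = 0" using natural[of x w "pM z"] x wM z by (simp add: z_def)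
  hence "pM z = 0" using ip_eq_0 z by blast
  moreover have "br x u = 0" using A(2) x uw(1) by (simp add: abelian_def)
  hence "br x y = z" using uw wM xG MG by (simp add: br_simps z_def)
  ultimately show ?thesis by simp
qed

text \<open>A vector in \<open>A \<inter> M\<close> annihilates the torsion, so the line through it splits off. If \<open>M\<close> is that
  line, there is no second summand, and the conclusion fails for the abelian algebra \<open>M\<close>.\<close>

lemma abelian_ideal_trivial_intersection:
  assumes "\<not> reducible D" "dim M \<noteq> 1" "lie_ideal G br A" "abelian A br"
  shows "A \<inter> M = {0}"
proof (rule ccontr)
  assume "A \<inter> M \<noteq> {0}"
  moreover have "0 \<in> A \<inter> M" using M_closed(1) subspace_0[OF idealD(1)[OF assms(3)]] by blast
  ultimately obtain x where x: "x \<in> A" "x \<in> M" "x \<noteq> 0" by blast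
  have dim1: "dim (span {x}) = 1"
    using dim_eq_card_independent[of "{x}"] x(3) by simp
  have "reducible D"
  proof (rule reducible_if_invariant)
    show "span {x} \<subseteq> M" using span_minimal[OF _ M_sub, of "{x}"] x by simp
    show "span {x} \<noteq> {0}" using x(3) span_base[of x "{x}"] by auto
    show "span {x} \<noteq> M" using dim1 assms(2) by metis
    fix p y assume p: "p \<in> span {x}" and y: "y \<in> M"
    then obtain c where "p = c *\<^sub>R x" by (auto simp: span_singleton)
    hence "pM (br p y) = c *\<^sub>R pM (br x y)" using x y MG by (simp add: br_simps p_simps br_in)
    thus "pM (br p y) \<in> span {x}"
      using abelian_ideal_meets_complement[OF assms(3,4) x(1,2) y] by (simp add: span_zero)
  qed simp
  thus False using assms(1) by simp
qed

end

locale effective_natred = natred +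
  assumes effective: "effective D"
begin

lemma effectiveD:
  assumes "h \<in> H" "\<And>x. x \<in> M \<Longrightarrow> br h x = 0"
  shows "h = 0"
proof -
  have "zero_outside M (br h) = zero_outside M (br 0)"
    using assms(2) MG by (auto simp: zero_outside_def br_zero_left fun_eq_iff)
  thus ?thesis using effective assms(1) H_closed(1) by (auto simp: effective_def inj_on_def)
qed

lemma ideal_trivial_isotropy:
  assumes N: "lie_ideal G br N" "N \<inter> M = {0}" and h: "h \<in> N" "h \<in> H"
  shows "h = 0"
proof (rule effectiveD[OF h(2)])
  fix x assume x: "x \<in> M"
  hence "br h x \<in> N \<inter> M" using br_HM h idealD(4)[OF N(1)] MG by blast
  thus "br h x = 0" using N(2) by blast
qed

text \<open>On an ideal \<open>N\<close> that meets \<open>M\<close> trivially, \<open>g (pM a) (pM b)\<close> is an inner product. It is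
  invariant under all of \<open>G\<close>: for \<open>y \<in> M\<close> and \<open>a \<in> N\<close> the only term of \<open>g (pM [y, a]) (pM a)\<close> that
  does not vanish by naturality pairs \<open>y\<close> with \<open>[pH a, a]\<close>, which lies in \<open>N \<inter> M\<close>.\<close>

lemma ideal_invariant_metric:
  assumes N: "lie_ideal G br N" "N \<inter> M = {0}" and y: "y \<in> G" and a: "a \<in> N"
  shows "g (pM (br y a)) (pM a) = 0"
proof -
  have aG: "a \<in> G" using a idealD(2)[OF N(1)] by blast
  note sa = G_split[OF aG] and sy = G_split[OF y]
  define h m where "h = pH a" and "m = pM a"
  define k n where "k = pH y" and "n = pM y"
  have hm': "h \<in> H" "m \<in> M" "a = h + m" "k \<in> H" "n \<in> M" "y = k + n"
    using sa sy by (simp_all add: h_def m_def k_def n_def)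
  have "br h a = br h m + 0" using hm' HG MG by (simp add: br_simps br_self)
  hence "br h m \<in> N" using idealD(3)[OF N(1) HG[OF hm'(1)] a] by simp
  hence hm0: "br h m = 0" using br_HM[OF hm'(1,2)] N(2) by blast
  have "pM (br y a) = br k m + br n h + pM (br n m)"
  proof -
    have "br y a = br k h + br k m + br n h + br n m"
      using hm' HG MG by (simp add: br_simps G_closed add_ac)
    thus ?thesis using hm' br_HH br_HM br_MH HG MG br_in
      by (simp add: p_simps G_closed pM_H pM_M)
  qed
  moreover have "g (br k m) m = 0" using H_skew[of k m m] ip_sym[of m "br k m"] hm' br_HM by simp
  moreover have "g (pM (br n m)) m = 0"
    using natural[of n m m] ip_sym[of m "pM (br n m)"] hm' pM_MM by simp
  moreover have "g (br n h) m = 0"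
  proof -
    have "g (br n h) m = - g (br h n) m"
      using br_anti[of n h] hm' HG MG br_HM by (simp add: ip_neg_left)
    also have "\<dots> = g n (br h m)" using H_skew hm' by simp
    also have "\<dots> = 0" using hm0 hm' by (simp add: ip_zero_right)
    finally show ?thesis .
  qed
  ultimately show ?thesis
    using hm' br_HM br_MH pM_MM by (simp add: ip_simps M_closed pM_add flip: m_def)
qed

text \<open>For \<open>b = [y, a]\<close> with \<open>[y, b] = 0\<close>, invariance of the metric on \<open>N\<close> says that \<open>pM b\<close> has length zero.\<close>

lemma ideal_square_free:
  assumes N: "lie_ideal G br N" "N \<inter> M = {0}"
  shows "square_free_action N"
  unfolding square_free_action_def
proof (intro ballI impI)
  fix y a assume y: "y \<in> G" and a: "a \<in> N" and sq: "br y (br y a) = 0"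
  define b where "b = br y a"
  have b: "b \<in> N" using idealD(3)[OF N(1) y a] b_def by simp
  have aG: "a \<in> G" "b \<in> G" using a b idealD(2)[OF N(1)] by blast+
  have "g (pM (br y (a + b))) (pM (a + b)) = 0"
    using ideal_invariant_metric[OF N y] subspace_add[OF idealD(1)[OF N(1)] a b] by blast
  moreover have "br y (a + b) = b" using y aG sq by (simp add: br_simps b_def)
  moreover have "g (pM b) (pM a) = 0" using ideal_invariant_metric[OF N y a] by (simp add: b_def)
  ultimately have "g (pM b) (pM b) = 0" using aG G_split by (simp add: p_simps ip_simps)
  hence "pM b = 0" using ip_eq_0 G_split aG by blast
  hence "b \<in> H" using G_split[OF aG(2)] by simp
  thus "br y a = 0" using ideal_trivial_isotropy[OF N b] b_def by simp
qed

lemma span_abelian_ideals: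
  assumes "\<And>I. I \<in> S \<Longrightarrow> lie_ideal G br I \<and> abelian I br \<and> I \<inter> M = {0}"
  shows "lie_ideal G br (span (\<Union>S))" "abelian (span (\<Union>S)) br"
proof -
  have 1: "lie_ideal G br I" "abelian I br" "square_free_action I" if "I \<in> S" for I
    using assms[OF that] ideal_square_free[of I] by auto
  have 2: "br x y = 0" if "I \<in> S" "J \<in> S" "x \<in> I" "y \<in> J" for I J x y
    using abelian_ideals_commute(2)[OF 1(1,3)[OF that(1)] 1(1,2)[OF that(2)] that(3,4)] .
  show "lie_ideal G br (span (\<Union>S))" "abelian (span (\<Union>S)) br"
    by (rule span_commuting_ideals, erule 1, erule 2, assumption+)+
qed

end

text \<open>The condition that the image of the curvature is \<open>ad H\<close> is pulled back along the injective map \<open>ad\<close>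
  to a condition on \<open>H\<close> itself.\<close>

locale transvection_natred = effective_natred +
  assumes isot_span: "isot D = span {proj_isot D (lbr D x y) |x y. x \<in> compl D \<and> y \<in> compl D}"
begin

lemma transvection: "transvection D"
proof -
  let ?ad = "\<lambda>h. zero_outside M (br h)"
  let ?S = "{pH (br x y) |x y. x \<in> M \<and> y \<in> M}"
  have "lin_on H ?ad"
    by (rule lin_onI) (auto simp: zero_outside_def fun_eq_iff plus_fun_def scaleR_fun_def br_simps HG MG)
  then obtain F where F: "linear F" "\<And>h. h \<in> H \<Longrightarrow> F h = ?ad h"
    using lin_on_extend[OF H_sub] by blast
  have SH: "?S \<subseteq> H" using pH_MM by auto
  have "{zero_outside M (curv (model_of D) x y) |x y. x \<in> M \<and> y \<in> M} = F ` ?S"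
  proof -
    have *: "zero_outside M (curv (model_of D) x y) = F (pH (br y x))" if "x \<in> M" "y \<in> M" for x y
    proof -
      have h: "pH (br x y) \<in> H" "pH (br y x) = - pH (br x y)"
        using G_split br_in MG that br_anti[of y x] p_neg(1)[of "br x y"] by auto
      have "F (pH (br y x)) = ?ad (- pH (br x y))" using F(2) h H_closed(5) by metis
      thus ?thesis using h HG MG by (auto simp: zero_outside_def fun_eq_iff model_simps br_simps)
    qed
    thus ?thesis by (auto simp: image_iff) (metis+)
  qed
  hence "span {zero_outside M (curv (model_of D) x y) |x y. x \<in> M \<and> y \<in> M} = F ` span ?S"
    using linear_span_image[OF F(1)] by simp
  also have "\<dots> = ?ad ` H" using F(2) isot_span by (auto simp: image_iff)
  finally show ?thesis using nr effective by (simp add: transvection_def)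
qed

text \<open>For \<open>x \<in> B \<inter> M\<close> and \<open>y \<in> M\<close> the bracket \<open>k = [x, y]\<close> lies in \<open>B \<inter> H\<close>, and \<open>ad k\<close> maps \<open>M\<close> into
  \<open>B \<inter> M\<close>, on which it vanishes. Being skew, it is zero. So \<open>x\<close> commutes with \<open>M\<close>, and hence with
  \<open>H\<close>, which \<open>M\<close> generates.\<close>

lemma abelian_ideal_meets_complement_central:
  assumes B: "lie_ideal G br B" "abelian B br" and x: "x \<in> B" "x \<in> M" and y: "y \<in> G"
  shows "br x y = 0"
proof -
  have ab: "br a b = 0" if "a \<in> B" "b \<in> B" for a b using B(2) that by (simp add: abelian_def)
  have xm: "br x z = 0" if z: "z \<in> M" for z
  proof -
    define k where "k = br x z"
    have kB: "k \<in> B" using idealD(4)[OF B(1) MG[OF z] x(1)] k_def by simp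
    have kG: "k \<in> G" using kB idealD(2)[OF B(1)] by blast
    have "pM k = 0" using abelian_ideal_meets_complement[OF B x z] k_def by simp
    hence kH: "k \<in> H" using G_split[OF kG] by simp
    have "k = 0"
    proof (rule effectiveD[OF kH])
      fix w assume w: "w \<in> M"
      define q where "q = br k w"
      have q: "q \<in> M" "q \<in> B"
        using br_HM[OF kH w] idealD(4)[OF B(1) MG[OF w] kB] q_def by auto
      have "g q q = - g w (br k q)" unfolding q_def using H_skew[OF kH w] br_HM[OF kH w] by blast
      also have "\<dots> = 0" using ab[OF kB q(2)] w by (simp add: ip_zero_right)
      finally show "br k w = 0" using ip_eq_0[OF q(1)] q_def by simp
    qed
    thus ?thesis by (simp add: k_def)
  qed
  have xh: "br x h = 0" if "h \<in> H" for h
  proof -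
    let ?S = "{pH (br u v) |u v. u \<in> M \<and> v \<in> M}"
    have "br x h \<in> {0}"
    proof (rule br_span_in[of ?S])
      show "?S \<subseteq> G" using pH_MM HG by auto
      show "h \<in> span ?S" using that isot_span by simp
      fix s assume "s \<in> ?S"
      then obtain u v where uv: "u \<in> M" "v \<in> M" "s = pH (br u v)" by blast
      have G: "br u v \<in> G" using uv br_in MG by blast
      note s = G_split[OF G]
      have "br x (br u v) = 0"
        using jacobi[of x u v] xm uv x MG by (simp add: br_zero_left br_zero_right)
      hence "br x (pH (br u v) + pM (br u v)) = 0" using s(3) by simp
      thus "br x s \<in> {0}" using uv s(1,2) x MG HG xm by (simp add: br_add_right)
    qed (use x MG in \<open>auto intro: subspace_single_0\<close>)
    thus ?thesis by simp
  qed
  show ?thesis using G_split[OF y] xm xh x MG HG br_add_right by (metis add.right_neutral)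
qed

text \<open>The flat factor of the decomposition; its complement in \<open>G\<close> is \<open>centerless_part\<close>, which contains all
  brackets.\<close>

definition central_part :: "'a set" where
  "central_part = {v \<in> M. \<forall>x\<in>G. br v x = 0}"

definition central_compl :: "'a set" where
  "central_compl = orth_compl M g central_part"

definition centerless_part :: "'a set" where
  "centerless_part = H + central_compl"

lemma central_part_sub: "subspace central_part"
  using MG by (auto simp: central_part_def subspace_def M_closed br_simps)

lemma central_part_M: "central_part \<subseteq> M" and central_compl_M: "central_compl \<subseteq> M"
  by (auto simp: central_part_def central_compl_def orth_compl_def)

lemma central_compl_sub: "subspace central_compl"
  unfolding central_compl_def by (rule orth_subspace[OF central_part_M])

lemma central_direct_sum: "direct_sum M central_compl central_part"
  using orth_direct_sum[OF central_part_sub central_part_M]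
  by (auto simp: direct_sum_def central_compl_def add.commute)

lemma centerless_part_sub: "subspace centerless_part"
  unfolding centerless_part_def by (rule subspace_set_plus[OF H_sub central_compl_sub])

lemma centerless_part_G: "centerless_part \<subseteq> G"
  using HG MG central_compl_M G_closed by (auto simp: centerless_part_def elim!: set_plus_elim)

text \<open>Skewness and naturality move the bracket onto the central vector: the inner product of \<open>[x, y]\<close> with
  \<open>v\<close> is a sum of inner products with brackets of \<open>v\<close>.\<close>

lemma br_in_centerless:
  assumes "x \<in> G" "y \<in> G"
  shows "br x y \<in> centerless_part"
proof -
  have "g (pM (br x y)) v = 0" if v: "v \<in> central_part" for v
  proof -
    have vM: "v \<in> M" and v0: "\<And>x. x \<in> G \<Longrightarrow> br v x = 0" using v by (auto simp: central_part_def)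
    have v0': "br x v = 0" if "x \<in> G" for x using v0[OF that] br_anti[of x v] MG[OF vM] that by simp
    define h m where "h = pH x" and "m = pM x"
    define k n where "k = pH y" and "n = pM y"
    have s: "h \<in> H" "m \<in> M" "x = h + m" "k \<in> H" "n \<in> M" "y = k + n"
      using G_split[OF assms(1)] G_split[OF assms(2)] by (simp_all add: h_def m_def k_def n_def)
    have "br x y = br h k + br h n + br m k + br m n"
      using s HG MG by (simp add: br_simps G_closed add_ac)
    hence "pM (br x y) = br h n + br m k + pM (br m n)" using s br_HH br_HM br_MH HG MG br_in
      by (simp add: p_simps G_closed pM_H pM_M)
    moreover have "g (br h n) v = 0"
      using H_skew[OF s(1,5) vM] v0' HG s by (simp add: ip_zero_right)
    moreover have "g (br m k) v = 0"
      using H_skew[OF s(4,2) vM] v0' HG MG s vM br_anti[of m k] br_HM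
      by (simp add: ip_zero_right ip_neg_left)
    moreover have "g (pM (br m n)) v = 0"
      using natural[OF s(2,5) vM] v0' MG s by (simp add: ip_zero_right pM_M M_closed)
    ultimately show ?thesis using s br_HM br_MH pM_MM vM by (simp add: ip_simps M_closed)
  qed
  hence "pM (br x y) \<in> central_compl"
    using G_split br_in assms by (auto simp: central_compl_def orth_compl_def)
  thus ?thesis using G_split[OF br_in[OF assms]] unfolding centerless_part_def
    by (metis set_plus_intro)
qed

lemma centerless_inter_central: "centerless_part \<inter> central_part = {0}"
proof -
  have "x = 0" if x: "x \<in> centerless_part" "x \<in> central_part" for x
  proof -
    obtain h m where hm': "h \<in> H" "m \<in> central_compl" "x = h + m"
      using x(1) by (auto simp: centerless_part_def elim!: set_plus_elim)
    have "pM x = m" using hm' central_compl_M pM_add by blast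
    moreover have "pM x = x" using x(2) central_part_M pM_M by blast
    ultimately have "x \<in> central_compl \<inter> central_part" using hm' x by simp
    thus ?thesis using central_direct_sum unfolding direct_sum_def by blast
  qed
  thus ?thesis using subspace_0[OF centerless_part_sub] subspace_0[OF central_part_sub] by blast
qed

lemma G_decomp:
  assumes "x \<in> G"
  obtains k v where "k \<in> centerless_part" "v \<in> central_part" "x = k + v"
proof -
  obtain m v where mv: "m \<in> central_compl" "v \<in> central_part" "pM x = m + v"
    using G_split[OF assms] direct_sum_elim[OF central_direct_sum] by blast
  have "x = (pH x + m) + v" using G_split(3)[OF assms] mv(3) by (simp add: add.assoc)
  thus thesis using that[of "pH x + m" v] mv G_split[OF assms] by (simp add: centerless_part_def set_plus_intro)
qed

lemma centerless_ideal: "lie_ideal G br centerless_part"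
  unfolding lie_ideal_def using centerless_part_sub centerless_part_G br_in_centerless by blast

lemma lie_direct_sum_center: "lie_direct_sum G br centerless_part central_part"
proof -
  have V: "central_part \<subseteq> G" using central_part_M MG by blast
  have "direct_sum G centerless_part central_part"
  proof (rule direct_sumI)
    show "\<exists>u\<in>centerless_part. \<exists>w\<in>central_part. x = u + w" if x: "x \<in> G" for x
      using G_decomp[OF x] by metis
  qed (use centerless_part_sub central_part_sub G_sub centerless_part_G V
        centerless_inter_central in auto)
  moreover have "lie_ideal G br central_part"
    unfolding lie_ideal_def
  proof (intro conjI ballI)
    fix x v assume x: "x \<in> G" and v: "v \<in> central_part"
    have "br x v = 0" using br_anti[of x v] x v V by (auto simp: central_part_def)
    thus "br x v \<in> central_part" using subspace_0[OF central_part_sub] by simp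
  qed (use central_part_sub V in auto)
  ultimately show ?thesis using centerless_ideal by (simp add: lie_direct_sum_def)
qed

lemma ideal_of_centerless:
  assumes "lie_ideal centerless_part br B"
  shows "lie_ideal G br B"
  unfolding lie_ideal_def
proof (intro conjI ballI)
  have B: "subspace B" "B \<subseteq> centerless_part" using assms by (auto simp: lie_ideal_def)
  show "subspace B" "B \<subseteq> G" using B centerless_part_G by auto
  fix x b assume x: "x \<in> G" and b: "b \<in> B"
  obtain k v where kv: "k \<in> centerless_part" "v \<in> central_part" "x = k + v" using G_decomp[OF x] .
  have bG: "b \<in> G" using b B centerless_part_G by blast
  have "br v b = 0" using kv(2) bG by (simp add: central_part_def)
  moreover have "v \<in> G" "k \<in> G" using kv central_part_M MG centerless_part_G by blast+
  ultimately have "br x b = br k b" using kv(3) bG by (simp add: br_add_left)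
  thus "br x b \<in> B" using assms kv(1) b by (simp add: lie_ideal_def)
qed

definition centerless_abelian :: "'a set set" where
  "centerless_abelian = {B. lie_ideal G br B \<and> abelian B br \<and> B \<subseteq> centerless_part}"

text \<open>A vector of \<open>B \<inter> M\<close> is central, and the center inside \<open>M\<close> has been split off.\<close>

lemma centerless_abelian_inter:
  assumes "B \<in> centerless_abelian"
  shows "B \<inter> M = {0}"
proof -
  have B: "lie_ideal G br B" "abelian B br" "B \<subseteq> centerless_part"
    using assms by (auto simp: centerless_abelian_def)
  have "x = 0" if x: "x \<in> B" "x \<in> M" for x
  proof -
    have "x \<in> central_part"
      using abelian_ideal_meets_complement_central[OF B(1,2) x] x by (simp add: central_part_def)
    thus ?thesis using x B(3) centerless_inter_central by blast
  qed
  thus ?thesis using subspace_0[OF idealD(1)[OF B(1)]] M_closed(1) by blast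
qed

definition abelian_radical :: "'a set" where
  "abelian_radical = span (\<Union>centerless_abelian)"

lemma abelian_radical_in: "abelian_radical \<in> centerless_abelian"
proof -
  have "lie_ideal G br abelian_radical" "abelian abelian_radical br"
    unfolding abelian_radical_def
    using span_abelian_ideals[of centerless_abelian] centerless_abelian_inter
    by (auto simp: centerless_abelian_def)
  moreover have "abelian_radical \<subseteq> centerless_part"
    unfolding abelian_radical_def
    by (rule span_minimal[OF _ centerless_part_sub]) (auto simp: centerless_abelian_def)
  ultimately show ?thesis by (simp add: centerless_abelian_def)
qed

text \<open>Such a derivation preserves the center inside \<open>M\<close>, hence also its orthogonal complement. So it carries
  an abelian ideal \<open>B\<close> of the centerless part into the larger abelian ideal \<open>B + d B\<close> of the same kind.\<close>

lemma derivation_abelian_radical: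
  assumes d_lin: "lin_on G d" and d_in: "\<And>x. x \<in> G \<Longrightarrow> d x \<in> G"
    and leibniz: "\<And>x y. x \<in> G \<Longrightarrow> y \<in> G \<Longrightarrow> d (br x y) = br (d x) y + br x (d y)"
    and d_H: "\<And>h. h \<in> H \<Longrightarrow> d h \<in> H" and d_M: "\<And>m. m \<in> M \<Longrightarrow> d m \<in> M" and d_skew: "skew_on M g d"
    and x: "x \<in> abelian_radical"
  shows "d x \<in> abelian_radical"
proof -
  have d_add: "d (x + y) = d x + d y" if "x \<in> G" "y \<in> G" for x y
    using d_lin that by (simp add: lin_on_def)
  have d0: "d 0 = 0" using lin_on_0[OF G_sub d_lin] .
  have d_central: "d v \<in> central_part" if v: "v \<in> central_part" for v
  proof -
    have vM: "v \<in> M" using v by (simp add: central_part_def)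
    have "br (d v) x = 0" if x: "x \<in> G" for x
      using leibniz[OF MG[OF vM] x] v x d_in d0 by (simp add: central_part_def)
    thus ?thesis using d_M[OF vM] by (simp add: central_part_def)
  qed
  have d_compl: "d m \<in> central_compl" if m: "m \<in> central_compl" for m
  proof -
    have mM: "m \<in> M" using m central_compl_M by blast
    have "g (d m) v = 0" if v: "v \<in> central_part" for v
    proof -
      have "g (d m) v = - g m (d v)" using d_skew mM v central_part_M by (auto simp: skew_on_def)
      also have "\<dots> = 0" using m d_central[OF v] by (simp add: central_compl_def orth_compl_def)
      finally show ?thesis .
    qed
    thus ?thesis using d_M[OF mM] by (simp add: central_compl_def orth_compl_def)
  qed
  have d_centerless: "d x \<in> centerless_part" if xK: "x \<in> centerless_part" for x
  proof -
    obtain h m where hm': "h \<in> H" "m \<in> central_compl" "x = h + m"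
      using xK unfolding centerless_part_def by (rule set_plus_elim)
    have "d x = d h + d m" using hm' HG MG central_compl_M d_add by blast
    thus ?thesis using d_H d_compl hm' by (simp add: centerless_part_def set_plus_intro)
  qed
  have *: "d b \<in> abelian_radical" if B: "B \<in> centerless_abelian" and b: "b \<in> B" for B b
  proof -
    have B': "lie_ideal G br B" "abelian B br" "B \<subseteq> centerless_part"
      using B by (auto simp: centerless_abelian_def)
    have "lie_ideal G br (B + d ` B)" "abelian (B + d ` B) br"
      by (rule derivation_translate_abelian_ideal[OF d_lin _ _ B'(1,2)
            ideal_square_free[OF B'(1) centerless_abelian_inter[OF B]]];
          simp add: d_in leibniz)+
    moreover have "B + d ` B \<subseteq> centerless_part"
      using subsetD[OF B'(3)] d_centerless subspace_add[OF centerless_part_sub]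
      by (auto elim!: set_plus_elim)
    ultimately have "B + d ` B \<in> centerless_abelian" by (simp add: centerless_abelian_def)
    moreover have "0 + d b \<in> B + d ` B"
      using b subspace_0[OF idealD(1)[OF B'(1)]] by (intro set_plus_intro) auto
    ultimately have "0 + d b \<in> \<Union>centerless_abelian" by (rule UnionI)
    thus ?thesis unfolding abelian_radical_def using span_base[of "d b"] by simp
  qed
  have rad: "span (\<Union>centerless_abelian) \<subseteq> G"
    by (rule span_minimal[OF _ G_sub]) (use idealD(2) in \<open>auto simp: centerless_abelian_def\<close>)
  have lin: "lin_on (span (\<Union>centerless_abelian)) d"
    using d_lin rad by (auto simp: lin_on_def subset_iff)
  have "subspace abelian_radical" by (simp add: abelian_radical_def)
  show ?thesis
    by (rule span_in_subspace_image[OF lin \<open>subspace abelian_radical\<close>])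
      (use * x in \<open>auto simp: abelian_radical_def\<close>)
qed

lemma semisimple_if_no_abelian_radical:
  assumes "abelian_radical = {0}" "centerless_part \<noteq> {0}"
  shows "semisimple centerless_part br"
proof -
  have "subalgebra G br centerless_part"
    using centerless_part_sub centerless_part_G br_in_centerless by (auto simp: subalgebra_def)
  hence K: "lie_algebra centerless_part br" by (rule subalgebra_lie)
  interpret K: lie centerless_part br by unfold_locales (rule K)
  have "I = {0}" if I: "lie_ideal centerless_part br I" "solvable I br" for I
  proof (rule ccontr)
    assume "I \<noteq> {0}"
    then obtain B where B: "lie_ideal centerless_part br B" "abelian B br" "B \<noteq> {0}"
      using K.solvable_ideal_contains_abelian[OF I] by blast
    have "B \<in> centerless_abelian"
      using ideal_of_centerless[OF B(1)] B by (auto simp: centerless_abelian_def lie_ideal_def)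
    hence "B \<subseteq> \<Union>centerless_abelian" by blast
    also have "\<dots> \<subseteq> abelian_radical" unfolding abelian_radical_def by (rule span_superset)
    finally have "B \<subseteq> {0}" using assms(1) by simp
    thus False using B(3) subspace_0[OF K.idealD(1)[OF B(1)]] by auto
  qed
  thus ?thesis using K assms(2) by (simp add: semisimple_def)
qed

end

section \<open>The fiber decomposition\<close>

text \<open>The fiber decomposition exists for every abelian ideal \<open>A\<close> with \<open>A \<inter> M = {0}\<close>. Maximality of \<open>A\<close> is
  what yields semisimplicity, and irreducibility is what makes \<open>Hp\<close> act faithfully on \<open>Mm\<close>.\<close>

locale fiber = effective_natred D for D :: "'a::real_vector decomp" +
  fixes A :: "'a set"
  assumes A_ideal: "lie_ideal (alg D) (lbr D) A" and A_abelian: "abelian A (lbr D)"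
    and A_M: "A \<inter> compl D = {0}"
begin

definition Hp where "Hp = pH ` A"
definition Mp where "Mp = pM ` A"
definition Mm where "Mm = orth_compl M g Mp"
definition rho where "rho = graph_iso A Mp"

lemma A_sub: "subspace A" and AG: "a \<in> A \<Longrightarrow> a \<in> G"
  and br_A: "x \<in> G \<Longrightarrow> a \<in> A \<Longrightarrow> br x a \<in> A" and A_br: "x \<in> G \<Longrightarrow> a \<in> A \<Longrightarrow> br a x \<in> A"
  using idealD[OF A_ideal] by auto

lemmas A_closed = subspace_0[OF A_sub] subspace_add[OF A_sub] subspace_scale[OF A_sub]
  subspace_diff[OF A_sub] subspace_neg[OF A_sub]

lemma A_commute: "a \<in> A \<Longrightarrow> b \<in> A \<Longrightarrow> br a b = 0"
  using A_abelian by (simp add: abelian_def)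

lemma A_H: "a \<in> A \<Longrightarrow> a \<in> H \<Longrightarrow> a = 0"
  using ideal_trivial_isotropy[OF A_ideal A_M] .

lemma A_pM_0: "a \<in> A \<Longrightarrow> pM a = 0 \<Longrightarrow> a = 0"
  using G_split[OF AG] A_H by (metis add.right_neutral)

lemma pH_lin: "lin_on A pH" and pM_lin: "lin_on A pM"
  by (auto intro!: lin_onI simp: p_simps AG)

lemma Hp_sub: "subspace Hp" and Mp_sub: "subspace Mp"
  unfolding Hp_def Mp_def using lin_on_subspace_image[OF A_sub] pH_lin pM_lin by auto

lemma HpH: "h \<in> Hp \<Longrightarrow> h \<in> H" and MpM: "x \<in> Mp \<Longrightarrow> x \<in> M" and MmM: "x \<in> Mm \<Longrightarrow> x \<in> M"
  using G_split(1,2)[OF AG] by (auto simp: Hp_def Mp_def Mm_def orth_compl_def)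

lemma Mp_subset: "Mp \<subseteq> M"
  using MpM by blast

lemma Mm_sub: "subspace Mm"
  unfolding Mm_def by (rule orth_subspace[OF Mp_subset])

lemmas Mm_closed = subspace_0[OF Mm_sub] subspace_add[OF Mm_sub] subspace_scale[OF Mm_sub]
  subspace_diff[OF Mm_sub] subspace_neg[OF Mm_sub]
lemmas Hp_closed = subspace_0[OF Hp_sub] subspace_add[OF Hp_sub] subspace_scale[OF Hp_sub]
  subspace_diff[OF Hp_sub] subspace_neg[OF Hp_sub]
lemmas Mp_closed = subspace_0[OF Mp_sub] subspace_add[OF Mp_sub] subspace_scale[OF Mp_sub]
  subspace_diff[OF Mp_sub] subspace_neg[OF Mp_sub]

lemma HpG: "h \<in> Hp \<Longrightarrow> h \<in> G" and MpG: "x \<in> Mp \<Longrightarrow> x \<in> G" and MmG: "x \<in> Mm \<Longrightarrow> x \<in> G"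
  using HpH MpM MmM HG MG by auto

lemma M_direct_sum: "direct_sum M Mp Mm"
  unfolding Mm_def by (rule orth_direct_sum[OF Mp_sub Mp_subset])

lemma Mm_Mp_orth: "x \<in> Mm \<Longrightarrow> y \<in> Mp \<Longrightarrow> g x y = 0" and Mp_Mm_orth: "x \<in> Mm \<Longrightarrow> y \<in> Mp \<Longrightarrow> g y x = 0"
proof -
  show *: "x \<in> Mm \<Longrightarrow> y \<in> Mp \<Longrightarrow> g x y = 0" by (simp add: Mm_def orth_compl_def)
  show "x \<in> Mm \<Longrightarrow> y \<in> Mp \<Longrightarrow> g y x = 0" using * ip_sym[OF MmM MpM] by metis
qed

lemma Mm_I: "x \<in> M \<Longrightarrow> (\<And>y. y \<in> Mp \<Longrightarrow> g x y = 0) \<Longrightarrow> x \<in> Mm"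
  by (simp add: Mm_def orth_compl_def)

lemma Mp_Mm_sum_0: "y \<in> Mp \<Longrightarrow> x \<in> Mm \<Longrightarrow> y + x = 0 \<Longrightarrow> y = 0 \<and> x = 0"
proof -
  assume yx: "y \<in> Mp" "x \<in> Mm" "y + x = 0"
  hence "x = - y" by (simp add: add_eq_0_iff)
  hence "x \<in> Mp" using Mp_closed(5)[OF yx(1)] by simp
  hence "x = 0" using yx(2) M_direct_sum unfolding direct_sum_def by blast
  thus ?thesis using yx by simp
qed

lemma rho_pH:
  assumes "a \<in> A"
  shows "rho (pH a) = pM a"
  unfolding rho_def graph_iso_def
proof (rule the_equality)
  show "pM a \<in> Mp \<and> pH a + pM a \<in> A"
    using assms G_split(3)[OF AG[OF assms]] by (simp add: Mp_def)
  fix y assume y: "y \<in> Mp \<and> pH a + y \<in> A"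
  have "(pH a + y) - a \<in> A" using y assms A_closed by blast
  moreover have "(pH a + y) - a = y - pM a"
    using G_split(3)[OF AG[OF assms]] by (metis add_diff_cancel_left)
  ultimately have "y - pM a \<in> A \<inter> M" using y MpM G_split(2)[OF AG[OF assms]] M_closed by auto
  thus "y = pM a" using A_M by auto
qed

lemma rho:
  assumes "h \<in> Hp"
  shows "rho h \<in> Mp" "h + rho h \<in> A" "rho h \<in> M" "rho h \<in> G"
proof -
  obtain a where a: "a \<in> A" "h = pH a" using assms by (auto simp: Hp_def)
  show "rho h \<in> Mp" using a rho_pH by (simp add: Mp_def)
  thus "rho h \<in> M" "rho h \<in> G" using MpM MpG by auto
  show "h + rho h \<in> A" using a rho_pH G_split(3)[OF AG[OF a(1)]] by simp
qed

lemma A_elim: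
  assumes "a \<in> A"
  obtains h where "h \<in> Hp" "a = h + rho h"
  using that[of "pH a"] assms rho_pH G_split(3)[OF AG] by (simp add: Hp_def)

lemma Mp_elim:
  assumes "y \<in> Mp"
  obtains h where "h \<in> Hp" "y = rho h"
proof -
  obtain a where "a \<in> A" "y = pM a" using assms by (auto simp: Mp_def)
  thus thesis using that[of "pH a"] rho_pH by (simp add: Hp_def)
qed

lemma rho_eq:
  assumes "h \<in> H" "y \<in> M" "h + y \<in> A"
  shows "h \<in> Hp" "rho h = y"
proof -
  show "h \<in> Hp" unfolding Hp_def using pH_add[OF assms(1,2)] assms(3) by (metis imageI)
  show "rho h = y" using rho_pH[OF assms(3)] pH_add[OF assms(1,2)] pM_add[OF assms(1,2)] by simp
qed

lemma rho_lin: "lin_on Hp rho"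
proof (rule lin_onI)
  fix h k assume hk: "h \<in> Hp" "k \<in> Hp"
  have "(h + rho h) + (k + rho k) \<in> A" using rho(2) hk A_closed(2) by simp
  hence "(h + k) + (rho h + rho k) \<in> A" by (simp add: add_ac)
  thus "rho (h + k) = rho h + rho k"
    using rho_eq(2)[of "h + k" "rho h + rho k"] hk rho(3) HpH H_closed(2) M_closed(2) by simp
next
  fix c h assume h: "h \<in> Hp"
  have "c *\<^sub>R (h + rho h) \<in> A" using rho(2)[OF h] A_closed(3) by simp
  hence "c *\<^sub>R h + c *\<^sub>R rho h \<in> A" by (simp add: scaleR_add_right)
  thus "rho (c *\<^sub>R h) = c *\<^sub>R rho h"
    using rho_eq(2)[of "c *\<^sub>R h" "c *\<^sub>R rho h"] h rho(3) HpH H_closed(3) M_closed(3) by simp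
qed

lemma rho_simps:
  "h \<in> Hp \<Longrightarrow> k \<in> Hp \<Longrightarrow> rho (h + k) = rho h + rho k"
  "h \<in> Hp \<Longrightarrow> rho (c *\<^sub>R h) = c *\<^sub>R rho h"
  "h \<in> Hp \<Longrightarrow> k \<in> Hp \<Longrightarrow> rho (h - k) = rho h - rho k"
  "rho 0 = 0"
  "h \<in> Hp \<Longrightarrow> rho (- h) = - rho h"
proof -
  show *: "h \<in> Hp \<Longrightarrow> k \<in> Hp \<Longrightarrow> rho (h + k) = rho h + rho k"
    "h \<in> Hp \<Longrightarrow> rho (c *\<^sub>R h) = c *\<^sub>R rho h" for h k c
    using rho_lin by (auto simp: lin_on_def)
  show "h \<in> Hp \<Longrightarrow> k \<in> Hp \<Longrightarrow> rho (h - k) = rho h - rho k"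
    by (rule lin_on_diff[OF Hp_sub rho_lin])
  show "rho 0 = 0" by (rule lin_on_0[OF Hp_sub rho_lin])
  show "h \<in> Hp \<Longrightarrow> rho (- h) = - rho h" using *(2)[of h "-1"] by simp
qed

lemma rho_0: "h \<in> Hp \<Longrightarrow> rho h = 0 \<Longrightarrow> h = 0"
  using rho(2)[of h] A_H HpH by simp

lemma H_Hp:
  assumes "k \<in> H" "h \<in> Hp"
  shows "br k h \<in> Hp" "br k (rho h) = rho (br k h)"
proof -
  have "br k (h + rho h) \<in> A" using br_A[OF HG[OF assms(1)] rho(2)[OF assms(2)]] .
  hence "br k h + br k (rho h) \<in> A" using assms HpG rho HG by (simp add: br_simps)
  from rho_eq[OF _ _ this]
  show "br k h \<in> Hp" "br k (rho h) = rho (br k h)" using assms br_HH br_HM HpH rho by auto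
qed

lemma H_Mm:
  assumes "k \<in> H" "x \<in> Mm"
  shows "br k x \<in> Mm"
proof (rule Mm_I)
  show "br k x \<in> M" using assms br_HM MmM by blast
  fix y assume "y \<in> Mp"
  then obtain h where h: "h \<in> Hp" "y = rho h" by (rule Mp_elim)
  have "g (br k x) y = - g x (br k y)" using H_skew assms(1) MmM[OF assms(2)] h rho by blast
  also have "\<dots> = 0" using H_Hp[OF assms(1) h(1)] h Mm_Mp_orth[OF assms(2)] rho by simp
  finally show "g (br k x) y = 0" .
qed

lemma Mm_H: "k \<in> H \<Longrightarrow> x \<in> Mm \<Longrightarrow> br x k = - br k x"
  using br_anti MmG HG by blast

text \<open>This is the relation \<open>[h + rho h, k + rho k] = 0\<close>, solved for its last term.\<close>

lemma rho_rho:
  assumes "h \<in> Hp" "k \<in> Hp"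
  shows "br (rho h) (rho k) = - br h k - 2 *\<^sub>R rho (br h k)"
proof -
  have "br (h + rho h) (k + rho k) = 0" using A_commute rho assms by blast
  hence 1: "br h k + br (rho h) k + (br h (rho k) + br (rho h) (rho k)) = 0"
    using assms HpG rho by (simp add: br_simps G_closed)
  have 2: "br h (rho k) = rho (br h k)" using H_Hp(2) assms HpH by blast
  have "br (rho h) k = - br k (rho h)" using br_anti assms HpG rho by blast
  also have "\<dots> = - rho (br k h)" using H_Hp(2) assms HpH by simp
  also have "\<dots> = rho (- br k h)" using rho_simps(5) H_Hp(1) assms HpH by simp
  also have "- br k h = br h k" using br_anti[of h k] assms HpG by simp
  finally have 3: "br (rho h) k = rho (br h k)" .
  have "br (rho h) (rho k) + (br h k + 2 *\<^sub>R rho (br h k)) = 0"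
    using 1 unfolding 2 3 by (simp add: scaleR_2 add_ac)
  hence "br (rho h) (rho k) = - (br h k + 2 *\<^sub>R rho (br h k))" by (rule eq_neg_iff_add_eq_0[THEN iffD2])
  thus ?thesis by simp
qed

text \<open>The \<open>M\<close>-component of \<open>[a, x]\<close> lies in \<open>Mp\<close>, since \<open>[a, x] \<in> A\<close>. It is also orthogonal to \<open>Mp\<close>: by
  naturality its inner product with \<open>rho k\<close> is the one of \<open>x\<close> with a vector of \<open>Mp\<close>.\<close>

lemma A_Mm:
  assumes a: "a \<in> A" and x: "x \<in> Mm"
  shows "br a x = 0"
proof -
  obtain h where h: "h \<in> Hp" "a = h + rho h" using A_elim[OF a] .
  have axA: "br a x \<in> A" using A_br a MmG[OF x] by blast
  have "br a x = br h x + br (rho h) x" using h HpG MmG[OF x] rho by (simp add: br_simps)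
  hence p: "pM (br a x) = br h x + pM (br (rho h) x)"
    using h x HpG MmG rho br_in H_Mm HpH MmM by (simp add: p_simps pM_M)
  have "pM (br a x) \<in> Mm"
  proof (rule Mm_I)
    show "pM (br a x) \<in> M" using G_split AG axA by blast
    fix y assume "y \<in> Mp"
    then obtain k where k: "k \<in> Hp" "y = rho k" by (rule Mp_elim)
    have kM: "rho k \<in> M" "rho h \<in> M" using rho k h by auto
    have b: "br h k \<in> Hp" using H_Hp(1) HpH h k by blast
    have "g (br h x) y = 0" using H_Mm[OF HpH[OF h(1)] x] Mm_Mp_orth k rho by simp
    moreover have "g (pM (br (rho h) x)) y = - g x (pM (br (rho h) (rho k)))"
      using natural[OF kM(2) MmM[OF x] kM(1)] k by simp
    moreover have "pM (br (rho h) (rho k)) = - 2 *\<^sub>R rho (br h k)"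
      using rho_rho[OF h(1) k(1)] b rho HpG HpH H_closed G_closed by (simp add: p_simps pM_H pM_M)
    moreover have "- 2 *\<^sub>R rho (br h k) \<in> Mp" using b rho Mp_closed by blast
    ultimately show "g (pM (br a x)) y = 0"
      using p x h k kM br_HM HpH MmM pM_MM Mm_Mp_orth by (simp add: ip_simps)
  qed
  moreover have "pM (br a x) \<in> Mp" using axA by (simp add: Mp_def)
  ultimately have "pM (br a x) = 0" using M_direct_sum unfolding direct_sum_def by blast
  thus ?thesis using A_pM_0 axA by blast
qed

lemma rho_Mm:
  assumes "h \<in> Hp" "x \<in> Mm"
  shows "br (rho h) x = - br h x" "br x (rho h) = br h x"
proof -
  have "br h x + br (rho h) x = 0"
    using A_Mm[OF rho(2)[OF assms(1)] assms(2)] assms HpG MmG rho by (simp add: br_simps)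
  thus *: "br (rho h) x = - br h x" by (metis add_eq_0_iff)
  show "br x (rho h) = br h x" using * br_anti[of x "rho h"] assms MmG rho by simp
qed

text \<open>The projection onto \<open>H\<close> that defines \<open>H0\<close> is computed through the splitting \<open>G = H \<oplus> A \<oplus> Mm\<close>.\<close>

abbreviation qH where "qH \<equiv> proj_along (isot D) (A + Mm)"

lemma AMm_sub: "subspace (A + Mm)"
  by (rule subspace_set_plus[OF A_sub Mm_sub])

lemma fiber_split_zero:
  assumes "h \<in> H" "a \<in> A" "m \<in> Mm" "h + a + m = 0"
  shows "h = 0" "a = 0" "m = 0"
proof -
  have "pM (h + a + m) = pM a + m"
    using assms(1-3) HG AG MmG MmM by (simp add: p_simps pM_H pM_M G_closed)
  hence "pM a + m = 0" using assms(4) pM_H[OF H_closed(1)] by simp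
  hence *: "pM a = 0" "m = 0" using Mp_Mm_sum_0[of "pM a" m] assms by (auto simp: Mp_def)
  thus "a = 0" "m = 0" using A_pM_0 assms(2) by auto
  thus "h = 0" using assms(4) by simp
qed

lemma H_AMm: "H \<inter> (A + Mm) = {0}"
proof -
  have "h = 0" if hH: "h \<in> H" and hAM: "h \<in> A + Mm" for h
  proof -
    obtain a m where am: "a \<in> A" "m \<in> Mm" "h = a + m" using hAM by (rule set_plus_elim)
    have "h + (- a) + (- m) = 0" using am(3) by simp
    thus ?thesis by (rule fiber_split_zero(1)[OF hH A_closed(5)[OF am(1)] Mm_closed(5)[OF am(2)]])
  qed
  moreover have "0 \<in> A + Mm" by (rule subspace_0[OF AMm_sub])
  ultimately show ?thesis using H_closed(1) by blast
qed

lemma qH_fiber_split: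
  assumes "h \<in> H" "a \<in> A" "m \<in> Mm"
  shows "qH (h + a + m) = h"
  by (rule proj_along_eq[OF H_sub AMm_sub H_AMm assms(1)])
    (use assms in \<open>simp add: add.assoc set_plus_intro\<close>)

lemma fiber_split:
  assumes "x \<in> G"
  obtains h a m where "h \<in> H" "a \<in> A" "m \<in> Mm" "x = h + a + m"
proof -
  obtain y m where ym: "y \<in> Mp" "m \<in> Mm" "pM x = y + m"
    using G_split(2)[OF assms] direct_sum_elim[OF M_direct_sum] by blast
  obtain k where k: "k \<in> Hp" "y = rho k" using Mp_elim[OF ym(1)] .
  have "x = (pH x - k) + (k + rho k) + m" using G_split(3)[OF assms] ym(3) k(2) by (simp add: add.assoc)
  moreover have "pH x - k \<in> H" by (rule H_closed(4)[OF G_split(1)[OF assms] HpH[OF k(1)]])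
  ultimately show thesis using that rho(2)[OF k(1)] ym(2) by metis
qed

lemma qH_H: "x \<in> G \<Longrightarrow> qH x \<in> H"
  using qH_fiber_split by (elim fiber_split) simp

lemma qH_lin: "lin_on G qH"
proof -
  have "G \<subseteq> H + (A + Mm)"
  proof
    fix x assume "x \<in> G"
    then obtain h a m where t: "h \<in> H" "a \<in> A" "m \<in> Mm" "x = h + a + m" by (rule fiber_split)
    have "h + (a + m) \<in> H + (A + Mm)" using t(1-3) by (intro set_plus_intro)
    thus "x \<in> H + (A + Mm)" using t(4) by (simp add: add.assoc)
  qed
  thus ?thesis using proj_along_lin(1)[OF H_sub AMm_sub H_AMm] by (auto simp: lin_on_def subset_iff)
qed

abbreviation H0 where "H0 \<equiv> h_zero D A Mm"

lemma bracket_G: "{br x y |x y. x \<in> Mm \<and> y \<in> Mm} \<subseteq> G" "bracket_span br Mm Mm \<subseteq> G"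
proof -
  show *: "{br x y |x y. x \<in> Mm \<and> y \<in> Mm} \<subseteq> G" using br_in MmG by blast
  show "bracket_span br Mm Mm \<subseteq> G"
    unfolding bracket_span_def by (rule span_minimal[OF * G_sub])
qed

lemma H0_span: "H0 = span {qH (br x y) |x y. x \<in> Mm \<and> y \<in> Mm}"
proof -
  obtain F where F: "linear F" "\<And>x. x \<in> G \<Longrightarrow> F x = qH x" using lin_on_extend[OF G_sub qH_lin] by blast
  have "H0 = F ` bracket_span br Mm Mm"
    unfolding h_zero_def using F(2) bracket_G(2) by (auto simp: image_iff subset_iff)
  also have "\<dots> = span (F ` {br x y |x y. x \<in> Mm \<and> y \<in> Mm})"
    unfolding bracket_span_def by (rule linear_span_image[OF F(1), symmetric])
  also have "F ` {br x y |x y. x \<in> Mm \<and> y \<in> Mm} = {qH (br x y) |x y. x \<in> Mm \<and> y \<in> Mm}"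
    using F(2) bracket_G(1) by (auto simp: image_iff subset_iff)
  finally show ?thesis .
qed

lemma H0_sub: "subspace H0"
  unfolding H0_span by simp

lemma H0_gen: "x \<in> Mm \<Longrightarrow> y \<in> Mm \<Longrightarrow> qH (br x y) \<in> H0"
  unfolding H0_span by (rule span_base) blast

lemma H0_subset: "H0 \<subseteq> H"
  unfolding H0_span by (rule span_minimal[OF _ H_sub]) (use qH_H br_in MmG in blast)

lemma H0H: "h \<in> H0 \<Longrightarrow> h \<in> H" and H0G: "h \<in> H0 \<Longrightarrow> h \<in> G"
  using H0_subset HG by auto

lemmas H0_closed = subspace_0[OF H0_sub] subspace_add[OF H0_sub] subspace_scale[OF H0_sub]
  subspace_diff[OF H0_sub] subspace_neg[OF H0_sub]

lemma bracket_Mm: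
  assumes "x \<in> Mm" "y \<in> Mm"
  obtains u k v where "u \<in> H0" "k \<in> Hp" "v \<in> Mm" "br x y = u + (k + rho k) + v" "qH (br x y) = u"
proof -
  obtain h a m where t: "h \<in> H" "a \<in> A" "m \<in> Mm" "br x y = h + a + m"
    using fiber_split br_in MmG assms by metis
  obtain k where "k \<in> Hp" "a = k + rho k" using A_elim[OF t(2)] .
  thus thesis using that[of h k m] t H0_gen[OF assms] qH_fiber_split[OF t(1-3)] by simp
qed

text \<open>By the Jacobi identity \<open>A\<close> commutes with \<open>[Mm, Mm]\<close>. The components of such a bracket along \<open>A\<close> and
  \<open>Mm\<close> commute with \<open>A\<close>, and therefore so does its component in \<open>H\<close>.\<close>

lemma A_H0:
  assumes a: "a \<in> A" and h: "h \<in> H0"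
  shows "br a h = 0"
proof -
  have "br a h \<in> {0}"
  proof (rule br_span_in)
    show "h \<in> span {qH (br x y) |x y. x \<in> Mm \<and> y \<in> Mm}" using h H0_span by simp
    show "{qH (br x y) |x y. x \<in> Mm \<and> y \<in> Mm} \<subseteq> G" using H0_gen H0G by blast
    fix s assume "s \<in> {qH (br x y) |x y. x \<in> Mm \<and> y \<in> Mm}"
    then obtain x y where xy: "x \<in> Mm" "y \<in> Mm" "s = qH (br x y)" by blast
    obtain u k v where uv: "u \<in> H0" "k \<in> Hp" "v \<in> Mm" "br x y = u + (k + rho k) + v" "qH (br x y) = u"
      using bracket_Mm[OF xy(1,2)] .
    have "br a (br x y) = 0"
      using jacobi[OF AG[OF a] MmG[OF xy(1)] MmG[OF xy(2)]] A_Mm a xy MmG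
      by (simp add: br_zero_left br_zero_right)
    hence "br a (u + (k + rho k) + v) = 0" using uv(4) by simp
    hence "br a u + br a (k + rho k) + br a v = 0"
      using AG[OF a] H0G[OF uv(1)] AG[OF rho(2)[OF uv(2)]] MmG[OF uv(3)] G_closed(2)
      by (simp add: br_add_right del: add_0)
    thus "br a s \<in> {0}" using A_commute[OF a rho(2)[OF uv(2)]] A_Mm[OF a uv(3)] uv(5) xy(3) by simp
  qed (use AG a in \<open>auto intro: subspace_single_0\<close>)
  thus ?thesis by simp
qed

text \<open>\<open>[h, k + rho k] = 0\<close> splits into an \<open>H\<close>-component and an \<open>M\<close>-component.\<close>

lemma H0_Hp:
  assumes h: "h \<in> H0" and k: "k \<in> Hp"
  shows "br h k = 0" "br h (rho k) = 0" "br k h = 0"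
proof -
  have "br h (k + rho k) = 0"
    using A_H0[OF rho(2)[OF k] h] br_anti[of h "k + rho k"] H0G[OF h] AG[OF rho(2)[OF k]] by simp
  hence "br h k + br h (rho k) = 0" using H0G[OF h] HpG[OF k] rho[OF k] by (simp add: br_add_right)
  moreover have "br h k \<in> H" "br h (rho k) \<in> M" using br_HH br_HM H0H h HpH k rho by auto
  ultimately show *: "br h k = 0" "br h (rho k) = 0"
    using pH_add[of "br h k" "br h (rho k)"] pM_add[of "br h k" "br h (rho k)"]
      pH_H[OF H_closed(1)] pM_H[OF H_closed(1)] by auto
  show "br k h = 0" using * br_anti[of k h] H0G[OF h] HpG[OF k] by simp
qed

lemma qH_equivariant:
  assumes "k \<in> H" "z \<in> G"
  shows "br k (qH z) = qH (br k z)"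
proof -
  obtain h a m where t: "h \<in> H" "a \<in> A" "m \<in> Mm" "z = h + a + m" using fiber_split[OF assms(2)] .
  have "br k z = br k h + br k a + br k m"
    using t assms HG AG MmG by (simp add: br_simps G_closed)
  thus ?thesis
    using qH_fiber_split[of "br k h" "br k a" "br k m"] qH_fiber_split[OF t(1-3)] t br_HH br_A H_Mm assms(1) HG by simp
qed

lemma H_H0:
  assumes k: "k \<in> H" and h: "h \<in> H0"
  shows "br k h \<in> H0"
proof (rule br_span_in[OF _ HG[OF k] H0_sub])
  show "h \<in> span {qH (br x y) |x y. x \<in> Mm \<and> y \<in> Mm}" using h H0_span by simp
  show "{qH (br x y) |x y. x \<in> Mm \<and> y \<in> Mm} \<subseteq> G" using H0_gen H0G by blast
  fix s assume "s \<in> {qH (br x y) |x y. x \<in> Mm \<and> y \<in> Mm}"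
  then obtain x y where xy: "x \<in> Mm" "y \<in> Mm" "s = qH (br x y)" by blast
  have G: "br x y \<in> G" "br (br k x) y \<in> G" "br x (br k y) \<in> G"
    using br_in MmG HG k xy H_Mm by simp_all
  have "br k s = qH (br (br k x) y + br x (br k y))"
    using qH_equivariant[OF k G(1)] xy(3) jacobi[OF HG[OF k] MmG[OF xy(1)] MmG[OF xy(2)]] by simp
  also have "\<dots> = qH (br (br k x) y) + qH (br x (br k y))" using qH_lin G by (simp add: lin_on_def)
  finally show "br k s \<in> H0" using H0_gen H_Mm k xy H0_closed by simp
qed

end

context fiber
begin

section \<open>The base space and the algebra on \<open>H0 \<oplus> Mm\<close>\<close>

abbreviation Gm where "Gm \<equiv> h_zero D A Mm + Mm"
abbreviation Pm where "Pm \<equiv> proj_along (h_zero D A Mm + Mm) A"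
abbreviation Dm where "Dm \<equiv> g_minus D A Mm"
abbreviation brm where "brm \<equiv> \<lambda>x y. proj_along (h_zero D A Mm + Mm) A (lbr D x y)"

lemma Dm_simps: "alg Dm = Gm" "lbr Dm = brm" "isot Dm = H0" "compl Dm = Mm" "met Dm = g"
  by (simp_all add: g_minus_def)

lemma Gm_sub: "subspace Gm"
  by (rule subspace_set_plus[OF H0_sub Mm_sub])

lemmas Gm_closed = subspace_0[OF Gm_sub] subspace_add[OF Gm_sub] subspace_scale[OF Gm_sub]
  subspace_diff[OF Gm_sub] subspace_neg[OF Gm_sub]

lemma Gm_elim:
  assumes "x \<in> Gm"
  obtains h m where "h \<in> H0" "m \<in> Mm" "x = h + m"
  using assms by (rule set_plus_elim)

lemma Gm_I: "h \<in> H0 \<Longrightarrow> m \<in> Mm \<Longrightarrow> h + m \<in> Gm"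
  by (rule set_plus_intro)

lemma Mm_Gm: "m \<in> Mm \<Longrightarrow> m \<in> Gm" and H0_Gm: "h \<in> H0 \<Longrightarrow> h \<in> Gm"
  using Gm_I[of 0 m] Gm_I[of h 0] H0_closed(1) Mm_closed(1) by simp_all

lemma Gm_G: "x \<in> Gm \<Longrightarrow> x \<in> G"
  using H0G MmG G_closed(2) by (elim Gm_elim) simp

lemma Gm_A: "Gm \<inter> A = {0}"
proof -
  have "x = 0" if xG: "x \<in> Gm" and xA: "x \<in> A" for x
  proof -
    obtain h m where hm': "h \<in> H0" "m \<in> Mm" "x = h + m" using Gm_elim[OF xG] .
    have "h + (- x) + m = 0" using hm'(3) by simp
    hence "- x = 0" by (rule fiber_split_zero(2)[OF H0H[OF hm'(1)] A_closed(5)[OF xA] hm'(2)])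
    thus ?thesis by simp
  qed
  thus ?thesis using Gm_closed(1) A_closed(1) by blast
qed

lemma Pm_add: "z \<in> Gm \<Longrightarrow> a \<in> A \<Longrightarrow> Pm (z + a) = z"
  by (rule proj_along_add(1)[OF Gm_sub A_sub Gm_A])

lemma Pm_Gm: "z \<in> Gm \<Longrightarrow> Pm z = z"
  using Pm_add[of z 0] A_closed(1) by simp

lemma A_Gm:
  assumes "a \<in> A" "z \<in> Gm"
  shows "br a z = 0" "br z a = 0"
proof -
  obtain h m where hm': "h \<in> H0" "m \<in> Mm" "z = h + m" using Gm_elim[OF assms(2)] .
  show *: "br a z = 0" using hm' A_H0 A_Mm assms(1) AG H0G MmG by (simp add: br_simps)
  show "br z a = 0" using * br_anti[of z a] Gm_G AG assms by simp
qed

lemma H_Gm: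
  assumes "k \<in> H" "z \<in> Gm"
  shows "br k z \<in> Gm"
proof -
  obtain h m where hm': "h \<in> H0" "m \<in> Mm" "z = h + m" using Gm_elim[OF assms(2)] .
  have "br k z = br k h + br k m" using hm' assms(1) HG H0G MmG by (simp add: br_simps)
  thus ?thesis using Gm_I H_H0 H_Mm assms(1) hm' by simp
qed

text \<open>The bracket in the two splittings \<open>H \<oplus> A \<oplus> Mm\<close> and \<open>H \<oplus> M\<close> at once.\<close>

lemma bracket_Mm':
  assumes "x \<in> Mm" "y \<in> Mm"
  obtains u k v where "u \<in> H0" "k \<in> Hp" "v \<in> Mm" "br x y = u + (k + rho k) + v" "qH (br x y) = u"
    "brm x y = u + v" "pM (br x y) = rho k + v" "pH (br x y) = u + k"
proof -
  obtain u k v where *: "u \<in> H0" "k \<in> Hp" "v \<in> Mm" "br x y = u + (k + rho k) + v" "qH (br x y) = u"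
    using bracket_Mm[OF assms] .
  have e: "br x y = (u + v) + (k + rho k)" "br x y = (u + k) + (rho k + v)"
    using *(4) by (simp_all add: add_ac)
  have "brm x y = u + v" unfolding e(1) by (rule Pm_add[OF Gm_I[OF *(1,3)] rho(2)[OF *(2)]])
  moreover have "u + k \<in> H" "rho k + v \<in> M"
    using H_closed(2)[OF H0H[OF *(1)] HpH[OF *(2)]] M_closed(2)[OF rho(3)[OF *(2)] MmM[OF *(3)]] .
  hence "pM (br x y) = rho k + v" "pH (br x y) = u + k" unfolding e(2) by (simp_all add: pM_add pH_add)
  ultimately show thesis using that * by blast
qed

lemma bracket_Gm:
  assumes "x \<in> Gm" "y \<in> Gm"
  obtains z a where "z \<in> Gm" "a \<in> A" "br x y = z + a" "brm x y = z"
proof -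
  obtain h m where 1: "h \<in> H0" "m \<in> Mm" "x = h + m" using Gm_elim[OF assms(1)] .
  obtain h' m' where 2: "h' \<in> H0" "m' \<in> Mm" "y = h' + m'" using Gm_elim[OF assms(2)] .
  obtain u k v where 3: "u \<in> H0" "k \<in> Hp" "v \<in> Mm" "br m m' = u + (k + rho k) + v"
    using bracket_Mm[OF 1(2) 2(2)] by metis
  have in_G: "h \<in> G" "m \<in> G" "h' \<in> G" "m' \<in> G" using 1 2 H0G MmG by auto
  have "br x y = br h h' + br h m' + br m h' + br m m'"
    using 1(3) 2(3) in_G by (simp add: br_simps G_closed add_ac)
  also have "\<dots> = ((br h h' + u) + (br h m' + br m h' + v)) + (k + rho k)"
    using 3(4) by (simp add: add_ac)
  finally have e: "br x y = ((br h h' + u) + (br h m' + br m h' + v)) + (k + rho k)" .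
  have "br h h' + u \<in> H0" using H_H0[OF H0H[OF 1(1)] 2(1)] 3(1) H0_closed(2) by simp
  moreover have "br h m' + br m h' + v \<in> Mm"
    using H_Mm[OF H0H[OF 1(1)] 2(2)] H_Mm[OF H0H[OF 2(1)] 1(2)] Mm_H[OF H0H[OF 2(1)] 1(2)] 3(3)
      Mm_closed(2,4) by simp
  ultimately have z: "(br h h' + u) + (br h m' + br m h' + v) \<in> Gm" by (rule Gm_I)
  have "brm x y = (br h h' + u) + (br h m' + br m h' + v)"
    unfolding e by (rule Pm_add[OF z rho(2)[OF 3(2)]])
  thus thesis using that[OF z rho(2)[OF 3(2)] e] by blast
qed

lemma Pm_lin: "lin_on (Gm + A) Pm"
  by (rule proj_along_lin(1)[OF Gm_sub A_sub Gm_A])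

lemma GmA_sub: "subspace (Gm + A)"
  by (rule subspace_set_plus[OF Gm_sub A_sub])

lemma br_GmA: "x \<in> Gm \<Longrightarrow> y \<in> Gm \<Longrightarrow> br x y \<in> Gm + A"
  by (rule bracket_Gm, assumption+) (simp add: set_plus_intro)

lemma brm_Gm: "x \<in> Gm \<Longrightarrow> y \<in> Gm \<Longrightarrow> brm x y \<in> Gm"
  by (rule bracket_Gm, assumption+) simp

lemma Pm_add_br: "u \<in> Gm + A \<Longrightarrow> v \<in> Gm + A \<Longrightarrow> Pm (u + v) = Pm u + Pm v"
  and Pm_scale_br: "u \<in> Gm + A \<Longrightarrow> Pm (c *\<^sub>R u) = c *\<^sub>R Pm u"
  using Pm_lin by (simp_all add: lin_on_def)

text \<open>The inner projection may be dropped because \<open>A\<close> commutes with \<open>H0 \<oplus> Mm\<close>.\<close>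

lemma brm_brm:
  assumes "x \<in> Gm" "y \<in> Gm" "z \<in> Gm"
  shows "brm x (brm y z) = Pm (br x (br y z))" "br x (br y z) \<in> Gm + A"
proof -
  obtain w a where w: "w \<in> Gm" "a \<in> A" "br y z = w + a" "brm y z = w"
    using bracket_Gm[OF assms(2,3)] .
  have "br x (br y z) = br x w"
    using w A_Gm(2)[OF w(2) assms(1)] Gm_G assms(1) AG by (simp add: br_simps)
  thus "brm x (brm y z) = Pm (br x (br y z))" "br x (br y z) \<in> Gm + A"
    using w(1,4) br_GmA[OF assms(1) w(1)] by simp_all
qed

lemma lie_algebra_Dm: "lie_algebra Gm brm"
  unfolding lie_algebra_def
proof (intro conjI ballI allI)
  show "subspace Gm" by (rule Gm_sub)
  show "fin_spanned Gm" by (rule fin_spanned_subspace[OF G_fin Gm_sub]) (use Gm_G in blast)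
  fix x assume x: "x \<in> Gm"
  show "brm x x = 0" using br_self[OF Gm_G[OF x]] Pm_Gm[OF Gm_closed(1)] by simp
  fix y assume y: "y \<in> Gm"
  show "brm x y \<in> Gm" by (rule brm_Gm[OF x y])
  show "brm (c *\<^sub>R x) y = c *\<^sub>R brm x y" "brm x (c *\<^sub>R y) = c *\<^sub>R brm x y" for c
    using Pm_scale_br[OF br_GmA[OF x y]] Gm_G x y by (simp_all add: br_simps)
  fix z assume z: "z \<in> Gm"
  show "brm (x + y) z = brm x z + brm y z" "brm z (x + y) = brm z x + brm z y"
    using Pm_add_br br_GmA Gm_G x y z by (simp_all add: br_simps)
  have "br x (br y z) + br y (br z x) + br z (br x y) = 0"
    using lie Gm_G[OF x] Gm_G[OF y] Gm_G[OF z] unfolding lie_algebra_def by blast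
  moreover have "Pm (br x (br y z) + br y (br z x) + br z (br x y))
    = brm x (brm y z) + brm y (brm z x) + brm z (brm x y)"
    using x y z subspace_add[OF GmA_sub] by (simp add: brm_brm Pm_add_br)
  ultimately show "brm x (brm y z) + brm y (brm z x) + brm z (brm x y) = 0"
    using Pm_Gm[OF Gm_closed(1)] by simp
qed

lemma H0_Mm: "H0 \<inter> Mm = {0}"
  using H0_subset MmM HM0 H0_closed(1) Mm_closed(1) by blast

lemma Dm_split:
  assumes "u \<in> H0" "v \<in> Mm"
  shows "proj_along H0 Mm (u + v) = u" "proj_along Mm H0 (u + v) = v"
  using proj_along_add[OF H0_sub Mm_sub H0_Mm assms] by auto

text \<open>On \<open>Mm\<close> the torsion of \<open>D\<close> differs from that of \<open>H0 \<oplus> Mm\<close> by a term in \<open>Mp\<close> only.\<close>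

lemma Dm_torsion:
  assumes "x \<in> Mm" "y \<in> Mm" "z \<in> Mm"
  shows "g (proj_along Mm H0 (brm x y)) z = g (pM (br x y)) z"
proof -
  obtain u k v where *: "u \<in> H0" "k \<in> Hp" "v \<in> Mm" "brm x y = u + v" "pM (br x y) = rho k + v"
    using bracket_Mm'[OF assms(1,2)] by metis
  have "g (rho k + v) z = g v z"
    using Mp_Mm_orth[OF assms(3) rho(1)[OF *(2)]] rho(3)[OF *(2)] MmM *(3) assms(3)
    by (simp add: ip_add_left)
  thus ?thesis using * Dm_split by simp
qed

lemma brm_H0_Mm: "h \<in> H0 \<Longrightarrow> x \<in> Mm \<Longrightarrow> brm h x = br h x"
  using Pm_Gm[OF Mm_Gm] H_Mm H0H by blast

lemma brm_H0_H0: "h \<in> H0 \<Longrightarrow> k \<in> H0 \<Longrightarrow> brm h k = br h k"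
  using Pm_Gm[OF H0_Gm] H_H0 H0H by blast

lemma Mm_natural:
  "x \<in> Mm \<Longrightarrow> y \<in> Mm \<Longrightarrow> z \<in> Mm \<Longrightarrow> g (pM (br x y)) z = - g y (pM (br x z))"
  using natural MmM by blast

lemma inner_product_Mm: "inner_product_on Mm g"
proof -
  interpret Mm: ip_space Mm g by (rule subspace_ip_space[OF Mm_sub]) (use MmM in blast)
  show ?thesis by (rule Mm.ip)
qed

lemma naturally_reductive_Dm: "naturally_reductive Dm"
  unfolding naturally_reductive_def Dm_simps
proof (intro conjI ballI)
  show "lie_algebra Gm brm" by (rule lie_algebra_Dm)
  show "subalgebra Gm brm H0"
    using H0_sub H0_Gm H_H0 H0H by (auto simp: subalgebra_def brm_H0_H0)
  show "direct_sum Gm H0 Mm" using H0_sub Mm_sub H0_Mm by (simp add: direct_sum_def)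
  show "inner_product_on Mm g" by (rule inner_product_Mm)
next
  fix h x assume hx: "h \<in> H0" "x \<in> Mm"
  show "brm h x \<in> Mm" using hx H_Mm H0H by (simp add: brm_H0_Mm)
next
  fix h assume h: "h \<in> H0"
  show "skew_on Mm g (brm h)"
    using h H_skew H0H MmM by (simp add: skew_on_def brm_H0_Mm)
next
  fix x y z assume xyz: "x \<in> Mm" "y \<in> Mm" "z \<in> Mm"
  have "proj_along Mm H0 (brm x z) \<in> Mm"
    by (rule bracket_Mm'[OF xyz(1,3)]) (simp add: Dm_split)
  hence "g y (proj_along Mm H0 (brm x z)) = g (proj_along Mm H0 (brm x z)) y"
    using ip_sym MmM xyz by blast
  also have "\<dots> = g y (pM (br x z))"
    using Dm_torsion[OF xyz(1,3,2)] ip_sym MmM pM_MM xyz by simp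
  finally show "g (proj_along Mm H0 (brm x y)) z = - g y (proj_along Mm H0 (brm x z))"
    using Dm_torsion[OF xyz] Mm_natural[OF xyz] by simp
qed

text \<open>An element of \<open>H0\<close> annihilates \<open>Mp\<close>, so it acts on \<open>M\<close> only through \<open>Mm\<close>.\<close>

lemma H0_effective:
  assumes "h \<in> H0" "\<And>x. x \<in> Mm \<Longrightarrow> br h x = 0"
  shows "h = 0"
proof (rule effectiveD[OF H0H[OF assms(1)]])
  fix x assume x: "x \<in> M"
  obtain y m where ym: "y \<in> Mp" "m \<in> Mm" "x = y + m" using direct_sum_elim[OF M_direct_sum x] .
  obtain k where k: "k \<in> Hp" "y = rho k" using Mp_elim[OF ym(1)] .
  show "br h x = 0"
    using ym k H0_Hp(2)[OF assms(1) k(1)] assms H0G MmG rho by (simp add: br_simps)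
qed

lemma effective_Dm: "effective Dm"
  unfolding effective_def Dm_simps
proof (rule inj_onI)
  fix h k assume hk: "h \<in> H0" "k \<in> H0" and e: "zero_outside Mm (brm h) = zero_outside Mm (brm k)"
  have "br (h - k) x = 0" if x: "x \<in> Mm" for x
  proof -
    have "brm h x = brm k x" using fun_cong[OF e, of x] x by (simp add: zero_outside_def)
    thus ?thesis using hk x brm_H0_Mm H0G MmG by (simp add: br_simps)
  qed
  hence "h - k = 0" by (rule H0_effective[OF H0_closed(4)[OF hk]])
  thus "h = k" by simp
qed

lemma transvection_natred_Dm: "transvection_natred Dm"
proof unfold_locales
  show "naturally_reductive Dm" by (rule naturally_reductive_Dm)
  show "effective Dm" by (rule effective_Dm)
  have "proj_along H0 Mm (brm x y) = qH (br x y)" if "x \<in> Mm" "y \<in> Mm" for x y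
    by (rule bracket_Mm'[OF that]) (simp add: Dm_split)
  hence "{proj_along H0 Mm (brm x y) |x y. x \<in> Mm \<and> y \<in> Mm}
    = {qH (br x y) |x y. x \<in> Mm \<and> y \<in> Mm}" by (intro Collect_cong) metis
  thus "isot Dm = span {proj_along (isot Dm) (compl Dm) (lbr Dm x y) |x y. x \<in> compl Dm \<and> y \<in> compl Dm}"
    unfolding Dm_simps using H0_span by simp
qed

abbreviation base_isot where "base_isot \<equiv> isot D + Mp"

text \<open>With \<open>A\<close> in place of \<open>Mp\<close>, the action on \<open>Mm\<close> becomes transparent: \<open>A\<close> acts by zero.\<close>

lemma base_isot_eq: "base_isot = H + A"
proof
  show "base_isot \<subseteq> H + A"
  proof
    fix x assume "x \<in> base_isot"
    then obtain h y where hy: "h \<in> H" "y \<in> Mp" "x = h + y" by (rule set_plus_elim)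
    obtain k where k: "k \<in> Hp" "y = rho k" using Mp_elim[OF hy(2)] .
    have "x = (h - k) + (k + rho k)" using hy k by simp
    thus "x \<in> H + A" using set_plus_intro[OF H_closed(4)[OF hy(1) HpH[OF k(1)]] rho(2)[OF k(1)]] by simp
  qed
  show "H + A \<subseteq> base_isot"
  proof
    fix x assume "x \<in> H + A"
    then obtain h a where ha: "h \<in> H" "a \<in> A" "x = h + a" by (rule set_plus_elim)
    obtain k where k: "k \<in> Hp" "a = k + rho k" using A_elim[OF ha(2)] .
    have "x = (h + k) + rho k" using ha k by (simp add: add.assoc)
    thus "x \<in> base_isot" using set_plus_intro[OF H_closed(2)[OF ha(1) HpH[OF k(1)]] rho(1)[OF k(1)]] by simp
  qed
qed

lemma base_isot_sub: "subspace base_isot"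
  by (rule subspace_set_plus[OF H_sub Mp_sub])

lemma base_isot_elim:
  assumes "x \<in> base_isot"
  obtains h a where "h \<in> H" "a \<in> A" "x = h + a"
  using assms unfolding base_isot_eq by (rule set_plus_elim)

lemma base_isot_Mm: "base_isot \<inter> Mm = {0}"
proof -
  have "x = 0" if xE: "x \<in> base_isot" and xM: "x \<in> Mm" for x
  proof -
    obtain h a where ha: "h \<in> H" "a \<in> A" "x = h + a" using base_isot_elim[OF xE] .
    have "h + a + (- x) = 0" using ha(3) by simp
    hence "- x = 0" by (rule fiber_split_zero(3)[OF ha(1,2) Mm_closed(5)[OF xM]])
    thus ?thesis by simp
  qed
  thus ?thesis using subspace_0[OF base_isot_sub] Mm_closed(1) by blast
qed

lemma base_isot_action:
  assumes "h \<in> H" "a \<in> A" "x \<in> Mm"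
  shows "br (h + a) x = br h x"
  using assms A_Mm HG AG MmG by (simp add: br_simps)

lemma base_space_torsion:
  assumes "w \<in> G" "z \<in> Mm"
  shows "g (proj_along Mm base_isot w) z = g (pM w) z" "proj_along Mm base_isot w \<in> Mm"
proof -
  obtain h a m where t: "h \<in> H" "a \<in> A" "m \<in> Mm" "w = h + a + m" using fiber_split[OF assms(1)] .
  have "h + a \<in> base_isot" unfolding base_isot_eq using t by (simp add: set_plus_intro)
  hence "proj_along Mm base_isot w = m" using proj_along_add(2)[OF base_isot_sub Mm_sub base_isot_Mm _ t(3)] t(4) by blast
  moreover have "pM w = pM a + m"
    using t HG AG MmG MmM by (simp add: p_simps pM_H pM_M G_closed)
  moreover have "pM a \<in> Mp" using t by (simp add: Mp_def)
  ultimately show "g (proj_along Mm base_isot w) z = g (pM w) z" "proj_along Mm base_isot w \<in> Mm"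
    using Mp_Mm_orth[OF assms(2)] MpM MmM t(3) assms(2) by (simp_all add: ip_add_left)
qed

lemma naturally_reductive_base_space: "naturally_reductive (base_space D Mp Mm)"
proof -
  have b: "alg (base_space D Mp Mm) = G" "lbr (base_space D Mp Mm) = br"
    "isot (base_space D Mp Mm) = base_isot" "compl (base_space D Mp Mm) = Mm" "met (base_space D Mp Mm) = g"
    by (simp_all add: base_space_def)
  show ?thesis
    unfolding naturally_reductive_def b
  proof (intro conjI ballI)
    show "lie_algebra G br" by (rule lie)
    show "inner_product_on Mm g" by (rule inner_product_Mm)
    have EG: "x \<in> G" if "x \<in> base_isot" for x
      by (rule base_isot_elim[OF that]) (use HG AG G_closed in simp)
    show "direct_sum G base_isot Mm"
    proof (rule direct_sumI[OF G_sub base_isot_sub Mm_sub _ _ base_isot_Mm])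
      fix x assume "x \<in> G"
      then obtain h a m where t: "h \<in> H" "a \<in> A" "m \<in> Mm" "x = h + a + m" by (rule fiber_split)
      have "h + a \<in> base_isot" unfolding base_isot_eq using t by (simp add: set_plus_intro)
      thus "\<exists>u\<in>base_isot. \<exists>w\<in>Mm. x = u + w" using t by blast
    qed (use EG MmG in auto)
    have "br x y \<in> base_isot" if x: "x \<in> base_isot" and y: "y \<in> base_isot" for x y
    proof -
      obtain h a where ha: "h \<in> H" "a \<in> A" "x = h + a" using base_isot_elim[OF x] .
      obtain k b where kb: "k \<in> H" "b \<in> A" "y = k + b" using base_isot_elim[OF y] .
      have "br x y = br h k + (br h b + br a k + br a b)"
        using ha kb HG AG by (simp add: br_simps G_closed add_ac)
      moreover have "br h b + br a k + br a b \<in> A"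
        using ha kb HG AG br_A A_br A_closed by simp
      ultimately show ?thesis unfolding base_isot_eq using br_HH ha kb by (simp add: set_plus_intro)
    qed
    thus "subalgebra G br base_isot" using base_isot_sub EG by (auto simp: subalgebra_def)
  next
    fix e x assume e: "e \<in> base_isot" and x: "x \<in> Mm"
    show "br e x \<in> Mm" by (rule base_isot_elim[OF e]) (simp add: base_isot_action x H_Mm)
  next
    fix e assume e: "e \<in> base_isot"
    show "skew_on Mm g (br e)"
      by (rule base_isot_elim[OF e]) (simp add: base_isot_action skew_on_def H_skew MmM)
  next
    fix x y z assume xyz: "x \<in> Mm" "y \<in> Mm" "z \<in> Mm"
    have G: "br x y \<in> G" "br x z \<in> G" using br_in MmG xyz by auto
    have "g y (proj_along Mm base_isot (br x z)) = g (proj_along Mm base_isot (br x z)) y"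
      using ip_sym base_space_torsion(2)[OF G(2) xyz(2)] MmM xyz by blast
    also have "\<dots> = g y (pM (br x z))"
      using base_space_torsion(1)[OF G(2) xyz(2)] ip_sym MmM pM_MM xyz by simp
    finally show "g (proj_along Mm base_isot (br x y)) z = - g y (proj_along Mm base_isot (br x z))"
      using base_space_torsion(1)[OF G(1) xyz(3)] Mm_natural[OF xyz] by simp
  qed
qed

lemma base_space_isomorphic: "isomorphic_decomps (base_space D Mp Mm) Dm"
proof -
  have t: "g (- proj_along Mm base_isot (br x y)) z = g (- proj_along Mm H0 (brm x y)) z"
    if "x \<in> Mm" "y \<in> Mm" "z \<in> Mm" for x y z
  proof -
    have G: "br x y \<in> G" using br_in MmG that by auto
    have "proj_along Mm H0 (brm x y) \<in> Mm"
      by (rule bracket_Mm'[OF that(1,2)]) (simp add: Dm_split)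
    thus ?thesis
      using base_space_torsion[OF G that(3)] Dm_torsion[OF that] MmM that by (simp add: ip_neg_left)
  qed
  have r: "br (proj_along base_isot Mm (br x y)) z = brm (proj_along H0 Mm (brm x y)) z"
    if xyz: "x \<in> Mm" "y \<in> Mm" "z \<in> Mm" for x y z
  proof -
    obtain u k v where *: "u \<in> H0" "k \<in> Hp" "v \<in> Mm" "br x y = u + (k + rho k) + v"
      "brm x y = u + v" using bracket_Mm'[OF xyz(1,2)] by metis
    have "u + (k + rho k) \<in> base_isot" unfolding base_isot_eq using * H0H rho by (simp add: set_plus_intro)
    hence "proj_along base_isot Mm (br x y) = u + (k + rho k)"
      using proj_along_add(1)[OF base_isot_sub Mm_sub base_isot_Mm _ *(3)] *(4) by simp
    moreover have "proj_along H0 Mm (brm x y) = u" using *(1,3,5) Dm_split by simp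
    ultimately show ?thesis
      using base_isot_action[OF H0H[OF *(1)] rho(2)[OF *(2)] xyz(3)] brm_H0_Mm[OF *(1) xyz(3)] by simp
  qed
  show ?thesis
    unfolding isomorphic_decomps_def isomorphic_models_def
    by (rule exI[of _ "\<lambda>x. x"])
      (auto simp: model_of_def base_space_def Dm_simps t r linear_id[unfolded id_def] bij_betw_def inj_on_def)
qed

section \<open>Semisimplicity\<close>

text \<open>
  Let \<open>J\<close> be the largest abelian ideal of the centerless part of \<open>H0 \<oplus> Mm\<close>. All of \<open>H\<close> acts on
  \<open>H0 \<oplus> Mm\<close> by derivations, so \<open>J\<close> is \<open>H\<close>-invariant and \<open>A + J\<close> is an ideal of \<open>G\<close>. Brackets of
  elements of \<open>J\<close> lie in \<open>A\<close>, and their \<open>A\<close>-component is measured by the action of \<open>Hp\<close> on the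
  \<open>Mm\<close>-components of \<open>J\<close>; that action vanishes, because it maps into \<open>J \<inter> Mm = {0}\<close>. So \<open>A + J\<close> is
  an abelian ideal.
\<close>

lemma no_abelian_radical:
  assumes maximal: "\<And>I. lie_ideal G br I \<Longrightarrow> abelian I br \<Longrightarrow> I \<subseteq> A"
  shows "transvection_natred.abelian_radical Dm = {0}"
proof -
  interpret m: transvection_natred Dm by (rule transvection_natred_Dm)
  define J where "J = m.abelian_radical"
  have "J \<in> m.centerless_abelian" using m.abelian_radical_in J_def by simp
  hence J: "lie_ideal Gm brm J" "abelian J brm" and J_Mm: "J \<inter> Mm = {0}"
    using m.centerless_abelian_inter[of J] by (auto simp: m.centerless_abelian_def Dm_simps)
  have J_sub: "subspace J" and JGm: "\<And>j. j \<in> J \<Longrightarrow> j \<in> Gm" using J(1) by (auto simp: lie_ideal_def)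
  have JG: "j \<in> G" if "j \<in> J" for j using Gm_G[OF JGm[OF that]] .
  have H_J: "br l j \<in> J" if l: "l \<in> H" and j: "j \<in> J" for l j
    unfolding J_def
  proof (rule m.derivation_abelian_radical[of "br l" j], unfold Dm_simps)
    show "lin_on Gm (br l)" using br_lin HG[OF l] Gm_G by blast
    show "br l x \<in> Gm" if "x \<in> Gm" for x by (rule H_Gm[OF l that])
    show "br l h \<in> H0" if "h \<in> H0" for h by (rule H_H0[OF l that])
    show "br l x \<in> Mm" if "x \<in> Mm" for x by (rule H_Mm[OF l that])
    show "skew_on Mm g (br l)" using H_skew l MmM by (simp add: skew_on_def)
    show "j \<in> m.abelian_radical" using j J_def by simp
    fix x y assume x: "x \<in> Gm" and y: "y \<in> Gm"
    obtain z a where za: "z \<in> Gm" "a \<in> A" "br x y = z + a" "brm x y = z"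
      using bracket_Gm[OF x y] .
    have "br l (br x y) = br l z + br l a" using za HG l Gm_G AG by (simp add: br_simps)
    hence "Pm (br l (br x y)) = br l z" using Pm_add[OF H_Gm[OF l za(1)] br_A[OF HG[OF l] za(2)]] by simp
    moreover have "br l (br x y) = br (br l x) y + br x (br l y)"
      using jacobi HG[OF l] Gm_G x y by blast
    ultimately show "br l (brm x y) = brm (br l x) y + brm x (br l y)"
      using Pm_add_br br_GmA H_Gm l x y za(4) by simp
  qed
  have JJ: "br j j' = 0" if j: "j \<in> J" and j': "j' \<in> J" for j j'
  proof -
    obtain z a where za: "z \<in> Gm" "a \<in> A" "br j j' = z + a" "brm j j' = z"
      using bracket_Gm[OF JGm[OF j] JGm[OF j']] .
    have "z = 0" using J(2) j j' za(4) by (simp add: abelian_def)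
    hence bA: "br j j' \<in> A" using za by simp
    obtain k y where ky: "k \<in> H0" "y \<in> Mm" "j = k + y" using Gm_elim[OF JGm[OF j]] .
    obtain k' y' where ky': "k' \<in> H0" "y' \<in> Mm" "j' = k' + y'" using Gm_elim[OF JGm[OF j']] .
    note in_G = H0G[OF ky(1)] H0G[OF ky'(1)] MmG[OF ky(2)] MmG[OF ky'(2)]
    have "br j j' = br k k' + br k y' + br y k' + br y y'"
      using ky(3) ky'(3) in_G by (simp add: br_simps G_closed add_ac)
    moreover have Mm2: "br k y' \<in> Mm" "br y k' \<in> Mm"
      using H_Mm[OF H0H] ky ky' Mm_H[OF H0H[OF ky'(1)] ky(2)] Mm_closed(5) by simp_all
    moreover have "br k k' \<in> H" using br_HH H0H ky ky' by blast
    ultimately have p: "pM (br j j') = br k y' + br y k' + pM (br y y')"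
      using br_in in_G MmM MmG HG by (simp add: p_simps pM_H pM_M G_closed)
    have "g (pM (br j j')) (rho l) = 0" if l: "l \<in> Hp" for l
    proof -
      have "br l j = br l k + br l y" using ky in_G HpG[OF l] by (simp add: br_simps)
      hence "br l y \<in> J" using H_J[OF HpH[OF l] j] H0_Hp(3)[OF ky(1) l] by simp
      hence 0: "br l y = 0" using J_Mm H_Mm[OF HpH[OF l] ky(2)] by blast
      have "g (pM (br y y')) (rho l) = - g y' (pM (br y (rho l)))"
        using natural MmM ky ky' rho(3)[OF l] by blast
      also have "\<dots> = 0"
        using rho_Mm(2)[OF l ky(2)] 0 pM_M[OF M_closed(1)] MmM[OF ky'(2)] by (simp add: ip_zero_right)
      finally show ?thesis
        using p Mm_Mp_orth[OF _ rho(1)[OF l]] Mm2 MmM rho(3)[OF l] pM_MM ky(2) ky'(2) M_closed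
        by (simp add: ip_add_left)
    qed
    moreover obtain l where l: "l \<in> Hp" "pM (br j j') = rho l"
      using bA Mp_elim[of "pM (br j j')"] by (auto simp: Mp_def)
    ultimately have "g (rho l) (rho l) = 0" by metis
    hence "pM (br j j') = 0" using l ip_eq_0 rho(3) by simp
    thus ?thesis using A_pM_0 bA by blast
  qed
  have AJ: "lie_ideal G br (A + J)"
    unfolding lie_ideal_def
  proof (intro conjI ballI)
    show AJ_sub: "subspace (A + J)" by (rule subspace_set_plus[OF A_sub J_sub])
    show "A + J \<subseteq> G" using AG JG G_closed(2) by (auto elim!: set_plus_elim)
    fix x y assume x: "x \<in> G" and y: "y \<in> A + J"
    obtain h a m where t: "h \<in> H" "a \<in> A" "m \<in> Mm" "x = h + a + m" using fiber_split[OF x] .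
    obtain b j where bj: "b \<in> A" "j \<in> J" "y = b + j" using y by (rule set_plus_elim)
    obtain z c where zc: "z \<in> Gm" "c \<in> A" "br m j = z + c" "brm m j = z"
      using bracket_Gm[OF Mm_Gm[OF t(3)] JGm[OF bj(2)]] .
    have zJ: "z \<in> J" using J(1) Mm_Gm[OF t(3)] bj(2) zc(4) unfolding lie_ideal_def by metis
    have "br a j = 0" by (rule A_Gm(1)[OF t(2) JGm[OF bj(2)]])
    hence "br x y = (br x b + c) + (br h j + z)"
      using t bj HG AG MmG JG x zc(3) by (simp add: br_simps G_closed add_ac)
    moreover have "br x b + c \<in> A" using br_A[OF x bj(1)] zc(2) A_closed(2) by blast
    moreover have "br h j + z \<in> J" using H_J[OF t(1) bj(2)] zJ subspace_add[OF J_sub] by blast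
    ultimately show "br x y \<in> A + J" by (simp add: set_plus_intro)
  qed
  have "abelian (A + J) br"
    unfolding abelian_def
  proof (intro ballI)
    fix x y assume x: "x \<in> A + J" and y: "y \<in> A + J"
    obtain a j where aj: "a \<in> A" "j \<in> J" "x = a + j" using x by (rule set_plus_elim)
    obtain b k where bk: "b \<in> A" "k \<in> J" "y = b + k" using y by (rule set_plus_elim)
    show "br x y = 0"
      using aj bk A_commute JJ A_Gm JGm AG JG by (simp add: br_simps G_closed)
  qed
  hence "A + J \<subseteq> A" by (rule maximal[OF AJ])
  hence "J \<subseteq> A" using set_plus_right[OF A_sub, of J] by blast
  hence "J = {0}" using JGm Gm_A subspace_0[OF J_sub] by blast
  thus ?thesis by (simp add: J_def)
qed

end

section \<open>The Lie algebra of an extension\<close>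

lemma transport_apply:
  assumes "inj_on f V" "x \<in> V" "y \<in> V"
  shows "transport f V b (f x) (f y) = b x y"
  using assms by (simp add: transport_def)

lemma (in lie) lie_algebra_image:
  assumes lin: "lin_on G f" and hom: "\<And>x y. x \<in> G \<Longrightarrow> y \<in> G \<Longrightarrow> f (br x y) = br' (f x) (f y)"
  shows "lie_algebra (f ` G) br'"
  unfolding lie_algebra_def
proof (intro conjI)
  have add: "f x + f y = f (x + y)" if "x \<in> G" "y \<in> G" for x y using lin that by (simp add: lin_on_def)
  have scale: "c *\<^sub>R f x = f (c *\<^sub>R x)" if "x \<in> G" for c x using lin that by (simp add: lin_on_def)
  have zero: "f 0 = 0" by (rule lin_on_0[OF G_sub lin])
  show "subspace (f ` G)" by (rule lin_on_subspace_image[OF G_sub lin])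
  show "fin_spanned (f ` G)" by (rule lin_on_fin_spanned_image[OF G_fin lin])
  show "\<forall>x\<in>f ` G. \<forall>y\<in>f ` G. br' x y \<in> f ` G" using br_in by (auto simp flip: hom)
  show "\<forall>x\<in>f ` G. \<forall>y\<in>f ` G. \<forall>z\<in>f ` G. br' (x + y) z = br' x z + br' y z \<and> br' z (x + y) = br' z x + br' z y"
    by (auto simp: add G_closed br_in br_simps simp flip: hom)
  show "\<forall>c. \<forall>x\<in>f ` G. \<forall>y\<in>f ` G. br' (c *\<^sub>R x) y = c *\<^sub>R br' x y \<and> br' x (c *\<^sub>R y) = c *\<^sub>R br' x y"
    by (auto simp: scale G_closed br_in br_simps simp flip: hom)
  show "\<forall>x\<in>f ` G. br' x x = 0" by (auto simp: br_self zero simp flip: hom)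
  show "\<forall>x\<in>f ` G. \<forall>y\<in>f ` G. \<forall>z\<in>f ` G. br' x (br' y z) + br' y (br' z x) + br' z (br' x y) = 0"
  proof (intro ballI)
    fix x' y' z' assume "x' \<in> f ` G" "y' \<in> f ` G" "z' \<in> f ` G"
    then obtain x y z where *: "x \<in> G" "y \<in> G" "z \<in> G" "x' = f x" "y' = f y" "z' = f z" by blast
    have "br' x' (br' y' z') + br' y' (br' z' x') + br' z' (br' x' y')
      = f (br x (br y z) + br y (br z x) + br z (br x y))"
      using *(1-3) unfolding *(4-6) by (simp add: add G_closed br_in flip: hom)
    also have "br x (br y z) + br y (br z x) + br z (br x y) = 0"
      using lie *(1-3) unfolding lie_algebra_def by blast
    finally show "br' x' (br' y' z') + br' y' (br' z' x') + br' z' (br' x' y') = 0"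
      using zero by simp
  qed
qed

context ip_space
begin

lemma parseval:
  assumes "orthonormal_basis V g E" "x \<in> V" "y \<in> V"
  shows "(\<Sum>e\<in>E. g x e * g e y) = g x y"
proof -
  have E: "finite E" "\<And>e. e \<in> E \<Longrightarrow> e \<in> V" using assms(1) by (auto simp: orthonormal_basis_def)
  have "g x y = g (\<Sum>e\<in>E. g x e *\<^sub>R e) y" using orthonormal_expansion[OF assms(1,2)] by simp
  also have "\<dots> = (\<Sum>e\<in>E. g (g x e *\<^sub>R e) y)"
    using E V_sub assms(3) by (intro ip_sum_left) (auto intro: subspace_scale)
  also have "\<dots> = (\<Sum>e\<in>E. g x e * g e y)"
    using E assms(3) by (intro sum.cong) (auto simp: ip_scale_left)
  finally show ?thesis by simp
qed

text \<open>This evaluates the sums over an orthonormal basis in the definition of the extension.\<close>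

lemma linear_form_expansion:
  assumes E: "orthonormal_basis V g E" and F: "lin_on V F" and x: "x \<in> V"
  shows "(\<Sum>e\<in>E. F e * g e x) = F x"
proof -
  have E': "finite E" "\<And>e. e \<in> E \<Longrightarrow> e \<in> V" using E by (auto simp: orthonormal_basis_def)
  have "F x = F (\<Sum>e\<in>E. g x e *\<^sub>R e)" using orthonormal_expansion[OF E x] by simp
  also have "\<dots> = (\<Sum>e\<in>E. g x e *\<^sub>R F e)" by (rule lin_on_sum_scaleR[OF V_sub F E'])
  also have "\<dots> = (\<Sum>e\<in>E. F e * g e x)" using E'(2) x ip_sym by (intro sum.cong) auto
  finally show ?thesis by simp
qed

end

text \<open>In an orthonormal basis of \<open>M\<close>, the isotropy algebra acts by skew matrices.\<close>

lemma (in effective_natred) so_inf_embedding: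
  obtains i where "lie_embedding H br so_inf so_inf_bracket i"
proof -
  obtain E where E: "orthonormal_basis M g E" using orthonormal_basis_exists by blast
  have E': "finite E" "E \<subseteq> M" "span E = M" using E by (auto simp: orthonormal_basis_def)
  obtain e where e: "bij_betw e {..<card E} E" using ex_bij_betw_nat_finite[OF E'(1)] by (auto simp: atLeast0LessThan)
  define n where "n = card E"
  have eM: "e i \<in> M" if "i < n" for i using bij_betwE[OF e] E'(2) that unfolding n_def by blast
  have par: "(\<Sum>l<n. g x (e l) * g (e l) y) = g x y" if "x \<in> M" "y \<in> M" for x y
    using parseval[OF E that] sum.reindex_bij_betw[OF e, of "\<lambda>v. g x v * g v y"] by (simp add: n_def)
  define R where "R h i j = (if i < n \<and> j < n then g (e i) (br h (e j)) else 0)" for h i j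
  have "lin_on H R"
    by (rule lin_onI)
      (auto simp: R_def fun_eq_iff plus_fun_def scaleR_fun_def br_simps HG MG eM ip_simps br_HM)
  then obtain f where f: "linear f" "\<And>h. h \<in> H \<Longrightarrow> f h = R h" using lin_on_extend[OF H_sub] by blast
  have R_zero: "R h i j = 0" if "\<not> i < n \<or> \<not> j < n" for h i j using that by (auto simp: R_def)
  have R_skew: "R h i j = - R h j i" if "h \<in> H" for h i j
  proof (cases "i < n \<and> j < n")
    case True
    have "g (br h (e i)) (e j) = - g (e i) (br h (e j))" using H_skew[OF that] eM True by blast
    moreover have "g (br h (e i)) (e j) = g (e j) (br h (e i))"
      using ip_sym[OF br_HM[OF that eM] eM] True by blast
    ultimately show ?thesis using True by (simp add: R_def)
  qed (auto simp: R_def)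
  have R_so: "R h \<in> so_inf" if h: "h \<in> H" for h
  proof -
    have "\<forall>i j. R h i j = - R h j i" using R_skew[OF h] by blast
    moreover have "\<forall>i j. n \<le> i \<or> n \<le> j \<longrightarrow> R h i j = 0" using R_zero by (simp add: not_less)
    ultimately show ?thesis unfolding so_inf_def by blast
  qed
  have prod: "mat_prod_inf (R h) (R k) i j = g (e i) (br h (br k (e j)))"
    if "h \<in> H" "k \<in> H" "i < n" "j < n" for h k i j
  proof -
    have "mat_prod_inf (R h) (R k) i j = (\<Sum>l<n. R h i l * R k l j)"
      unfolding mat_prod_inf_def using R_zero
      by (intro sum.mono_neutral_left) (auto simp: not_less[symmetric])
    also have "\<dots> = (\<Sum>l<n. - (g (br h (e i)) (e l) * g (e l) (br k (e j))))"
      using that H_skew eM by (intro sum.cong) (auto simp: R_def)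
    also have "\<dots> = - g (br h (e i)) (br k (e j))"
      using par[of "br h (e i)" "br k (e j)"] br_HM eM that by (simp add: sum_negf)
    also have "\<dots> = g (e i) (br h (br k (e j)))" using H_skew br_HM eM that by simp
    finally show ?thesis .
  qed
  have prod0: "mat_prod_inf (R h) (R k) i j = 0" if "\<not> i < n \<or> \<not> j < n" for h k i j
    unfolding mat_prod_inf_def using R_zero that by (auto intro!: sum.neutral)
  have hom: "R (br h k) = so_inf_bracket (R h) (R k)" if hk: "h \<in> H" "k \<in> H" for h k
  proof (intro ext)
    fix i j
    show "R (br h k) i j = so_inf_bracket (R h) (R k) i j"
    proof (cases "i < n \<and> j < n")
      case True
      have "br (br h k) (e j) = br h (br k (e j)) - br k (br h (e j))"
        using jacobi[of h k "e j"] hk True eM HG MG by simp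
      thus ?thesis using True hk prod br_HM eM
        by (simp add: so_inf_bracket_def R_def ip_diff_right fun_diff_def)
    next
      case False
      thus ?thesis using prod0 R_zero by (auto simp: so_inf_bracket_def fun_diff_def)
    qed
  qed
  have inj: "inj_on R H"
  proof (rule inj_onI)
    fix h k assume hk: "h \<in> H" "k \<in> H" "R h = R k"
    have "br (h - k) x = 0" if x: "x \<in> M" for x
    proof -
      have "br (h - k) x \<in> {0}"
      proof (rule br_span_in[of E])
        show "x \<in> span E" using x E'(3) by simp
        show "E \<subseteq> G" using E'(2) MG by blast
        show "h - k \<in> G" using hk HG G_closed by simp
        fix s assume "s \<in> E"
        then obtain j where j: "j < n" "s = e j" using e unfolding n_def bij_betw_def by auto
        have brM: "br (h - k) s \<in> M" using br_HM hk H_closed j eM by simp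
        have "g (br (h - k) s) (e i) = 0" if i: "i < n" for i
        proof -
          have "g (e i) (br h s) = g (e i) (br k s)"
            using fun_cong[OF fun_cong[OF hk(3), of i], of j] i j by (simp add: R_def)
          hence "g (e i) (br (h - k) s) = 0"
            using hk j i eM br_HM HG MG by (simp add: br_simps ip_simps)
          thus ?thesis using ip_sym[OF brM eM[OF i]] by simp
        qed
        hence "g (br (h - k) s) (br (h - k) s) = 0" using par[OF brM brM] by simp
        thus "br (h - k) s \<in> {0}" using ip_eq_0 brM by blast
      qed (auto intro: subspace_single_0)
      thus ?thesis by simp
    qed
    hence "h - k = 0" by (rule effectiveD[OF H_closed(4)[OF hk(1,2)]])
    thus "h = k" by simp
  qed
  have "inj_on f H" using inj f(2) by (auto simp: inj_on_def)
  hence "lie_embedding H br so_inf so_inf_bracket f"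
    unfolding lie_embedding_def using f R_so hom br_HH by auto
  thus thesis by (rule that)
qed

context fiber
begin

abbreviation rho_metric where "rho_metric \<equiv> \<lambda>k l. g (rho k) (rho l)"

lemma Hp_subalgebra: "subalgebra G br Hp"
  using Hp_sub HpG H_Hp(1) HpH by (auto simp: subalgebra_def)

lemma rho_metric_invariant:
  assumes "h \<in> Hp" "k \<in> Hp" "l \<in> Hp"
  shows "rho_metric (br h k) l = - rho_metric k (br h l)"
  using H_skew[OF HpH[OF assms(1)] rho(3)[OF assms(2)] rho(3)[OF assms(3)]] H_Hp(2) HpH assms by simp

lemma inner_product_transport:
  assumes "lin_on Hp th" "inj_on th Hp"
  shows "inner_product_on (th ` Hp) (transport th Hp rho_metric)"
proof -
  have add: "th h + th k = th (h + k)" if "h \<in> Hp" "k \<in> Hp" for h k using assms(1) that by (simp add: lin_on_def)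
  have scale: "c *\<^sub>R th h = th (c *\<^sub>R h)" if "h \<in> Hp" for c h using assms(1) that by (simp add: lin_on_def)
  have zero: "th 0 = 0" by (rule lin_on_0[OF Hp_sub assms(1)])
  have "0 < g (rho h) (rho h)" if "h \<in> Hp" "th h \<noteq> 0" for h
    using ip_pos rho(3)[OF that(1)] rho_0[OF that(1)] zero that(2) by metis
  thus ?thesis
    unfolding inner_product_on_def using rho(3)
    by (auto simp: add scale transport_apply[OF assms(2)] Hp_closed rho_simps ip_simps ip_sym)
qed

lemma extension_pair_transport:
  assumes th: "lin_on Hp th" "inj_on th Hp"
    and hom: "\<And>h k. h \<in> Hp \<Longrightarrow> k \<in> Hp \<Longrightarrow> th (br h k) = brS (th h) (th k)" and S: "th ` Hp \<subseteq> S"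
  shows "extension_pair S brS (th ` Hp) (transport th Hp rho_metric)"
proof -
  interpret Hp: lie Hp br by unfold_locales (rule subalgebra_lie[OF Hp_subalgebra])
  have L: "lie_algebra (th ` Hp) brS" by (rule Hp.lie_algebra_image[OF th(1) hom])
  hence "subalgebra S brS (th ` Hp)" using S by (auto simp: subalgebra_def lie_algebra_def)
  moreover have "ad_invariant (th ` Hp) brS (transport th Hp rho_metric)"
    unfolding ad_invariant_def skew_on_def
    by (auto simp: transport_apply[OF th(2)] Hp.br_in rho_metric_invariant simp flip: hom)
  ultimately show ?thesis using L inner_product_transport[OF th] by (simp add: extension_pair_def)
qed

section \<open>Reconstruction as an extension\<close>

text \<open>Here \<open>k' + rho k'\<close> is the component of \<open>[x, y]\<close> along \<open>A\<close>. By naturality \<open>k'\<close> is dual to the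
  2-form \<open>g ([l, x]) y\<close>, which is how the action of \<open>Hp\<close> on \<open>Mm\<close> enters the torsion and the curvature.\<close>

lemma bracket_M:
  assumes h: "h \<in> Hp" and k: "k \<in> Hp" and x: "x \<in> Mm" and y: "y \<in> Mm"
  obtains u k' v where "u \<in> H0" "k' \<in> Hp" "v \<in> Mm" "brm x y = u + v"
    "\<And>l. l \<in> Hp \<Longrightarrow> g (rho k') (rho l) = - g (br l x) y"
    "pM (br (rho h + x) (rho k + y)) = rho (k' - 2 *\<^sub>R br h k) + (v - br h y + br k x)"
    "pH (br (rho h + x) (rho k + y)) = u + (k' - br h k)"
proof -
  obtain u k' v where *: "u \<in> H0" "k' \<in> Hp" "v \<in> Mm" "br x y = u + (k' + rho k') + v"
    "brm x y = u + v" "pM (br x y) = rho k' + v" using bracket_Mm'[OF x y] by metis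
  have hk: "br h k \<in> Hp" using H_Hp(1)[OF HpH[OF h] k] .
  have "br (rho h + x) (rho k + y) = br (rho h) (rho k) + br (rho h) y + (br x (rho k) + br x y)"
    using h k x y rho MmG by (simp add: br_simps G_closed add_ac)
  also have "\<dots> = (- br h k - 2 *\<^sub>R rho (br h k)) + (- br h y) + (br k x + (u + (k' + rho k') + v))"
    using rho_rho[OF h k] rho_Mm(1)[OF h y] rho_Mm(2)[OF k x] *(4) by simp
  also have "\<dots> = (u + (k' - br h k)) + (rho (k' - 2 *\<^sub>R br h k) + (v - br h y + br k x))"
    using *(2) hk by (simp add: rho_simps Hp_closed)
  finally have e: "br (rho h + x) (rho k + y)
    = (u + (k' - br h k)) + (rho (k' - 2 *\<^sub>R br h k) + (v - br h y + br k x))" .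
  have inH: "u + (k' - br h k) \<in> H" using *(1,2) hk H0H HpH H_closed by simp
  have inM: "rho (k' - 2 *\<^sub>R br h k) + (v - br h y + br k x) \<in> M"
    using rho(3) Hp_closed *(2,3) hk MmM H_Mm HpH h k x y Mm_closed M_closed by simp
  have "g (rho k') (rho l) = - g (br l x) y" if l: "l \<in> Hp" for l
  proof -
    have lx: "br l x \<in> Mm" by (rule H_Mm[OF HpH[OF l] x])
    have "g (rho k') (rho l) = g (pM (br x y)) (rho l)"
      using *(6) rho(3) *(2,3) l MmM Mm_Mp_orth[OF *(3) rho(1)[OF l]] by (simp add: ip_simps)
    also have "\<dots> = - g y (pM (br x (rho l)))" using natural MmM x y rho(3) l by blast
    also have "pM (br x (rho l)) = br l x" using rho_Mm(2)[OF l x] pM_M[OF MmM[OF lx]] by simp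
    finally show ?thesis using ip_sym[OF MmM[OF y] MmM[OF lx]] by simp
  qed
  thus thesis using that[OF *(1,2,3,5)] e pM_add[OF inH inM] pH_add[OF inH inM] by simp
qed

lemma M_elim:
  assumes "a \<in> M"
  obtains h x where "h \<in> Hp" "x \<in> Mm" "a = rho h + x"
  using direct_sum_elim[OF M_direct_sum assms] Mp_elim by metis

lemma M_coordinates:
  assumes "lin_on Hp th"
  obtains f where "linear f" "\<And>h x. h \<in> Hp \<Longrightarrow> x \<in> Mm \<Longrightarrow> f (rho h + x) = (th h, x)"
proof -
  define f where "f a = (th (inv_into Hp rho (proj_along Mp Mm a)), proj_along Mm Mp a)" for a
  have inj: "inj_on rho Hp"
  proof (rule inj_onI)
    fix h k assume hk: "h \<in> Hp" "k \<in> Hp" "rho h = rho k"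
    have "rho (h - k) = 0" using hk by (simp add: rho_simps)
    hence "h - k = 0" by (rule rho_0[OF Hp_closed(4)[OF hk(1,2)]])
    thus "h = k" by simp
  qed
  have MpMm: "Mp \<inter> Mm = {0}" using M_direct_sum by (simp add: direct_sum_def)
  have f: "f (rho h + x) = (th h, x)" if "h \<in> Hp" "x \<in> Mm" for h x
    using proj_along_add[OF Mp_sub Mm_sub MpMm rho(1)[OF that(1)] that(2)] inj that(1)
    by (simp add: f_def)
  have "lin_on M f"
  proof (rule lin_onI)
    fix a b assume "a \<in> M" "b \<in> M"
    then obtain h x k y where *: "h \<in> Hp" "x \<in> Mm" "a = rho h + x" "k \<in> Hp" "y \<in> Mm" "b = rho k + y"
      by (metis M_elim)
    have e: "a + b = rho (h + k) + (x + y)" using * by (simp add: rho_simps add_ac)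
    have "f (a + b) = (th (h + k), x + y)"
      unfolding e by (rule f[OF Hp_closed(2)[OF *(1,4)] Mm_closed(2)[OF *(2,5)]])
    moreover have "f a = (th h, x)" "f b = (th k, y)" using f * by simp_all
    moreover have "th (h + k) = th h + th k" using assms *(1,4) by (simp add: lin_on_def)
    ultimately show "f (a + b) = f a + f b" by (simp only: plus_prod_def fst_conv snd_conv)
  next
    fix c a assume "a \<in> M"
    then obtain h x where *: "h \<in> Hp" "x \<in> Mm" "a = rho h + x" by (metis M_elim)
    have e: "c *\<^sub>R a = rho (c *\<^sub>R h) + c *\<^sub>R x" using * by (simp add: rho_simps scaleR_add_right)
    have "f (c *\<^sub>R a) = (th (c *\<^sub>R h), c *\<^sub>R x)"
      unfolding e by (rule f[OF Hp_closed(3)[OF *(1)] Mm_closed(3)[OF *(2)]])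
    moreover have "f a = (th h, x)" using f * by simp
    moreover have "th (c *\<^sub>R h) = c *\<^sub>R th h" using assms *(1) by (simp add: lin_on_def)
    ultimately show "f (c *\<^sub>R a) = c *\<^sub>R f a" by (simp only: scaleR_prod_def fst_conv snd_conv)
  qed
  then obtain F where F: "linear F" "\<And>a. a \<in> M \<Longrightarrow> F a = f a" using lin_on_extend[OF M_sub] by blast
  have "F (rho h + x) = (th h, x)" if "h \<in> Hp" "x \<in> Mm" for h x
    using F(2) f that rho(3) MmM M_closed(2) by simp
  thus thesis using that F(1) by blast
qed

text \<open>
  The isometry is \<open>rho h + x \<mapsto> (th h, x)\<close>. The map \<open>th\<close> is left open so that it may be the representation
  on \<open>Mm\<close> if that space is non-zero, and an embedding into \<open>so(\<infinity>)\<close> if it is zero. The curvature of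
  the extension contains the operator by which \<open>w\<close> acts, where \<open>w\<close> is minus the \<open>Hp\<close>-part of \<open>[a, b]\<close>: its
  coefficients in the orthonormal basis are the values of the 2-forms \<open>psi e\<close>.
\<close>

lemma isomorphic_extension:
  fixes th :: "'a \<Rightarrow> 'k::real_vector"
  assumes th: "lin_on Hp th" "inj_on th Hp"
    and hom: "\<And>h k. h \<in> Hp \<Longrightarrow> k \<in> Hp \<Longrightarrow> th (br h k) = brS (th h) (th k)"
    and act: "\<And>h x. h \<in> Hp \<Longrightarrow> x \<in> Mm \<Longrightarrow> act (th h) x = br h x"
  shows "isomorphic_models (model_of D)
    (extension_model Dm (th ` Hp) brS act (transport th Hp rho_metric))"
proof -
  define K where "K = th ` Hp"
  define B where "B = transport th Hp rho_metric"
  have B: "B (th h) (th k) = g (rho h) (rho k)" if "h \<in> Hp" "k \<in> Hp" for h k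
    unfolding B_def using transport_apply[OF th(2) that, of rho_metric] by simp
  have Hp_fin: "fin_spanned Hp" by (rule fin_spanned_subspace[OF G_fin Hp_sub]) (use HpG in blast)
  interpret K: ip_space K B
    using inner_product_transport[OF th] lin_on_fin_spanned_image[OF Hp_fin th(1)]
    by unfold_locales (simp_all add: K_def B_def)
  define E where "E = (SOME E. orthonormal_basis K B E)"
  have E: "orthonormal_basis K B E" unfolding E_def by (rule someI_ex[OF K.orthonormal_basis_exists])
  have E': "finite E" "\<And>e. e \<in> E \<Longrightarrow> e \<in> K" using E by (auto simp: orthonormal_basis_def)
  have th_K: "th h \<in> K" if "h \<in> Hp" for h using that by (simp add: K_def)
  have th_add: "th h + th k = th (h + k)" if "h \<in> Hp" "k \<in> Hp" for h k using th(1) that by (simp add: lin_on_def)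
  have th_scale: "c *\<^sub>R th h = th (c *\<^sub>R h)" if "h \<in> Hp" for c h using th(1) that by (simp add: lin_on_def)
  have th_neg: "th (- h) = - th h" if "h \<in> Hp" for h using th_scale[OF that, of "-1"] by simp
  have hk: "br h k \<in> Hp" if "h \<in> Hp" "k \<in> Hp" for h k using H_Hp(1)[OF HpH[OF that(1)] that(2)] .
  have hx: "br h x \<in> Mm" "br h x \<in> M" if "h \<in> Hp" "x \<in> Mm" for h x
    using H_Mm[OF HpH[OF that(1)] that(2)] MmM by auto
  define Q where "Q = extension_model Dm K brS act B"
  define ip' where "ip' = (\<lambda>x y. B (fst x) (fst y) + g (snd x) (snd y))"
  define psi where "psi = (\<lambda>k x. (brS k (fst x), act k (snd x)))"
  have Q: "mspace Q = K \<times> Mm" "mmet Q = ip'"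
    "tors Q = (\<lambda>x y z. tors (model_of Dm) (snd x) (snd y) (snd z)
      + (\<Sum>k\<in>E. g (act k (snd x)) (snd y) * B k (fst z) + g (act k (snd y)) (snd z) * B k (fst x)
        + g (act k (snd z)) (snd x) * B k (fst y)) + 2 * B (brS (fst x) (fst y)) (fst z))"
    "curv Q = (\<lambda>x y z. (0, curv (model_of Dm) (snd x) (snd y) (snd z))
      + (\<Sum>k\<in>E. ip' (psi k x) y *\<^sub>R psi k z))"
    by (simp_all add: Q_def extension_model_def Let_def Dm_simps ip'_def psi_def flip: E_def)
  obtain f where f: "linear f" "\<And>h x. h \<in> Hp \<Longrightarrow> x \<in> Mm \<Longrightarrow> f (rho h + x) = (th h, x)"
    using M_coordinates[OF th(1)] by blast
  have act_lin: "lin_on K (\<lambda>k. g (act k x) y)" if "x \<in> Mm" "y \<in> Mm" for x y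
    by (rule lin_onI)
      (auto simp: K_def th_add th_scale act that Hp_closed br_simps HpG MmG ip_simps hx MmM)
  have mixed: "(\<Sum>k\<in>E. g (act k x) y * B k (th l)) = g (br l x) y"
    if "x \<in> Mm" "y \<in> Mm" "l \<in> Hp" for x y l
    using K.linear_form_expansion[OF E act_lin[OF that(1,2)] th_K[OF that(3)]] act that by simp
  have bij: "bij_betw f M (K \<times> Mm)"
    unfolding bij_betw_def
  proof
    show "inj_on f M"
    proof (rule inj_onI)
      fix a b assume ab: "a \<in> M" "b \<in> M" "f a = f b"
      obtain h x where a: "h \<in> Hp" "x \<in> Mm" "a = rho h + x" using M_elim[OF ab(1)] .
      obtain k y where b: "k \<in> Hp" "y \<in> Mm" "b = rho k + y" using M_elim[OF ab(2)] .
      have "(th h, x) = (th k, y)" using ab(3) f(2)[OF a(1,2)] f(2)[OF b(1,2)] a(3) b(3) by simp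
      thus "a = b" using a b th(2) by (auto simp: inj_on_def)
    qed
    show "f ` M = K \<times> Mm"
    proof
      show "f ` M \<subseteq> K \<times> Mm"
      proof
        fix p assume "p \<in> f ` M"
        then obtain a where a: "a \<in> M" "p = f a" by blast
        obtain h x where "h \<in> Hp" "x \<in> Mm" "a = rho h + x" using M_elim[OF a(1)] .
        thus "p \<in> K \<times> Mm" using a(2) f(2) th_K by simp
      qed
      show "K \<times> Mm \<subseteq> f ` M"
      proof
        fix p assume "p \<in> K \<times> Mm"
        then obtain h x where "h \<in> Hp" "x \<in> Mm" "p = (th h, x)" by (auto simp: K_def)
        thus "p \<in> f ` M" using f(2)[of h x] rho(3) MmM M_closed(2) by (metis image_eqI)
      qed
    qed
  qed
  have metric: "mmet Q (f a) (f b) = g a b" if a: "a \<in> M" and b: "b \<in> M" for a b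
  proof -
    obtain h x where a': "h \<in> Hp" "x \<in> Mm" "a = rho h + x" using M_elim[OF a] .
    obtain k y where b': "k \<in> Hp" "y \<in> Mm" "b = rho k + y" using M_elim[OF b] .
    have "g a b = g (rho h) (rho k) + g x y"
      using a' b' rho(3) MmM Mm_Mp_orth[OF a'(2) rho(1)[OF b'(1)]] Mp_Mm_orth[OF b'(2) rho(1)[OF a'(1)]]
      by (simp add: ip_simps M_closed)
    thus ?thesis unfolding Q a'(3) b'(3) using f(2) a' b' B by (simp add: ip'_def)
  qed
  have torsion: "tors Q (f a) (f b) (f c) = tors (model_of D) a b c"
    if a: "a \<in> M" and b: "b \<in> M" and c: "c \<in> M" for a b c
  proof -
    obtain h x where a': "h \<in> Hp" "x \<in> Mm" "a = rho h + x" using M_elim[OF a] .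
    obtain k y where b': "k \<in> Hp" "y \<in> Mm" "b = rho k + y" using M_elim[OF b] .
    obtain l z where c': "l \<in> Hp" "z \<in> Mm" "c = rho l + z" using M_elim[OF c] .
    obtain u k' v where t: "u \<in> H0" "k' \<in> Hp" "v \<in> Mm" "brm x y = u + v"
      "g (rho k') (rho l) = - g (br l x) y"
      "pM (br (rho h + x) (rho k + y)) = rho (k' - 2 *\<^sub>R br h k) + (v - br h y + br k x)"
      using bracket_M[OF a'(1) b'(1) a'(2) b'(2)] c'(1) by metis
    have m: "v - br h y + br k x \<in> Mm" "rho (k' - 2 *\<^sub>R br h k) \<in> Mp"
      using t(2,3) hx a' b' hk Mm_closed Hp_closed rho(1) by simp_all
    have "g (pM (br a b)) c = g (rho (k' - 2 *\<^sub>R br h k)) (rho l) + g (v - br h y + br k x) z"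
      unfolding a'(3) b'(3) c'(3) t(6)
      using Mm_Mp_orth[OF m(1) rho(1)[OF c'(1)]] Mp_Mm_orth[OF c'(2) m(2)] MmM[OF m(1)] MpM[OF m(2)]
        MmM[OF c'(2)] rho(3)[OF c'(1)] by (simp add: ip_add_left ip_add_right M_closed)
    also have "\<dots> = g (rho k') (rho l) - 2 * g (rho (br h k)) (rho l) + (g v z - g (br h y) z + g (br k x) z)"
      using t(2,3) a' b' c' hk[OF a'(1) b'(1)] hx rho(3) MmM Hp_closed
      by (simp add: rho_simps ip_simps M_closed)
    finally have "g (pM (br a b)) c = - g (br l x) y - 2 * g (rho (br h k)) (rho l)
      + (g v z - g (br h y) z + g (br k x) z)" using t(5) by simp
    moreover have "g (br k x) z = - g (br k z) x"
      using H_skew[OF HpH[OF b'(1)] MmM[OF a'(2)] MmM[OF c'(2)]] ip_sym[OF MmM[OF a'(2)] hx(2)[OF b'(1) c'(2)]]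
      by simp
    ultimately have T: "tors (model_of D) a b c = g (br l x) y + 2 * g (rho (br h k)) (rho l)
      - g v z + g (br h y) z + g (br k z) x"
      using pM_MM[OF a b] c by (simp add: model_simps ip_neg_left)
    have T0: "tors (model_of Dm) x y z = - g v z"
      using t(1,3,4) Dm_split MmM c'(2) by (simp add: model_of_def Dm_simps ip_neg_left)
    have fabc: "f a = (th h, x)" "f b = (th k, y)" "f c = (th l, z)" using f(2) a' b' c' by simp_all
    have "B (brS (th h) (th k)) (th l) = g (rho (br h k)) (rho l)"
      using B[OF hk[OF a'(1) b'(1)] c'(1)] hom[OF a'(1) b'(1)] by simp
    hence "tors Q (f a) (f b) (f c) = - g v z + (g (br l x) y + g (br h y) z + g (br k z) x)
      + 2 * g (rho (br h k)) (rho l)"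
      unfolding Q fabc using T0 mixed a' b' c' by (simp add: sum.distrib)
    thus ?thesis using T by simp
  qed
  have curvature: "curv Q (f a) (f b) (f c) = f (curv (model_of D) a b c)"
    if a: "a \<in> M" and b: "b \<in> M" and c: "c \<in> M" for a b c
  proof -
    obtain h x where a': "h \<in> Hp" "x \<in> Mm" "a = rho h + x" using M_elim[OF a] .
    obtain k y where b': "k \<in> Hp" "y \<in> Mm" "b = rho k + y" using M_elim[OF b] .
    obtain l z where c': "l \<in> Hp" "z \<in> Mm" "c = rho l + z" using M_elim[OF c] .
    obtain u k' v where t: "u \<in> H0" "k' \<in> Hp" "v \<in> Mm" "brm x y = u + v"
      "\<And>l. l \<in> Hp \<Longrightarrow> g (rho k') (rho l) = - g (br l x) y"
      "pH (br (rho h + x) (rho k + y)) = u + (k' - br h k)"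
      using bracket_M[OF a'(1) b'(1) a'(2) b'(2)] by metis
    define w where "w = br h k - k'"
    have w: "w \<in> Hp" using hk[OF a'(1) b'(1)] t(2) Hp_closed(4) w_def by blast
    have pw: "pH (br a b) = u - w" using t(6) a'(3) b'(3) by (simp add: w_def)
    have uz: "br u z \<in> Mm" by (rule H_Mm[OF H0H[OF t(1)] c'(2)])
    have "curv (model_of D) a b c = rho (br w l) + (br w z - br u z)"
      unfolding model_simps pw c'(3)
      using w c' t(1) HpG H0G rho MmG H0_Hp(2)[OF t(1) c'(1)] H_Hp(2)[OF HpH[OF w] c'(1)]
      by (simp add: br_simps G_closed)
    hence R: "f (curv (model_of D) a b c) = (th (br w l), br w z - br u z)"
      using f(2)[OF hk[OF w c'(1)] Mm_closed(4)[OF hx(1)[OF w c'(2)] uz]] by simp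
    have R0: "curv (model_of Dm) x y z = - br u z"
      using t(1,3,4) Dm_split brm_H0_Mm[OF t(1) c'(2)] by (simp add: model_of_def Dm_simps)
    have fabc: "f a = (th h, x)" "f b = (th k, y)" "f c = (th l, z)" using f(2) a' b' c' by simp_all
    have coeff: "ip' (psi e (th h, x)) (th k, y) = B (th w) e" if eK: "e \<in> K" for e
    proof -
      obtain j where j: "j \<in> Hp" "e = th j" using eK by (auto simp: K_def)
      have "ip' (psi e (th h, x)) (th k, y) = g (rho (br j h)) (rho k) + g (br j x) y"
        using B[OF hk[OF j(1) a'(1)] b'(1)] hom[OF j(1) a'(1)] act[OF j(1) a'(2)] j(2)
        by (simp add: ip'_def psi_def)
      moreover have "g (rho (br h k)) (rho j) = g (rho (br j h)) (rho k)"
      proof -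
        have "g (rho (br h k)) (rho j) = - g (rho k) (rho (br h j))"
          by (rule rho_metric_invariant[OF a'(1) b'(1) j(1)])
        also have "rho (br h j) = - rho (br j h)"
          using br_anti[OF HpG[OF a'(1)] HpG[OF j(1)]] rho_simps(5)[OF hk[OF j(1) a'(1)]] by simp
        finally show ?thesis
          using ip_sym rho(3) hk j a' b' by (simp add: ip_neg_right)
      qed
      moreover have "B (th w) e = g (rho (br h k)) (rho j) - g (rho k') (rho j)"
        using B[OF w j(1)] j hk[OF a'(1) b'(1)] t(2) rho(3) by (simp add: w_def rho_simps ip_diff_left)
      ultimately show ?thesis using t(5)[OF j(1)] by simp
    qed
    have psi_lin: "lin_on K (\<lambda>e. psi e (th l, z))"
      by (rule lin_onI)
        (auto simp: K_def psi_def th_add th_scale act c' Hp_closed br_simps HpG MmG hk simp flip: hom)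
    have "(\<Sum>e\<in>E. ip' (psi e (th h, x)) (th k, y) *\<^sub>R psi e (th l, z))
      = (\<Sum>e\<in>E. B (th w) e *\<^sub>R psi e (th l, z))" using coeff E'(2) by (intro sum.cong) auto
    also have "\<dots> = psi (\<Sum>e\<in>E. B (th w) e *\<^sub>R e) (th l, z)"
      by (rule lin_on_sum_scaleR[OF K.V_sub psi_lin E', symmetric])
    also have "\<dots> = psi (th w) (th l, z)" using K.orthonormal_expansion[OF E th_K[OF w]] by simp
    also have "\<dots> = (th (br w l), br w z)" using hom[OF w c'(1)] act[OF w c'(2)] by (simp add: psi_def)
    finally show ?thesis unfolding Q fabc using R R0 by simp
  qed
  have "isomorphic_models (model_of D) Q"
    unfolding isomorphic_models_def
    using f(1) bij metric torsion curvature by (intro exI[of _ f]) (simp add: Q(1) model_simps(1,2))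
  thus ?thesis by (simp add: Q_def K_def B_def)
qed

end

section \<open>The representation on \<open>Mm\<close>\<close>

context fiber
begin

abbreviation phi where "phi \<equiv> phi_rep D A Mm"

text \<open>\<open>Hp\<close> commutes with \<open>H0\<close>, so extending the action on \<open>Mm\<close> by zero yields the adjoint action.\<close>

lemma phi_Gm:
  assumes "l \<in> Hp" "x \<in> Gm"
  shows "phi l x = br l x"
proof -
  obtain h m where hm': "h \<in> H0" "m \<in> Mm" "x = h + m" using Gm_elim[OF assms(2)] .
  have "br l x = br l m" using hm' H0_Hp(3)[OF hm'(1) assms(1)] HpG[OF assms(1)] H0G MmG by (simp add: br_simps)
  thus ?thesis using assms(2) Dm_split(2)[OF hm'(1,2)] hm'(3) by (simp add: phi_rep_def zero_outside_def)
qed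

lemma phi_outside: "x \<notin> Gm \<Longrightarrow> phi l x = 0"
  by (simp add: phi_rep_def zero_outside_def)

lemma phi_lin: "lin_on Hp phi"
proof (rule lin_onI)
  fix h k assume "h \<in> Hp" "k \<in> Hp"
  thus "phi (h + k) = phi h + phi k"
    using Hp_closed(2)[of h k] HpG Gm_G
    by (intro ext, case_tac "x \<in> Gm") (simp_all add: phi_Gm phi_outside plus_fun_def br_simps)
next
  fix c h assume "h \<in> Hp"
  thus "phi (c *\<^sub>R h) = c *\<^sub>R phi h"
    using Hp_closed(3)[of h c] HpG Gm_G
    by (intro ext, case_tac "x \<in> Gm") (simp_all add: phi_Gm phi_outside scaleR_fun_def br_simps)
qed

lemma phi_commutator:
  assumes "h \<in> Hp" "k \<in> Hp"
  shows "phi (br h k) = commutator (phi h) (phi k)"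
proof
  fix x
  have hk: "br h k \<in> Hp" using H_Hp(1)[OF HpH[OF assms(1)] assms(2)] .
  show "phi (br h k) x = commutator (phi h) (phi k) x"
  proof (cases "x \<in> Gm")
    case True
    have "br h (br k x) = br (br h k) x + br k (br h x)"
      by (rule jacobi[OF HpG[OF assms(1)] HpG[OF assms(2)] Gm_G[OF True]])
    thus ?thesis
      using True hk assms H_Gm[OF HpH _] by (simp add: phi_Gm commutator_def)
  next
    case False
    thus ?thesis
      using phi_Gm[OF _ Gm_closed(1)] assms HpG by (simp add: phi_outside commutator_def br_zero_right)
  qed
qed

lemma phi_s_alg:
  assumes l: "l \<in> Hp"
  shows "phi l \<in> s_alg Dm"
proof -
  have lG: "l \<in> G" and lH: "l \<in> H" using l HpG HpH by auto
  have "phi l (brm x y) = brm (phi l x) y + brm x (phi l y)" if x: "x \<in> Gm" and y: "y \<in> Gm" for x y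
  proof -
    obtain z a where za: "z \<in> Gm" "a \<in> A" "br x y = z + a" "brm x y = z" using bracket_Gm[OF x y] .
    have "br l (br x y) = br l z + br l a" using za lG Gm_G AG by (simp add: br_simps)
    hence "Pm (br l (br x y)) = br l z"
      using Pm_add[OF H_Gm[OF lH za(1)] br_A[OF lG za(2)]] by simp
    moreover have "br l (br x y) = br (br l x) y + br x (br l y)"
      using jacobi lG Gm_G x y by blast
    ultimately show ?thesis
      using Pm_add_br br_GmA H_Gm[OF lH] l x y za(1,4) by (simp add: phi_Gm)
  qed
  moreover have "phi l (x + y) = phi l x + phi l y" if "x \<in> Gm" "y \<in> Gm" for x y
    using that l lG Gm_closed Gm_G by (simp add: phi_Gm br_simps)
  moreover have "phi l (c *\<^sub>R x) = c *\<^sub>R phi l x" if "x \<in> Gm" for x c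
    using that l lG Gm_closed Gm_G by (simp add: phi_Gm br_simps)
  ultimately have "phi l \<in> derivations Gm brm"
    unfolding derivations_def using phi_outside H_Gm[OF lH] phi_Gm[OF l] by simp
  moreover have "\<forall>h\<in>H0. phi l h = 0" using phi_Gm[OF l] H0_Gm H0_Hp(3) l by simp
  moreover have "\<forall>x\<in>Mm. phi l x \<in> Mm" using phi_Gm[OF l] Mm_Gm H_Mm[OF lH] by simp
  moreover have "skew_on Mm g (phi l)"
    using phi_Gm[OF l] Mm_Gm H_skew[OF lH] MmM by (simp add: skew_on_def)
  ultimately show ?thesis unfolding s_alg_def Dm_simps by simp
qed

text \<open>Let \<open>K\<close> be the kernel. It is an ideal of \<open>Hp\<close>, so \<open>T(rho K, Mp) \<subseteq> rho K\<close>; and \<open>T(rho K, Mm)\<close> is the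
  action of \<open>K\<close> on \<open>Mm\<close>, which is zero. Hence \<open>rho K\<close> splits off. Its complement contains \<open>Mm\<close>.\<close>

lemma phi_injective:
  assumes irreducible: "\<not> reducible D" and "Mm \<noteq> {0}"
  shows "inj_on phi Hp"
proof -
  define K where "K = {h \<in> Hp. \<forall>x\<in>Mm. br h x = 0}"
  have K_sub: "subspace K"
    unfolding K_def subspace_def using HpG MmG by (auto simp: Hp_closed br_simps)
  have K_Hp: "K \<subseteq> Hp" by (auto simp: K_def)
  have lin: "lin_on K rho" using rho_lin K_Hp by (auto simp: lin_on_def subset_iff)
  have "rho ` K = {0}"
  proof (rule ccontr)
    assume ne: "rho ` K \<noteq> {0}"
    have PMp: "rho ` K \<subseteq> Mp" using rho(1) K_Hp by blast
    have "reducible D"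
    proof (rule reducible_if_invariant)
      show "subspace (rho ` K)" by (rule lin_on_subspace_image[OF K_sub lin])
      show "rho ` K \<subseteq> M" using PMp MpM by blast
      show "rho ` K \<noteq> {0}" by (rule ne)
      show "rho ` K \<noteq> M"
      proof
        assume "rho ` K = M"
        hence "Mm \<subseteq> Mp \<inter> Mm" using PMp MmM by blast
        hence "Mm \<subseteq> {0}" using M_direct_sum unfolding direct_sum_def by blast
        thus False using assms(2) Mm_closed(1) by blast
      qed
      fix p y assume "p \<in> rho ` K" and y: "y \<in> M"
      then obtain k where k: "k \<in> K" "p = rho k" by blast
      obtain l x where lx: "l \<in> Hp" "x \<in> Mm" "y = rho l + x" using M_elim[OF y] .
      have kHp: "k \<in> Hp" and k0: "\<And>x. x \<in> Mm \<Longrightarrow> br k x = 0" using k(1) by (auto simp: K_def)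
      have kl: "br k l \<in> Hp" by (rule H_Hp(1)[OF HpH[OF kHp] lx(1)])
      have "br (br k l) x' = 0" if x': "x' \<in> Mm" for x'
      proof -
        have "br k (br l x') = br (br k l) x' + br l (br k x')"
          by (rule jacobi[OF HpG[OF kHp] HpG[OF lx(1)] MmG[OF x']])
        thus ?thesis
          using k0[OF x'] k0[OF H_Mm[OF HpH[OF lx(1)] x']] HpG[OF lx(1)] by (simp add: br_zero_right)
      qed
      hence klK: "br k l \<in> K" using kl by (simp add: K_def)
      have "br p y = br (rho k) (rho l) + br (rho k) x"
        using k(2) lx rho kHp MmG by (simp add: br_simps)
      also have "\<dots> = - br k l - 2 *\<^sub>R rho (br k l)"
        using rho_rho[OF kHp lx(1)] rho_Mm(1)[OF kHp lx(2)] k0[OF lx(2)] by simp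
      also have "\<dots> = - br k l + rho (- 2 *\<^sub>R br k l)"
        using rho_simps(2)[OF kl, of "-2"] by simp
      finally have e: "br p y = - br k l + rho (- 2 *\<^sub>R br k l)" .
      have "pM (br p y) = rho (- 2 *\<^sub>R br k l)"
        unfolding e by (rule pM_add[OF H_closed(5)[OF HpH[OF kl]] rho(3)[OF Hp_closed(3)[OF kl]]])
      thus "pM (br p y) \<in> rho ` K" using subspace_scale[OF K_sub klK, of "-2"] by (simp only: imageI)
    qed
    thus False using irreducible by simp
  qed
  hence K0: "k = 0" if "k \<in> K" for k using that rho_0 K_Hp by blast
  show ?thesis
  proof (rule inj_onI)
    fix h k assume hk: "h \<in> Hp" "k \<in> Hp" "phi h = phi k"
    have "br (h - k) x = 0" if x: "x \<in> Mm" for x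
      using fun_cong[OF hk(3), of x] phi_Gm hk(1,2) Mm_Gm[OF x] HpG MmG[OF x] by (simp add: br_simps)
    hence "h - k \<in> K" using Hp_closed(4)[OF hk(1,2)] by (simp add: K_def)
    thus "h = k" using K0 by fastforce
  qed
qed

lemma Dm_trivial:
  assumes "Mm = {0}"
  shows "Gm = {0}"
proof -
  have "{br x y |x y. x \<in> Mm \<and> y \<in> Mm} = {0}"
    using assms br_zero_left[OF G_closed(1)] by auto
  hence "bracket_span br Mm Mm = {0}" by (simp add: bracket_span_def)
  hence "H0 = {qH 0}" by (simp add: h_zero_def)
  moreover have "qH 0 = 0" using qH_fiber_split[of 0 0 0] H_closed(1) A_closed(1) Mm_closed(1) by simp
  ultimately show ?thesis using assms by (simp add: set_plus_def)
qed

lemma isomorphic_phi_extension: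
  assumes "inj_on phi Hp"
  shows "extension_pair (s_alg Dm) commutator (phi ` Hp) (transport phi Hp rho_metric)"
    and "isomorphic_models (model_of D) (extension Dm (phi ` Hp) (transport phi Hp rho_metric))"
proof -
  show "extension_pair (s_alg Dm) commutator (phi ` Hp) (transport phi Hp rho_metric)"
    using phi_lin assms phi_commutator phi_s_alg by (intro extension_pair_transport) auto
  show "isomorphic_models (model_of D) (extension Dm (phi ` Hp) (transport phi Hp rho_metric))"
    unfolding extension_def
    using phi_lin assms phi_commutator phi_Gm Mm_Gm by (intro isomorphic_extension) auto
qed

lemma isomorphic_extension_of_zero:
  assumes "Mm = {0}"
  shows "\<exists>i. lie_embedding Hp br so_inf so_inf_bracket i \<and>
    extension_pair so_inf so_inf_bracket (i ` Hp) (transport i Hp rho_metric) \<and>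
    isomorphic_models (model_of D) (extension_of_zero Dm (i ` Hp) (transport i Hp rho_metric))"
proof -
  obtain i where "lie_embedding H br so_inf so_inf_bracket i" by (rule so_inf_embedding)
  hence i: "linear i" "inj_on i H" "i ` H \<subseteq> so_inf"
    "\<And>h k. h \<in> H \<Longrightarrow> k \<in> H \<Longrightarrow> i (br h k) = so_inf_bracket (i h) (i k)"
    by (auto simp: lie_embedding_def)
  have HpH': "Hp \<subseteq> H" using HpH by blast
  have iHp: "inj_on i Hp" "i ` Hp \<subseteq> so_inf"
    using inj_on_subset[OF i(2) HpH'] i(3) HpH' by auto
  have lin: "lin_on Hp i" using i(1) by (simp add: lin_on_def linear_add linear_scale)
  have "lie_embedding Hp br so_inf so_inf_bracket i"
    using i(1,4) iHp HpH by (simp add: lie_embedding_def)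
  moreover have "extension_pair so_inf so_inf_bracket (i ` Hp) (transport i Hp rho_metric)"
    using i(4) HpH by (intro extension_pair_transport[OF lin iHp(1) _ iHp(2)]) auto
  moreover have "isomorphic_models (model_of D)
      (extension_of_zero Dm (i ` Hp) (transport i Hp rho_metric))"
    unfolding extension_of_zero_def
    using i(4) HpH HpG assms by (intro isomorphic_extension[OF lin iHp(1)]) (auto simp: br_zero_right)
  ultimately show ?thesis by blast
qed

lemma g_minus_splitting:
  assumes "\<And>I. lie_ideal G br I \<Longrightarrow> abelian I br \<Longrightarrow> I \<subseteq> A"
  shows "\<exists>M0 V. direct_sum Mm M0 V \<and> lie_direct_sum (alg Dm) (lbr Dm) (H0 + M0) V \<and>
    abelian V (lbr Dm) \<and> (semisimple (H0 + M0) (lbr Dm) \<or> H0 + M0 = {0})"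
proof -
  interpret m: transvection_natred Dm by (rule transvection_natred_Dm)
  have "abelian m.central_part (lbr Dm)"
    unfolding abelian_def
  proof (intro ballI)
    fix v w assume "v \<in> m.central_part" "w \<in> m.central_part"
    thus "lbr Dm v w = 0" using m.MG[of w] by (simp add: m.central_part_def)
  qed
  moreover have "semisimple (H0 + m.central_compl) (lbr Dm) \<or> H0 + m.central_compl = {0}"
    using m.semisimple_if_no_abelian_radical[OF no_abelian_radical[OF assms]]
    by (auto simp: m.centerless_part_def Dm_simps)
  ultimately show ?thesis
    using m.central_direct_sum m.lie_direct_sum_center
    by (intro exI[of _ m.central_compl] exI[of _ m.central_part])
      (simp add: m.centerless_part_def Dm_simps)
qed

end


section \<open>Irreducible transvection algebras\<close>

lemma (in effective_natred) fiber_max_abelian_ideal: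
  assumes "\<not> reducible D" "dim M \<noteq> 1"
  shows "fiber D (max_abelian_ideal G br)"
proof -
  have ideals: "lie_ideal G br I \<and> abelian I br \<and> I \<inter> M = {0}"
    if "I \<in> {I. lie_ideal G br I \<and> abelian I br}" for I
    using that abelian_ideal_trivial_intersection[OF assms] by blast
  have A: "lie_ideal G br (max_abelian_ideal G br)" "abelian (max_abelian_ideal G br) br"
    unfolding max_abelian_ideal_def using span_abelian_ideals[OF ideals] by blast+
  thus ?thesis
    using abelian_ideal_trivial_intersection[OF assms] by unfold_locales
qed

lemma (in fiber) fiber_decompositionD:
  assumes "fiber_decomposition D A Hp' Hm Mp' Mm' Ma"
  shows "Ma = {0}" "Hp' = Hp" "Mp' = Mp" "Mm' = Mm"
proof -
  show Ma: "Ma = {0}" using assms A_M by (simp add: fiber_decomposition_def)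
  have orth: "orth_compl M g {0} = M" by (auto simp: orth_compl_def ip_zero_right)
  have "a_prime D A = A"
    unfolding a_prime_def A_M orth using G_split(2)[OF AG] by blast
  thus "Hp' = Hp" "Mp' = Mp" "Mm' = Mm"
    using assms orth Ma by (simp_all add: fiber_decomposition_def Hp_def Mp_def Mm_def)
qed

theorem theorem3p18:
  fixes D :: "'a::real_vector decomp"
    and A Hp Hm Mp Mm Ma :: "'a set"
  assumes "naturally_reductive D"
    and "transvection D"
    and "\<not> reducible D"
    and "dim (compl D) \<noteq> 1"
    and "A = max_abelian_ideal (alg D) (lbr D)"
    and "fiber_decomposition D A Hp Hm Mp Mm Ma"
  shows "Ma = {0} \<and>
    (let Dm = g_minus D A Mm;
         H0 = isot Dm;
         rho = graph_iso A Mp;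
         rho_g = (\<lambda>k l. met D (rho k) (rho l));
         phi = phi_rep D A Mm
     in
       naturally_reductive (base_space D Mp Mm) \<and>
       transvection Dm \<and>
       isomorphic_decomps (base_space D Mp Mm) Dm \<and>
       (\<exists>M0 V. direct_sum Mm M0 V \<and>
          lie_direct_sum (alg Dm) (lbr Dm) (H0 + M0) V \<and>
          abelian V (lbr Dm) \<and>
          (semisimple (H0 + M0) (lbr Dm) \<or> H0 + M0 = {0})) \<and>
       (if Mm \<noteq> {0} then
          inj_on phi Hp \<and>
          extension_pair (s_alg Dm) commutator (phi ` Hp) (transport phi Hp rho_g) \<and>
          isomorphic_models (model_of D) (extension Dm (phi ` Hp) (transport phi Hp rho_g))
        else
          alg Dm = {0} \<and>
          (\<exists>i. lie_embedding Hp (lbr D) so_inf so_inf_bracket i \<and>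
             extension_pair so_inf so_inf_bracket (i ` Hp) (transport i Hp rho_g) \<and>
             isomorphic_models (model_of D)
               (extension_of_zero Dm (i ` Hp) (transport i Hp rho_g)))))"
proof -
  interpret effective_natred D
    using assms(1,2) by unfold_locales (simp_all add: transvection_def)
  interpret f: fiber D A unfolding assms(5) by (rule fiber_max_abelian_ideal[OF assms(3,4)])
  have maximal: "I \<subseteq> A" if "lie_ideal (alg D) (lbr D) I" "abelian I (lbr D)" for I
    unfolding assms(5) max_abelian_ideal_def using that by (auto intro: span_base)
  note eqs = f.fiber_decompositionD[OF assms(6)]
  have rho: "graph_iso A Mp = f.rho" by (simp add: f.rho_def eqs)
  interpret m: transvection_natred "g_minus D A f.Mm" by (rule f.transvection_natred_Dm)
  have H0: "isot (g_minus D A f.Mm) = h_zero D A f.Mm" by (simp add: f.Dm_simps)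
  have extension: "if f.Mm \<noteq> {0} then
      inj_on f.phi f.Hp \<and>
      extension_pair (s_alg f.Dm) commutator (f.phi ` f.Hp) (transport f.phi f.Hp f.rho_metric) \<and>
      isomorphic_models (model_of D) (extension f.Dm (f.phi ` f.Hp) (transport f.phi f.Hp f.rho_metric))
    else alg f.Dm = {0} \<and>
      (\<exists>i. lie_embedding f.Hp (lbr D) so_inf so_inf_bracket i \<and>
         extension_pair so_inf so_inf_bracket (i ` f.Hp) (transport i f.Hp f.rho_metric) \<and>
         isomorphic_models (model_of D)
           (extension_of_zero f.Dm (i ` f.Hp) (transport i f.Hp f.rho_metric)))"
  proof (split if_split, rule conjI; rule impI)
    assume "f.Mm \<noteq> {0}"
    note inj = f.phi_injective[OF assms(3) this]
    show "inj_on f.phi f.Hp \<and>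
      extension_pair (s_alg f.Dm) commutator (f.phi ` f.Hp) (transport f.phi f.Hp f.rho_metric) \<and>
      isomorphic_models (model_of D) (extension f.Dm (f.phi ` f.Hp) (transport f.phi f.Hp f.rho_metric))"
      by (intro conjI inj f.isomorphic_phi_extension[OF inj])
  next
    assume "\<not> f.Mm \<noteq> {0}"
    hence "f.Mm = {0}" by simp
    thus "alg f.Dm = {0} \<and>
      (\<exists>i. lie_embedding f.Hp (lbr D) so_inf so_inf_bracket i \<and>
         extension_pair so_inf so_inf_bracket (i ` f.Hp) (transport i f.Hp f.rho_metric) \<and>
         isomorphic_models (model_of D)
           (extension_of_zero f.Dm (i ` f.Hp) (transport i f.Hp f.rho_metric)))"
      unfolding f.Dm_simps(1) by (intro conjI f.Dm_trivial f.isomorphic_extension_of_zero)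
  qed
  show ?thesis
    unfolding Let_def eqs(2-4) rho[unfolded eqs(3)] H0
    using eqs(1) f.naturally_reductive_base_space m.transvection f.base_space_isomorphic
      f.g_minus_splitting[OF maximal] extension by (intro conjI)
qed

end
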